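(* Let $\mu,\nu\in\mathrm{M}_0(\mathbb{R}^d)$ be such that at least one of them has infinite mass and suppose $\mu$ vanishes on sets of Hausdorff dimension at most $d-1$. Then $\Gamma_{0,\mathrm{cm}}(\mu,\nu)$ is a singleton, with single element $\gamma$, say, and there exists a closed convex function $\psi:\mathbb{R}^d\to\mathbb{R}\cup\{\infty\}$ with $\mathrm{spt}\,\gamma\subset\partial\psi$ such that $$\gamma(A\times B)=(\mathrm{Id}\times\nabla\psi)_{\#}\mu(A\times B)=\mu\big(A\cap(\nabla\psi)^{-1}(B)\big)$$ for all Borel $A\subset\mathbb{R}^d\setminus\{0\}$ and $B\subset\mathbb{R}^d$, and $$\gamma(\{0\}\times B)=\nu(B)-(\nabla\psi)_{\#}\mu(B)$$ for all Borel $B\subset\mathbb{R}^d$ with $0\notin\mathrm{cl}(B)$. The map $\nabla\psi$ is defined and uniquely determined $\mu$-almost everywhere (that is, $\mu((\mathbb{R}^d\setminus\{0\})\setminus\mathrm{dom}\,\nabla\psi)=0$ and any two such functions $\psi$ have $\mu$-almost everywhere equal gradients). If, in addition, $\gamma$ is proper, then $$\nu(B)=(\nabla\psi)_{\#}\mu(B)=\mu\big((\mathbb{R}^d\setminus\{0\})\cap(\nabla\psi)^{-1}(B)\big)$$ for all Borel $B\subset\mathbb{R}^d\setminus\{0\}$.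
   Context: $\mathrm{M}_0(\mathbb{R}^k)$ denotes the set of nonnegative Borel measures $\mu$ on $\mathbb{R}^k\setminus\{0\}$ such that $\mu(B)<\infty$ for every Borel set $B\subset\mathbb{R}^k\setminus\{0\}$ with $0\notin \mathrm{cl}(B)$ (closure in $\mathbb{R}^k$). The support $\mathrm{spt}\,\mu$ is the set of $x\in\mathbb{R}^k$ such that $\mu(U\setminus\{0\})>0$ for every open $U\subset\mathbb{R}^k$ containing $x$ (so $0$ may belong to $\mathrm{spt}\,\mu$). "$\mu$ vanishes on sets of Hausdorff dimension at most $d-1$" means $\mu(A)=0$ for every Borel $A\subset\mathbb{R}^d\setminus\{0\}$ of Hausdorff dimension at most $d-1$. For $\mu,\nu\in\mathrm{M}_0(\mathbb{R}^d)$, a zero-coupling between $\mu$ and $\nu$ is a nonnegative Borel measure $\gamma$ on $(\mathbb{R}^d\times\mathbb{R}^d)\setminus\{(0,0)\}$ such that $\gamma(A\times\mathbb{R}^d)=\mu(A)$ and $\gamma(\mathbb{R}^d\times A)=\nu(A)$ for all Borel $A\subset\mathbb{R}^d\setminus\{0\}$; any such $\gamma$ belongs to $\mathrm{M}_0(\mathbb{R}^d\times\mathbb{R}^d)=\mathrm{M}_0(\mathbb{R}^{2d})$. $\Gamma_{0,\mathrm{cm}}(\mu,\nu)$ is the set of zero-couplings $\gamma$ such that $\mathrm{spt}\,\gamma$ is cyclically monotone. A set $T\subset\mathbb{R}^d\times\mathbb{R}^d$ is cyclically monotone if for every integer $n\ge 2$ and all $(x_1,y_1),\dots,(x_n,y_n)\in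 T$, with $y_{n+1}:=y_1$, one has $\sum_{i=1}^n\langle x_i,y_i\rangle\ge\sum_{i=1}^n\langle x_i,y_{i+1}\rangle$. A zero-coupling $\gamma$ is proper if $\gamma(\{0\}\times(\mathbb{R}^d\setminus\{0\}))=0$. A convex function $\psi:\mathbb{R}^d\to\mathbb{R}\cup\{\infty\}$ is closed if its epigraph is closed; $\mathrm{dom}\,\psi=\{\psi<\infty\}$; $\partial\psi=\{(x,v)\in\mathrm{dom}\,\psi\times\mathbb{R}^d:\forall y\in\mathbb{R}^d,\ \psi(y)\ge\psi(x)+\langle y-x,v\rangle\}$; $\mathrm{dom}\,\nabla\psi$ is the set of points where $\psi$ is (finite and) differentiable, and $(\nabla\psi)^{-1}(B)=\{x\in\mathrm{dom}\,\nabla\psi:\nabla\psi(x)\in B\}$. For $\mu$ a measure on $\mathbb{R}^d\setminus\{0\}$, $(\nabla\psi)_{\#}\mu(B)=\mu\big((\nabla\psi)^{-1}(B)\setminus\{0\}\big)$ for Borel $B\subset\mathbb{R}^d$, and $(\mathrm{Id}\times\nabla\psi)_{\#}\mu$ is the push-forward on $\mathbb{R}^d\times\mathbb{R}^d$ of $\mu$ by $x\mapsto(x,\nabla\psi(x))$, defined on $\mathrm{dom}\,\nabla\psi\setminus\{0\}$. *)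

theory Defs
  imports "HOL-Analysis.Analysis"
begin

section \<open>Hausdorff dimension\<close>

(* Coverings range over bounded sets only, because the library's diameter is a junk value on
   unbounded ones. The conventions diam({})^s = 0 and diam(U)^0 = 1 for nonempty U are spelled out
   since 0 powr 0 = 0 in the library; so the case s = 0 is the counting measure. *)

definition diam_power :: "real \<Rightarrow> 'a::metric_space set \<Rightarrow> ennreal" where
  "diam_power s U =
     (if U = {} then 0 else if s = 0 then 1 else ennreal (diameter U powr s))"

definition hausdorff_premeasure :: "real \<Rightarrow> real \<Rightarrow> 'a::metric_space set \<Rightarrow> ennreal" where
  "hausdorff_premeasure s \<delta> A =
     Inf {(\<Sum>i. diam_power s (U i)) | U :: nat \<Rightarrow> 'a set.
            (\<forall>i. bounded (U i) \<and> diameter (U i) \<le> \<delta>) \<and> A \<subseteq> (\<Union>i. U i)}"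

definition hausdorff_measure :: "real \<Rightarrow> 'a::metric_space set \<Rightarrow> ennreal" where
  "hausdorff_measure s A = (SUP \<delta>\<in>{0<..}. hausdorff_premeasure s \<delta> A)"

definition hausdorff_dim :: "'a::metric_space set \<Rightarrow> ereal" where
  "hausdorff_dim A = Inf {ereal s | s. 0 \<le> s \<and> hausdorff_measure s A = 0}"


section \<open>Measures on a punctured Euclidean space and zero-couplings\<close>

abbreviation punctured_borel :: "'a::euclidean_space measure" where
  "punctured_borel \<equiv> restrict_space borel (- {0})"

definition M0 :: "'a::euclidean_space measure set" where
  "M0 = {\<mu>. sets \<mu> = sets punctured_borel \<and>
             (\<forall>B\<in>sets borel. 0 \<notin> closure B \<longrightarrow> emeasure \<mu> B < \<infinity>)}"

definition spt :: "'a::euclidean_space measure \<Rightarrow> 'a set" where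
  "spt \<mu> = {x. \<forall>U. open U \<longrightarrow> x \<in> U \<longrightarrow> emeasure \<mu> (U - {0}) > 0}"

definition zero_coupling ::
    "'a::euclidean_space measure \<Rightarrow> 'a measure \<Rightarrow> ('a \<times> 'a) measure \<Rightarrow> bool" where
  "zero_coupling \<mu> \<nu> \<gamma> \<longleftrightarrow>
     sets \<gamma> = sets punctured_borel \<and>
     (\<forall>A\<in>sets borel. A \<subseteq> - {0} \<longrightarrow>
        emeasure \<gamma> (A \<times> UNIV) = emeasure \<mu> A \<and>
        emeasure \<gamma> (UNIV \<times> A) = emeasure \<nu> A)"

definition proper_coupling :: "('a::euclidean_space \<times> 'a) measure \<Rightarrow> bool" where
  "proper_coupling \<gamma> \<longleftrightarrow> emeasure \<gamma> ({0} \<times> (- {0})) = 0"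

definition cyclically_monotone :: "('a::real_inner \<times> 'a) set \<Rightarrow> bool" where
  "cyclically_monotone T \<longleftrightarrow>
     (\<forall>n\<ge>2. \<forall>x y :: nat \<Rightarrow> 'a. (\<forall>i<n. (x i, y i) \<in> T) \<longrightarrow>
        (\<Sum>i<n. x i \<bullet> y i) \<ge> (\<Sum>i<n. x i \<bullet> y (Suc i mod n)))"

definition Gamma0cm ::
    "'a::euclidean_space measure \<Rightarrow> 'a measure \<Rightarrow> ('a \<times> 'a) measure set" where
  "Gamma0cm \<mu> \<nu> = {\<gamma>. zero_coupling \<mu> \<nu> \<gamma> \<and> cyclically_monotone (spt \<gamma>)}"


section \<open>Extended-valued convex functions\<close>

definition ereal_epigraph :: "('a \<Rightarrow> ereal) \<Rightarrow> ('a \<times> real) set" where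
  "ereal_epigraph \<psi> = {(x, t). \<psi> x \<le> ereal t}"

(* Infinity is an allowed value and minus infinity is not; in ereal, 0 * \<infinity> = 0. *)
definition closed_convex_fun :: "('a::euclidean_space \<Rightarrow> ereal) \<Rightarrow> bool" where
  "closed_convex_fun \<psi> \<longleftrightarrow>
     (\<forall>x. \<psi> x \<noteq> - \<infinity>) \<and>
     (\<forall>x y. \<forall>t\<in>{0..1}. \<psi> ((1 - t) *\<^sub>R x + t *\<^sub>R y) \<le> ereal (1 - t) * \<psi> x + ereal t * \<psi> y) \<and>
     closed (ereal_epigraph \<psi>)"

definition subdiff :: "('a::euclidean_space \<Rightarrow> ereal) \<Rightarrow> ('a \<times> 'a) set" where
  "subdiff \<psi> = {(x, v). \<psi> x < \<infinity> \<and> (\<forall>y. \<psi> y \<ge> \<psi> x + ereal ((y - x) \<bullet> v))}"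

(* Differentiability at x forces finiteness near x, which has to be required separately because
   real_of_ereal maps \<infinity> to 0. *)
definition has_grad :: "('a::euclidean_space \<Rightarrow> ereal) \<Rightarrow> 'a \<Rightarrow> 'a \<Rightarrow> bool" where
  "has_grad \<psi> x v \<longleftrightarrow>
     (\<forall>\<^sub>F y in nhds x. \<bar>\<psi> y\<bar> \<noteq> \<infinity>) \<and> GDERIV (\<lambda>y. real_of_ereal (\<psi> y)) x :> v"

definition dom_grad :: "('a::euclidean_space \<Rightarrow> ereal) \<Rightarrow> 'a set" where
  "dom_grad \<psi> = {x. \<exists>v. has_grad \<psi> x v}"

definition grad :: "('a::euclidean_space \<Rightarrow> ereal) \<Rightarrow> 'a \<Rightarrow> 'a" where
  "grad \<psi> x = (THE v. has_grad \<psi> x v)"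

definition grad_vimage :: "('a::euclidean_space \<Rightarrow> ereal) \<Rightarrow> 'a set \<Rightarrow> 'a set" where
  "grad_vimage \<psi> B = {x \<in> dom_grad \<psi>. grad \<psi> x \<in> B}"

(* For a measure \<mu> on the punctured space, restrict_space \<mu> (dom_grad \<psi>) lives on
   dom_grad \<psi> - {0}, so the origin is excluded in both push-forwards. *)

definition grad_push ::
    "('a::euclidean_space \<Rightarrow> ereal) \<Rightarrow> 'a measure \<Rightarrow> 'a measure" where
  "grad_push \<psi> \<mu> = distr (restrict_space \<mu> (dom_grad \<psi>)) borel (grad \<psi>)"

definition id_grad_push ::
    "('a::euclidean_space \<Rightarrow> ereal) \<Rightarrow> 'a measure \<Rightarrow> ('a \<times> 'a) measure" where
  "id_grad_push \<psi> \<mu> = distr (restrict_space \<mu> (dom_grad \<psi>)) borel (\<lambda>x. (x, grad \<psi> x))"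

end

(* Existence: discretize \<nu> to finitely many atoms y. The semidiscrete problem is solved by
   x \<mapsto> max (0, max (x . y - b(y))), where b is the least nonnegative weight for which no cell has more
   \<mu>-mass than its atom; a cell is saturated unless b(y) = 0, i.e. unless y is a subgradient at 0, so all
   mass defects sit over x = 0. The graphs have a Kuratowski limit T, which is cyclically monotone and
   so contained in a subdifferential of some \<psi>; the gradients converge \<mu>-almost everywhere, because \<mu> does
   not charge the points where a subdifferential is multivalued. Then \<gamma> is the image of \<mu> under
   (Id, grad \<psi>) plus the mass of \<nu> that this leaves over, placed on {0} x R^d.

   Uniqueness: both supports contain (0, 0) since one mass is infinite, so the two potentials can be
   taken nonnegative with value 0 at 0. For c > 0 the set {\<psi>1 > \<psi>2 + c} has finite \<mu>-mass, and Aleksandrov's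
   argument shows that almost everywhere on it grad \<psi>2 takes values in its image under the
   subdifferential of \<psi>1. Letting c increase to \<psi>1(x) - \<psi>2(x) gives grad \<psi>1 = grad \<psi>2 on {\<psi>1 > \<psi>2}. On
   {\<psi>1 = \<psi>2} different gradients would make the subdifferential of max(\<psi>1, \<psi>2) multivalued. *)

theory Submission
  imports Defs "HOL-Library.Diagonal_Subsequence"
begin


section \<open>Hausdorff dimension of Lipschitz images of hyperplanes\<close>

text \<open>Both measures may have infinite mass near the origin, so total masses cannot be compared
  and mass cannot be subtracted freely. Counting arguments are therefore confined to sets of finite
  mass: sets at positive distance from \<open>0\<close>, half-spaces not containing it, and the sets
  where one potential exceeds the other by a fixed amount. The zero inside the maximum is the
  potential of an atom at \<open>0\<close> of unlimited capacity. The limit is taken on graphs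
  instead of measures: a Kuratowski limit always exists along a subsequence and inherits cyclic
  monotonicity, and almost everywhere convergence of selections takes the place of weak convergence
  of plans. Geometric null sets are reduced to a single kind, the points where a subdifferential is
  multivalued. Hyperplanes and supported points of convex sets arise from indicator functions, and
  points where two equal potentials have different gradients arise from their maximum. Such sets are
  projections of F-sigma sets, which in Euclidean space are sigma-compact; this also settles
  measurability.\<close>

lemma hausdorff_premeasure_finite_cover:
  fixes U :: "'i \<Rightarrow> 'a::metric_space set"
  assumes "finite I" "A \<subseteq> (\<Union>i\<in>I. U i)" "\<And>i. i \<in> I \<Longrightarrow> bounded (U i)"
    and "\<And>i. i \<in> I \<Longrightarrow> diameter (U i) \<le> r" "0 \<le> r" "r \<le> \<delta>" "0 < s"
  shows "hausdorff_premeasure s \<delta> A \<le> ennreal (real (card I) * r powr s)"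
proof -
  obtain h where h: "bij_betw h {0..<card I} I"
    using ex_bij_betw_nat_finite[OF assms(1)] by blast
  \<comment> \<open>The finite cover is padded to a sequence by empty sets, which
    \<open>diam_power\<close> counts as \<open>0\<close>.\<close>
  define V where "V n = (if n < card I then U (h n) else {})" for n
  have hI: "h n \<in> I" if "n < card I" for n
    using h that by (auto simp: bij_betw_def)
  have V: "\<forall>i. bounded (V i) \<and> diameter (V i) \<le> \<delta>"
    using assms(3-6) hI by (auto simp: V_def intro: order_trans)
  have "A \<subseteq> (\<Union>n. V n)"
  proof
    fix x assume "x \<in> A"
    then obtain i where i: "i \<in> I" "x \<in> U i" using assms(2) by blast
    then obtain n where "n < card I" "h n = i"
      using h by (metis atLeastLessThan_iff bij_betw_iff_bijections)
    then show "x \<in> (\<Union>n. V n)" using i by (auto simp: V_def intro!: exI[of _ n])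
  qed
  then have "hausdorff_premeasure s \<delta> A \<le> (\<Sum>i. diam_power s (V i))"
    unfolding hausdorff_premeasure_def using V by (intro Inf_lower) blast
  also have "\<dots> = (\<Sum>i<card I. diam_power s (V i))"
    by (rule suminf_finite) (auto simp: V_def diam_power_def)
  also have "\<dots> \<le> (\<Sum>i<card I. ennreal (r powr s))"
  proof (rule sum_mono)
    fix i assume "i \<in> {..<card I}"
    then have "diameter (V i) \<le> r" "bounded (V i)" using assms(3,4) hI by (auto simp: V_def)
    then show "diam_power s (V i) \<le> ennreal (r powr s)"
      using \<open>0 < s\<close> diameter_ge_0[of "V i"]
      by (auto simp: diam_power_def intro!: ennreal_leI powr_mono2)
  qed
  also have "\<dots> = ennreal (real (card I) * r powr s)"
    by (simp add: ennreal_mult'' ennreal_of_nat_eq_real_of_nat)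
  finally show ?thesis .
qed

text \<open>Stated at a fixed scale \<delta>, since nullity is later verified scale by scale. Covers
  of cost below \<open>e / 2 ^ Suc n\<close> are merged through \<open>prod_decode\<close>.\<close>

lemma hausdorff_premeasure_UN_nat_null:
  fixes A :: "nat \<Rightarrow> 'a::metric_space set"
  assumes "\<And>n. hausdorff_premeasure s \<delta> (A n) = 0"
  shows "hausdorff_premeasure s \<delta> (\<Union>n. A n) = 0"
proof -
  have "hausdorff_premeasure s \<delta> (\<Union>n. A n) \<le> 0 + ennreal e" if "0 < e" for e
  proof -
    define t where "t n = ennreal (e * (1/2) ^ Suc n)" for n
    have tpos: "0 < t n" for n using that by (simp add: t_def)
    have "\<exists>U :: nat \<Rightarrow> 'a set. ((\<forall>i. bounded (U i) \<and> diameter (U i) \<le> \<delta>) \<and> A n \<subseteq> (\<Union>i. U i))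
            \<and> (\<Sum>i. diam_power s (U i)) < t n" for n
    proof -
      have "hausdorff_premeasure s \<delta> (A n) < t n" using assms tpos by simp
      then show ?thesis unfolding hausdorff_premeasure_def Inf_less_iff by blast
    qed
    then obtain U :: "nat \<Rightarrow> nat \<Rightarrow> 'a set" where U: "\<And>n. (\<forall>i. bounded (U n i) \<and> diameter (U n i) \<le> \<delta>)"
      "\<And>n. A n \<subseteq> (\<Union>i. U n i)" "\<And>n. (\<Sum>i. diam_power s (U n i)) < t n"
      by metis
    define V where "V k = (case prod_decode k of (n, i) \<Rightarrow> U n i)" for k
    have "(\<Union>n. A n) \<subseteq> (\<Union>k. V k)"
    proof
      fix x assume "x \<in> (\<Union>n. A n)"
      then obtain n i where "x \<in> U n i" using U(2) by blast
      then show "x \<in> (\<Union>k. V k)"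
        by (auto simp: V_def intro!: exI[of _ "prod_encode (n, i)"])
    qed
    moreover have "\<forall>k. bounded (V k) \<and> diameter (V k) \<le> \<delta>"
      using U(1) by (auto simp: V_def split: prod.split)
    ultimately have "hausdorff_premeasure s \<delta> (\<Union>n. A n) \<le> (\<Sum>k. diam_power s (V k))"
      unfolding hausdorff_premeasure_def by (intro Inf_lower) blast
    also have "\<dots> = (\<Sum>k. (\<lambda>(n, i). diam_power s (U n i)) (prod_decode k))"
      by (simp add: V_def case_prod_beta)
    also have "\<dots> = (\<Sum>n. \<Sum>i. diam_power s (U n i))"
      by (rule suminf_ennreal_2dimen) simp
    also have "\<dots> \<le> (\<Sum>n. t n)"
      using U(3) by (intro suminf_le) (auto intro: less_imp_le)
    also have "\<dots> = ennreal e"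
    proof -
      have "(\<lambda>n. e * (1/2) ^ Suc n) sums (e * 1)"
        by (intro sums_mult) (rule power_half_series)
      then show ?thesis unfolding t_def using that
        by (intro suminf_ennreal_eq) auto
    qed
    finally show ?thesis by simp
  qed
  then have "hausdorff_premeasure s \<delta> (\<Union>n. A n) \<le> 0"
    by (rule ennreal_le_epsilon)
  then show ?thesis by simp
qed

lemma hausdorff_premeasure_UN_null:
  fixes A :: "'i \<Rightarrow> 'a::metric_space set"
  assumes "countable I" "\<And>i. i \<in> I \<Longrightarrow> hausdorff_premeasure s \<delta> (A i) = 0" "0 \<le> \<delta>"
  shows "hausdorff_premeasure s \<delta> (\<Union>i\<in>I. A i) = 0"
proof (cases "I = {}")
  case True
  have "hausdorff_premeasure s \<delta> ({} :: 'a set) \<le> (\<Sum>i::nat. diam_power s ({} :: 'a set))"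
    unfolding hausdorff_premeasure_def using assms(3)
    by (intro Inf_lower CollectI exI[of _ "\<lambda>_. {}"]) auto
  then show ?thesis using True by (simp add: diam_power_def)
next
  case False
  have "(\<Union>n. A (from_nat_into I n)) = (\<Union>i\<in>range (from_nat_into I). A i)" by simp
  also have "range (from_nat_into I) = I" by (rule range_from_nat_into[OF False assms(1)])
  finally show ?thesis
    using hausdorff_premeasure_UN_nat_null[of s \<delta> "\<lambda>n. A (from_nat_into I n)"] assms(2) from_nat_into[OF False]
    by metis
qed

text \<open>The relation \<open>R\<close> is the graph of a 1-Lipschitz map from a bounded piece of a coordinate
  hyperplane; its image is covered by the images of the cells of a grid in that hyperplane.\<close>

lemma hausdorff_premeasure_hyperplane_image_null:
  fixes R :: "('a::euclidean_space \<times> 'a) set"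
  assumes lip: "\<And>x z x' z'. (x, z) \<in> R \<Longrightarrow> (x', z') \<in> R \<Longrightarrow> norm (x - x') \<le> norm (z - z')"
    and e: "e \<in> Basis" "\<And>x z. (x, z) \<in> R \<Longrightarrow> z \<bullet> e = q"
    and m: "\<And>x z b. (x, z) \<in> R \<Longrightarrow> b \<in> Basis \<Longrightarrow> \<bar>z \<bullet> b\<bar> \<le> m" "0 < m"
    and s: "real DIM('a) - 1 < s" and \<delta>: "0 < \<delta>"
  shows "hausdorff_premeasure s \<delta> (fst ` R) = 0"
proof -
  let ?D = "DIM('a)"
  have D1: "?D \<ge> 1" by (simp add: Suc_leI)
  have s0: "0 < s" using s D1 by linarith
  \<comment> \<open>Bounds the diameter of the image of a grid cell of side \<open>m / K\<close>:
    the Euclidean norm is at most the sum of the absolute coordinates, each contributing at most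
    \<open>m / K\<close>.\<close>
  define r where "r K = real ?D * m / real K" for K :: nat
  \<comment> \<open>There are \<open>(2 K + 1) ^ (DIM('a) - 1)\<close> cells, at most
    \<open>(3 K) ^ (DIM('a) - 1)\<close>, each of cost at most \<open>r K powr s\<close>. Apart from
    the constant \<open>C\<close> this is a negative power of \<open>K\<close>.\<close>
  define C where "C = 3 ^ (?D - 1) * (real ?D * m) powr s"
  have bound: "hausdorff_premeasure s \<delta> (fst ` R) \<le> ennreal (C * real K powr (real ?D - 1 - s))"
    if K: "0 < K" "r K \<le> \<delta>" for K
  proof -
    define I where "I = (\<Pi>\<^sub>E b\<in>Basis - {e}. {- int K..int K})"
    define U where "U f = {x. \<exists>z. (x, z) \<in> R \<and> (\<forall>b\<in>Basis - {e}. \<lfloor>(z \<bullet> b) * real K / m\<rfloor> = f b)}"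
      for f :: "'a \<Rightarrow> int"
    have fin: "finite I" unfolding I_def by (intro finite_PiE) auto
    have cardI: "card I = (2 * K + 1) ^ (?D - 1)"
      unfolding I_def using e by (subst card_PiE) (auto simp: card_Diff_singleton prod_constant nat_add_distrib nat_mult_distrib)
    have cov: "fst ` R \<subseteq> (\<Union>f\<in>I. U f)"
    proof
      fix x assume "x \<in> fst ` R"
      then obtain z where z: "(x, z) \<in> R" by auto
      define f where "f = restrict (\<lambda>b. \<lfloor>(z \<bullet> b) * real K / m\<rfloor>) (Basis - {e})"
      have "\<lfloor>(z \<bullet> b) * real K / m\<rfloor> \<in> {- int K..int K}" if b: "b \<in> Basis" for b
      proof -
        have "\<bar>(z \<bullet> b) * real K / m\<bar> \<le> real K"
          using mult_right_mono[OF m(1)[OF z b], of "real K"] m(2)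
          by (simp add: abs_mult pos_divide_le_eq mult.commute)
        then have "- real K \<le> (z \<bullet> b) * real K / m" "(z \<bullet> b) * real K / m \<le> real K" by linarith+
        then show ?thesis by (simp add: le_floor_iff floor_le_iff)
      qed
      then have "f \<in> I" unfolding I_def f_def by (intro restrict_PiE_iff[THEN iffD2]) blast
      moreover have "x \<in> U f" using z by (auto simp: U_def f_def)
      ultimately show "x \<in> (\<Union>f\<in>I. U f)" by blast
    qed
    have dist: "norm (x - x') \<le> r K" if "x \<in> U f" "x' \<in> U f" for x x' f
    proof -
      obtain z z' where z: "(x, z) \<in> R" "(x', z') \<in> R"
        "\<forall>b\<in>Basis - {e}. \<lfloor>(z \<bullet> b) * real K / m\<rfloor> = \<lfloor>(z' \<bullet> b) * real K / m\<rfloor>"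
        using \<open>x \<in> U f\<close> \<open>x' \<in> U f\<close> unfolding U_def by force
      have "norm (z - z') \<le> (\<Sum>b\<in>Basis. \<bar>(z - z') \<bullet> b\<bar>)" by (rule norm_le_l1)
      also have "\<dots> \<le> (\<Sum>b\<in>(Basis::'a set). m / real K)"
      proof (rule sum_mono)
        fix b :: 'a assume b: "b \<in> Basis"
        show "\<bar>(z - z') \<bullet> b\<bar> \<le> m / real K"
        proof (cases "b = e")
          case True then show ?thesis using e z m(2) by (auto simp: inner_diff_left)
        next
          case False
          then have "\<lfloor>(z \<bullet> b) * real K / m\<rfloor> = \<lfloor>(z' \<bullet> b) * real K / m\<rfloor>" using z b by auto
          then have "\<bar>(z \<bullet> b) * real K / m - (z' \<bullet> b) * real K / m\<bar> \<le> 1" by linarith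
          then have "\<bar>((z - z') \<bullet> b) * (real K / m)\<bar> \<le> 1"
            by (simp add: inner_diff_left diff_divide_distrib left_diff_distrib)
          then show ?thesis using K m(2) by (simp add: abs_mult field_simps)
        qed
      qed
      also have "\<dots> = r K" by (simp add: r_def)
      finally show ?thesis using lip[OF z(1,2)] by linarith
    qed
    have r0: "0 \<le> r K" using m by (simp add: r_def)
    have bd: "bounded (U f)" for f
    proof (cases "U f = {}")
      case False
      then obtain x where "x \<in> U f" by blast
      then have "U f \<subseteq> cball x (r K)" using dist by (auto simp: dist_norm)
      then show ?thesis by (rule bounded_subset[OF bounded_cball])
    qed auto
    have "hausdorff_premeasure s \<delta> (fst ` R) \<le> ennreal (real (card I) * r K powr s)"
      by (rule hausdorff_premeasure_finite_cover[OF fin cov]) (auto simp: bd r0 K s0 intro!: diameter_le dist)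
    also have "\<dots> \<le> ennreal (C * real K powr (real ?D - 1 - s))"
    proof (rule ennreal_leI)
      have "real (card I) \<le> (3 * real K) ^ (?D - 1)"
        unfolding cardI of_nat_power using K by (intro power_mono) auto
      also have "\<dots> = 3 ^ (?D - 1) * real K powr (real ?D - 1)"
        using K D1 by (simp add: power_mult_distrib powr_realpow[symmetric] of_nat_diff)
      finally have "real (card I) * r K powr s \<le> 3 ^ (?D - 1) * real K powr (real ?D - 1) * r K powr s"
        by (intro mult_right_mono) auto
      also have "\<dots> = 3 ^ (?D - 1) * real K powr (real ?D - 1) * ((real ?D * m) powr s * real K powr (- s))"
        using m K by (simp add: r_def powr_divide powr_minus_divide)
      also have "3 ^ (?D - 1) * real K powr (real ?D - 1) * ((real ?D * m) powr s * real K powr (- s))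
           = C * real K powr (real ?D - 1 - s)"
        using powr_add[of "real K" "real ?D - 1" "- s"] by (simp add: C_def)
      finally show "real (card I) * r K powr s \<le> C * real K powr (real ?D - 1 - s)" .
    qed
    finally show ?thesis .
  qed
  have "(\<lambda>K. real ?D * m / real K) \<longlonglongrightarrow> 0" by (rule lim_const_over_n)
  then have "\<forall>\<^sub>F K in sequentially. r K < \<delta>"
    unfolding r_def using \<delta> by (rule order_tendstoD)
  then have ev: "\<forall>\<^sub>F K in sequentially. hausdorff_premeasure s \<delta> (fst ` R) \<le> ennreal (C * real K powr (real ?D - 1 - s))"
    using eventually_gt_at_top[of 0] by eventually_elim (intro bound, auto)
  have "(\<lambda>K. real K powr (real ?D - 1 - s)) \<longlonglongrightarrow> 0"
    using s by (intro tendsto_neg_powr filterlim_real_sequentially) auto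
  then have "(\<lambda>K. C * real K powr (real ?D - 1 - s)) \<longlonglongrightarrow> C * 0"
    by (intro tendsto_mult tendsto_const)
  then have "(\<lambda>K. ennreal (C * real K powr (real ?D - 1 - s))) \<longlonglongrightarrow> ennreal 0"
    by (intro tendsto_ennrealI) simp
  from tendsto_lowerbound[OF this ev] show ?thesis by simp
qed

text \<open>A supremum over scales of zeros is zero, so premeasures suffice; every exponent above
  \<open>t\<close> then bounds the dimension.\<close>

lemma hausdorff_dim_le:
  assumes "0 \<le> t" "\<And>s \<delta>. t < s \<Longrightarrow> 0 < \<delta> \<Longrightarrow> hausdorff_premeasure s \<delta> A = 0"
  shows "hausdorff_dim A \<le> ereal t"
proof (rule ereal_le_epsilon2)
  fix e :: real assume "0 < e"
  have "hausdorff_measure (t + e) A = 0"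
    unfolding hausdorff_measure_def using assms(2) \<open>0 < e\<close> by (intro SUP_eq_const) auto
  then have "hausdorff_dim A \<le> ereal (t + e)"
    unfolding hausdorff_dim_def using assms(1) \<open>0 < e\<close> by (intro Inf_lower) auto
  then show "hausdorff_dim A \<le> ereal t + ereal e" by simp
qed

lemma hausdorff_premeasure_mono:
  assumes "A \<subseteq> B" shows "hausdorff_premeasure s \<delta> A \<le> hausdorff_premeasure s \<delta> B"
  unfolding hausdorff_premeasure_def using assms by (intro Inf_superset_mono) blast


section \<open>Subdifferentials of closed convex functions\<close>

lemma closed_convex_finite: "closed_convex_fun \<psi> \<Longrightarrow> \<psi> x < \<infinity> \<Longrightarrow> \<exists>r. \<psi> x = ereal r"
  by (cases "\<psi> x") (auto simp: closed_convex_fun_def)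

text \<open>Points where \<psi> is infinite impose no condition, so only inequalities between reals
  remain; later arguments use this form to stay clear of extended arithmetic.\<close>

lemma subdiff_iff:
  assumes "closed_convex_fun \<psi>"
  shows "(x, v) \<in> subdiff \<psi> \<longleftrightarrow>
    (\<exists>r. \<psi> x = ereal r \<and> (\<forall>y t. \<psi> y = ereal t \<longrightarrow> r + (y - x) \<bullet> v \<le> t))" (is "?l \<longleftrightarrow> ?r")
proof
  assume l: ?l
  then obtain r where r: "\<psi> x = ereal r"
    using closed_convex_finite[OF assms] by (auto simp: subdiff_def)
  have "r + (y - x) \<bullet> v \<le> t" if "\<psi> y = ereal t" for y t
    using l r that by (auto simp: subdiff_def dest!: spec[of _ y])
  with r show ?r by blast
next
  assume ?r
  then obtain r where r: "\<psi> x = ereal r" "\<And>y t. \<psi> y = ereal t \<Longrightarrow> r + (y - x) \<bullet> v \<le> t" by blast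
  have "\<psi> y \<ge> \<psi> x + ereal ((y - x) \<bullet> v)" for y
    using r closed_convex_finite[OF assms, of y] by (cases "\<psi> y") (auto)
  then show ?l using r by (auto simp: subdiff_def)
qed

lemma subdiff_ineq:
  assumes "closed_convex_fun \<psi>" "(x, v) \<in> subdiff \<psi>" "\<psi> x = ereal r" "\<psi> y = ereal t"
  shows "r + (y - x) \<bullet> v \<le> t"
  using subdiff_iff[OF assms(1)] assms(2-4) by auto

lemma subdiff_monotone:
  assumes "closed_convex_fun \<psi>" "(x, v) \<in> subdiff \<psi>" "(y, w) \<in> subdiff \<psi>"
  shows "0 \<le> (x - y) \<bullet> (v - w)"
proof -
  obtain r t where r: "\<psi> x = ereal r" "\<psi> y = ereal t"
    using assms subdiff_iff by blast
  have "r + (y - x) \<bullet> v \<le> t" "t + (x - y) \<bullet> w \<le> r"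
    using subdiff_ineq[OF assms(1,2) r] subdiff_ineq[OF assms(1,3) r(2,1)] by auto
  then show ?thesis by (simp add: inner_diff_left inner_diff_right)
qed

lemma subdiff_convex_section:
  assumes "closed_convex_fun \<psi>" "(x, v) \<in> subdiff \<psi>" "(x, w) \<in> subdiff \<psi>" "0 \<le> t" "t \<le> 1"
  shows "(x, (1 - t) *\<^sub>R v + t *\<^sub>R w) \<in> subdiff \<psi>"
proof -
  obtain r where r: "\<psi> x = ereal r" using assms subdiff_iff by blast
  have "r + (y - x) \<bullet> ((1 - t) *\<^sub>R v + t *\<^sub>R w) \<le> u" if u: "\<psi> y = ereal u" for y u
  proof -
    have "(1 - t) * (r + (y - x) \<bullet> v) + t * (r + (y - x) \<bullet> w) \<le> (1 - t) * u + t * u"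
      using subdiff_ineq[OF assms(1,2) r u] subdiff_ineq[OF assms(1,3) r u] assms(4,5)
      by (intro add_mono mult_left_mono) auto
    then show ?thesis by (simp add: inner_add_right algebra_simps)
  qed
  then show ?thesis using subdiff_iff[OF assms(1)] r by auto
qed

text \<open>Sequential lower semicontinuity, read off from the closed epigraph.\<close>

lemma closed_convex_limit_le:
  assumes "closed_convex_fun \<psi>" "X \<longlonglongrightarrow> x" "T \<longlonglongrightarrow> t" "\<And>n. \<psi> (X n) \<le> ereal (T n)"
  shows "\<psi> x \<le> ereal t"
proof -
  have "closed (ereal_epigraph \<psi>)" using assms(1) by (simp add: closed_convex_fun_def)
  moreover have "\<And>n. (X n, T n) \<in> ereal_epigraph \<psi>" using assms(4) by (simp add: ereal_epigraph_def)
  moreover have "(\<lambda>n. (X n, T n)) \<longlonglongrightarrow> (x, t)" using assms(2,3) by (rule tendsto_Pair)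
  ultimately have "(x, t) \<in> ereal_epigraph \<psi>" by (meson closed_sequentially)
  then show ?thesis by (simp add: ereal_epigraph_def)
qed

text \<open>Solved for the value at the base point, the subgradient inequality bounds \<psi> from
  above by a continuous expression, and lower semicontinuity preserves such bounds.\<close>

lemma closed_subdiff:
  assumes cc: "closed_convex_fun \<psi>"
  shows "closed (subdiff \<psi>)"
  unfolding closed_sequential_limits
proof (intro allI impI, elim conjE)
  fix Z :: "nat \<Rightarrow> 'a \<times> 'a" and z
  assume Z: "\<forall>n. Z n \<in> subdiff \<psi>" and lim: "Z \<longlonglongrightarrow> z"
  obtain x v where z: "z = (x, v)" by fastforce
  have lx: "(\<lambda>n. fst (Z n)) \<longlonglongrightarrow> x" and lv: "(\<lambda>n. snd (Z n)) \<longlonglongrightarrow> v"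
    using tendsto_fst[OF lim] tendsto_snd[OF lim] z by auto
  have "(fst (Z n), snd (Z n)) \<in> subdiff \<psi>" for n using Z by simp
  then have ex: "\<exists>r. \<psi> (fst (Z n)) = ereal r \<and> (\<forall>y t. \<psi> y = ereal t \<longrightarrow> r + (y - fst (Z n)) \<bullet> snd (Z n) \<le> t)" for n
    using subdiff_iff[OF cc] by blast
  have le: "\<psi> x \<le> ereal (t - (y - x) \<bullet> v)" if "\<psi> y = ereal t" for y t
  proof (rule closed_convex_limit_le[OF cc lx])
    show "(\<lambda>n. t - (y - fst (Z n)) \<bullet> snd (Z n)) \<longlonglongrightarrow> t - (y - x) \<bullet> v"
      by (intro tendsto_intros lx lv)
    show "\<psi> (fst (Z n)) \<le> ereal (t - (y - fst (Z n)) \<bullet> snd (Z n))" for n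
      using ex[of n] that by (force simp: algebra_simps)
  qed
  \<comment> \<open>Finiteness at the limit point comes from testing this bound at some point of
    finite value, such as the first base point.\<close>
  obtain r where "\<psi> (fst (Z 0)) = ereal r" using ex by blast
  from le[OF this] have "\<psi> x < \<infinity>" by (cases "\<psi> x") auto
  then obtain u where u: "\<psi> x = ereal u" using closed_convex_finite[OF cc] by blast
  have "u + (y - x) \<bullet> v \<le> t" if "\<psi> y = ereal t" for y t
    using le[OF that] u by simp
  then show "z \<in> subdiff \<psi>" using subdiff_iff[OF cc] u z by blast
qed

text \<open>The exceptional set of the whole development. For closed convex \<psi> it consists of
  the points that have a subgradient but no gradient (\<open>dom_grad_eq\<close>).\<close>

definition multi_subdiff :: "('a::euclidean_space \<Rightarrow> ereal) \<Rightarrow> 'a set" where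
  "multi_subdiff \<psi> = {x. \<exists>v w. (x, v) \<in> subdiff \<psi> \<and> (x, w) \<in> subdiff \<psi> \<and> v \<noteq> w}"

text \<open>Minty's parametrization: \<open>x + v \<mapsto> x\<close> is 1-Lipschitz on the graph of a monotone relation.
  Where the subdifferential is multivalued, \<open>x + \<partial>\<psi>(x)\<close> contains a segment and hence
  meets one of countably many coordinate hyperplanes.\<close>

lemma hausdorff_dim_multi_subdiff:
  fixes \<psi> :: "'a::euclidean_space \<Rightarrow> ereal"
  assumes cc: "closed_convex_fun \<psi>"
  shows "hausdorff_dim (multi_subdiff \<psi>) \<le> ereal (real DIM('a) - 1)"
proof (rule hausdorff_dim_le)
  show "0 \<le> real DIM('a) - 1" by (simp add: Suc_leI)
next
  fix s \<delta> :: real assume s: "real DIM('a) - 1 < s" and \<delta>: "0 < \<delta>"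
  \<comment> \<open>The parameter is \<open>z = x + v\<close> with \<open>v\<close> a subgradient at
    \<open>x\<close>. The bound \<open>real m + 1\<close> is positive also for \<open>m = 0\<close>,
    as the covering lemma requires.\<close>
  define R where "R e q m = {(x, z). (x, z - x) \<in> subdiff \<psi> \<and> z \<bullet> e = q \<and> (\<forall>b\<in>Basis. \<bar>z \<bullet> b\<bar> \<le> real m + 1)}"
    for e :: 'a and q :: real and m :: nat
  have null: "hausdorff_premeasure s \<delta> (fst ` R e q m) = 0" if "e \<in> Basis" for e q m
  proof (rule hausdorff_premeasure_hyperplane_image_null[OF _ that _ _ _ s \<delta>])
    fix x z x' z' assume R: "(x, z) \<in> R e q m" "(x', z') \<in> R e q m"
    then have "0 \<le> (x - x') \<bullet> ((z - x) - (z' - x'))"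
      using subdiff_monotone[OF cc] by (auto simp: R_def)
    then have "(norm (x - x'))\<^sup>2 \<le> (x - x') \<bullet> (z - z')"
      by (simp add: power2_norm_eq_inner inner_diff_left inner_diff_right)
    also have "\<dots> \<le> norm (x - x') * norm (z - z')" by (rule norm_cauchy_schwarz)
    finally show "norm (x - x') \<le> norm (z - z')"
      by (cases "norm (x - x') = 0") (simp_all add: power2_eq_square)
  qed (auto simp: R_def)
  have sub: "multi_subdiff \<psi> \<subseteq> (\<Union>e\<in>Basis. \<Union>q\<in>\<rat>. \<Union>m. fst ` R e q m)"
  proof
    fix x assume "x \<in> multi_subdiff \<psi>"
    then obtain v w where vw: "(x, v) \<in> subdiff \<psi>" "(x, w) \<in> subdiff \<psi>" "v \<noteq> w"
      by (auto simp: multi_subdiff_def)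
    then obtain e where e: "e \<in> Basis" "v \<bullet> e \<noteq> w \<bullet> e" using euclidean_eqI by blast
    have "\<exists>v w. (x, v) \<in> subdiff \<psi> \<and> (x, w) \<in> subdiff \<psi> \<and> v \<bullet> e < w \<bullet> e"
      using vw e(2) by (metis linorder_neqE_linordered_idom)
    then obtain v w where vw: "(x, v) \<in> subdiff \<psi>" "(x, w) \<in> subdiff \<psi>" "v \<bullet> e < w \<bullet> e" by blast
    obtain q where q: "q \<in> \<rat>" "(x + v) \<bullet> e < q" "q < (x + w) \<bullet> e"
      using Rats_dense_in_real[of "(x + v) \<bullet> e" "(x + w) \<bullet> e"] vw(3) by (auto simp: inner_add_left)
    \<comment> \<open>Solves \<open>(x + u) \<bullet> e = q\<close> for \<open>u\<close> on the
      segment from \<open>v\<close> to \<open>w\<close>.\<close>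
    define t where "t = (q - (x + v) \<bullet> e) / (w \<bullet> e - v \<bullet> e)"
    have t: "0 \<le> t" "t \<le> 1" using q vw(3) by (auto simp: t_def inner_add_left field_simps)
    define u where "u = (1 - t) *\<^sub>R v + t *\<^sub>R w"
    have u: "(x, u) \<in> subdiff \<psi>" unfolding u_def by (rule subdiff_convex_section[OF cc vw(1,2) t])
    have "t * (w \<bullet> e - v \<bullet> e) = q - (x + v) \<bullet> e" using vw(3) by (simp add: t_def)
    then have ue: "(x + u) \<bullet> e = q" by (simp add: u_def inner_add_left algebra_simps)
    obtain m :: nat where m: "norm (x + u) \<le> real m" using real_arch_simple by blast
    have "\<bar>(x + u) \<bullet> b\<bar> \<le> real m + 1" if "b \<in> Basis" for b
      using Basis_le_norm[OF that, of "x + u"] m by linarith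
    then have "(x, x + u) \<in> R e q m" using u ue by (simp add: R_def)
    then show "x \<in> (\<Union>e\<in>Basis. \<Union>q\<in>\<rat>. \<Union>m. fst ` R e q m)"
      using e(1) q(1) by force
  qed
  have "hausdorff_premeasure s \<delta> (\<Union>p\<in>(Basis::'a set) \<times> (\<rat>::real set) \<times> (UNIV::nat set).
      case p of (e, q, m) \<Rightarrow> fst ` R e q m) = 0"
    using null \<delta> by (intro hausdorff_premeasure_UN_null countable_SIGMA countable_rat)
      (auto intro: countable_finite)
  moreover have "multi_subdiff \<psi> \<subseteq> (\<Union>p\<in>Basis \<times> \<rat> \<times> UNIV. case p of (e, q, m) \<Rightarrow> fst ` R e q m)"
  proof
    fix x assume "x \<in> multi_subdiff \<psi>"
    then obtain e q m where "e \<in> Basis" "q \<in> \<rat>" "x \<in> fst ` R e q m" using sub by blast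
    then show "x \<in> (\<Union>p\<in>Basis \<times> \<rat> \<times> UNIV. case p of (e, q, m) \<Rightarrow> fst ` R e q m)"
      by (intro UN_I[of "(e, q, m)"]) auto
  qed
  ultimately show "hausdorff_premeasure s \<delta> (multi_subdiff \<psi>) = 0"
    by (metis hausdorff_premeasure_mono le_zero_eq)
qed

section \<open>Existence of subgradients, and differentiability where they are unique\<close>

lemma supporting_hyperplane_not_interior:
  fixes S :: "'a::euclidean_space set"
  assumes S: "convex S" "x \<in> S" "x \<notin> interior S"
  obtains a where "a \<noteq> 0" "\<And>y. y \<in> S \<Longrightarrow> a \<bullet> y \<le> a \<bullet> x"
proof (cases "interior S = {}")
  \<comment> \<open>With empty interior, \<open>S\<close> lies in a hyperplane, and the normal of
    that hyperplane supports trivially.\<close>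
  case True
  then obtain a b where "a \<noteq> 0" "S \<subseteq> {x. a \<bullet> x = b}"
    using empty_interior_subset_hyperplane[OF S(1)] by metis
  then have "a \<bullet> y \<le> a \<bullet> x" if "y \<in> S" for y using S(2) that by (auto simp: subset_iff)
  then show ?thesis using that[of a] \<open>a \<noteq> 0\<close> by blast
next
  case False
  then have "rel_interior S = interior S" by (rule rel_interior_nonempty_interior)
  then obtain a where "a \<noteq> 0" "\<And>y. y \<in> S \<Longrightarrow> a \<bullet> x \<le> a \<bullet> y"
    using supporting_hyperplane_rel_boundary[OF S(1,2)] S(3) by metis
  then show ?thesis using that[of "- a"] by auto
qed

definition eff_dom :: "('a \<Rightarrow> ereal) \<Rightarrow> 'a set" where
  "eff_dom \<psi> = {x. \<psi> x < \<infinity>}"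

lemma eff_dom_ereal: "closed_convex_fun \<psi> \<Longrightarrow> x \<in> eff_dom \<psi> \<Longrightarrow> \<psi> x = ereal (real_of_ereal (\<psi> x))"
  using closed_convex_finite[of \<psi> x] by (auto simp: eff_dom_def)

lemma closed_convex_combination:
  assumes "closed_convex_fun \<psi>" "\<psi> x = ereal r" "\<psi> y = ereal s" "0 \<le> t" "t \<le> 1"
  shows "\<psi> ((1 - t) *\<^sub>R x + t *\<^sub>R y) \<le> ereal ((1 - t) * r + t * s)"
proof -
  have "\<psi> ((1 - t) *\<^sub>R x + t *\<^sub>R y) \<le> ereal (1 - t) * \<psi> x + ereal t * \<psi> y"
    using assms(1,4,5) by (simp add: closed_convex_fun_def)
  then show ?thesis using assms by simp
qed

lemma convex_eff_dom:
  assumes cc: "closed_convex_fun \<psi>" shows "convex (eff_dom \<psi>)"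
  unfolding convex_alt
proof (intro ballI allI impI)
  fix x y and u :: real assume xy: "x \<in> eff_dom \<psi>" "y \<in> eff_dom \<psi>" and u: "0 \<le> u \<and> u \<le> 1"
  show "(1 - u) *\<^sub>R x + u *\<^sub>R y \<in> eff_dom \<psi>"
    using closed_convex_combination[OF cc eff_dom_ereal[OF cc xy(1)] eff_dom_ereal[OF cc xy(2)], of u] u
    by (auto simp: eff_dom_def)
qed

lemma convex_on_eff_dom:
  assumes cc: "closed_convex_fun \<psi>" shows "convex_on (eff_dom \<psi>) (\<lambda>x. real_of_ereal (\<psi> x))"
proof (rule convex_onI)
  fix t :: real and x y assume t: "0 < t" "t < 1" and xy: "x \<in> eff_dom \<psi>" "y \<in> eff_dom \<psi>"
  have m: "(1 - t) *\<^sub>R x + t *\<^sub>R y \<in> eff_dom \<psi>"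
    using convex_eff_dom[OF cc] xy t unfolding convex_alt by auto
  have "\<psi> ((1 - t) *\<^sub>R x + t *\<^sub>R y) \<le> ereal ((1 - t) * real_of_ereal (\<psi> x) + t * real_of_ereal (\<psi> y))"
    using t by (intro closed_convex_combination[OF cc eff_dom_ereal[OF cc xy(1)] eff_dom_ereal[OF cc xy(2)]]) auto
  then show "real_of_ereal (\<psi> ((1 - t) *\<^sub>R x + t *\<^sub>R y)) \<le> (1 - t) * real_of_ereal (\<psi> x) + t * real_of_ereal (\<psi> y)"
    using eff_dom_ereal[OF cc m] by (metis ereal_less_eq(3))
qed (rule convex_eff_dom[OF cc])

lemma subdiff_imp_eff_dom: "(x, v) \<in> subdiff \<psi> \<Longrightarrow> x \<in> eff_dom \<psi>"
  by (simp add: subdiff_def eff_dom_def)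

text \<open>The epigraph has a supporting hyperplane at \<open>(x, \<psi> x)\<close>; over an
  interior point of the domain it is not vertical, and its slope is a subgradient.\<close>

lemma subdiff_exists_interior:
  fixes \<psi> :: "'a::euclidean_space \<Rightarrow> ereal"
  assumes cc: "closed_convex_fun \<psi>" and x: "x \<in> interior (eff_dom \<psi>)"
  shows "\<exists>v. (x, v) \<in> subdiff \<psi>"
proof -
  let ?E = "ereal_epigraph \<psi>"
  obtain r where r: "\<psi> x = ereal r"
    using eff_dom_ereal[OF cc] x interior_subset by blast
  have conv: "convex ?E" unfolding convex_alt
  proof (clarsimp simp: ereal_epigraph_def)
    fix y z and s t u :: real assume *: "\<psi> y \<le> ereal s" "\<psi> z \<le> ereal t" "0 \<le> u" "u \<le> 1"
    obtain p q where pq: "\<psi> y = ereal p" "\<psi> z = ereal q"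
      using * closed_convex_finite[OF cc, of y] closed_convex_finite[OF cc, of z]
      by (metis ereal_infty_less_eq(1) less_ereal.simps(4) linorder_not_le order.strict_trans1 ereal_less_PInfty)
    have "\<psi> ((1 - u) *\<^sub>R y + u *\<^sub>R z) \<le> ereal ((1 - u) * p + u * q)"
      by (rule closed_convex_combination[OF cc pq *(3,4)])
    also have "\<dots> \<le> ereal ((1 - u) * s + u * t)"
      using * pq by (auto intro!: add_mono mult_left_mono)
    finally show "\<psi> ((1 - u) *\<^sub>R y + u *\<^sub>R z) \<le> ereal ((1 - u) * s + u * t)" .
  qed
  have "(x, r) \<in> ?E" using r by (simp add: ereal_epigraph_def)
  moreover have "(x, r) \<notin> interior ?E"
  proof
    assume "(x, r) \<in> interior ?E"
    then obtain e where e: "0 < e" "ball (x, r) e \<subseteq> ?E" by (meson mem_interior)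
    have "(x, r - e / 2) \<in> ball (x, r) e" using e by (simp add: dist_Pair_Pair dist_real_def)
    then have "\<psi> x \<le> ereal (r - e / 2)" using e by (auto simp: ereal_epigraph_def)
    then show False using r e by simp
  qed
  ultimately obtain c where c: "c \<noteq> 0" "\<And>p. p \<in> ?E \<Longrightarrow> c \<bullet> p \<le> c \<bullet> (x, r)"
    using supporting_hyperplane_not_interior[OF conv] by metis
  obtain a \<alpha> where c_eq: "c = (a, \<alpha>)" by fastforce
  have ineq: "a \<bullet> y + \<alpha> * t \<le> a \<bullet> x + \<alpha> * r" if "\<psi> y \<le> ereal t" for y t
    using c(2)[of "(y, t)"] that by (simp add: c_eq ereal_epigraph_def)
  have "\<alpha> \<le> 0" using ineq[of x "r + 1"] r by (simp add: algebra_simps)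
  moreover have "\<alpha> \<noteq> 0"
  proof
    assume 0: "\<alpha> = 0"
    obtain e where e: "0 < e" "ball x e \<subseteq> eff_dom \<psi>" using x by (meson mem_interior)
    have a: "a \<noteq> 0" using c(1) c_eq 0 by (auto simp: zero_prod_def)
    \<comment> \<open>A step of length \<open>e / 2\<close> along the normal of a vertical
      hyperplane stays in the domain but leaves the half-space.\<close>
    define y where "y = x + (e / (2 * norm a)) *\<^sub>R a"
    have "y \<in> ball x e" using e a by (simp add: y_def dist_norm)
    then obtain t where "\<psi> y = ereal t" using e eff_dom_ereal[OF cc] by blast
    then have "a \<bullet> y \<le> a \<bullet> x" using ineq[of y t] 0 by simp
    moreover have "0 < a \<bullet> a" using a by simp
    ultimately show False using e a by (simp add: y_def inner_add_right mult_le_0_iff divide_le_0_iff)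
  qed
  ultimately have neg: "\<alpha> < 0" by simp
  define v where "v = (- 1 / \<alpha>) *\<^sub>R a"
  have "r + (y - x) \<bullet> v \<le> t" if "\<psi> y = ereal t" for y t
  proof -
    have "(y - x) \<bullet> a \<le> - \<alpha> * (t - r)"
      using ineq[of y t] that by (simp add: algebra_simps inner_commute inner_diff_left)
    then have "(- 1 / \<alpha>) * ((y - x) \<bullet> a) \<le> (- 1 / \<alpha>) * (- \<alpha> * (t - r))"
      using neg by (intro mult_left_mono) auto
    then show ?thesis using neg by (simp add: v_def)
  qed
  then show ?thesis using subdiff_iff[OF cc] r by blast
qed

lemma has_grad_unique:
  assumes "has_grad \<psi> x v" "has_grad \<psi> x w" shows "v = w"
proof -
  have "(\<lambda>h. h \<bullet> v) = (\<lambda>h. h \<bullet> w)"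
    using assms has_derivative_unique unfolding has_grad_def gderiv_def by blast
  then show ?thesis by (metis euclidean_eqI inner_commute)
qed

lemma grad_eq: "has_grad \<psi> x v \<Longrightarrow> grad \<psi> x = v"
  unfolding grad_def using has_grad_unique by blast

text \<open>Convexity bounds the difference quotients along the segment towards \<open>y\<close> by
  \<open>\<psi> y - \<psi> x\<close>; their limit is the directional derivative.\<close>

lemma has_grad_imp_subdiff:
  assumes cc: "closed_convex_fun \<psi>" and g: "has_grad \<psi> x v"
  shows "(x, v) \<in> subdiff \<psi>"
proof -
  define f where "f y = real_of_ereal (\<psi> y)" for y
  have fin: "\<forall>\<^sub>F y in nhds x. \<bar>\<psi> y\<bar> \<noteq> \<infinity>" and d: "(f has_derivative (\<lambda>h. h \<bullet> v)) (at x)"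
    using g unfolding has_grad_def gderiv_def f_def by auto
  have "\<bar>\<psi> x\<bar> \<noteq> \<infinity>" using fin by (rule eventually_nhds_x_imp_x)
  then obtain r where r: "\<psi> x = ereal r" by auto
  have "r + (y - x) \<bullet> v \<le> t" if t: "\<psi> y = ereal t" for y t
  proof -
    have "((\<lambda>u. x + u *\<^sub>R (y - x)) has_derivative (\<lambda>u. u *\<^sub>R (y - x))) (at 0)"
      by (auto intro!: derivative_eq_intros)
    from has_derivative_compose[OF this, of f "\<lambda>h. h \<bullet> v"] d
    have "((\<lambda>u. f (x + u *\<^sub>R (y - x))) has_derivative (\<lambda>u. (u *\<^sub>R (y - x)) \<bullet> v)) (at 0)" by simp
    then have "((\<lambda>u. f (x + u *\<^sub>R (y - x))) has_field_derivative ((y - x) \<bullet> v)) (at 0)"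
      by (simp add: has_field_derivative_def mult.commute[of _ "(y - x) \<bullet> v"])
    then have lim: "((\<lambda>u. (f (x + u *\<^sub>R (y - x)) - f x) / u) \<longlongrightarrow> (y - x) \<bullet> v) (at_right 0)"
      by (auto simp: DERIV_def intro: filterlim_mono at_le)
    have "(y - x) \<bullet> v \<le> t - r"
    proof (rule tendsto_upperbound[OF lim])
      have "\<forall>\<^sub>F u in at_right 0. (0::real) < u \<and> u < 1"
        using eventually_at_right_less[of "0::real"] eventually_at_rightI[of 0 1 "\<lambda>u. u < (1::real)"]
        by (auto intro: eventually_conj)
      then show "\<forall>\<^sub>F u in at_right 0. (f (x + u *\<^sub>R (y - x)) - f x) / u \<le> t - r"
      proof eventually_elim
        case (elim u)
        have "\<psi> ((1 - u) *\<^sub>R x + u *\<^sub>R y) \<le> ereal ((1 - u) * r + u * t)"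
          using elim by (intro closed_convex_combination[OF cc r t]) auto
        then have le: "\<psi> (x + u *\<^sub>R (y - x)) \<le> ereal ((1 - u) * r + u * t)"
          by (simp add: algebra_simps)
        then have "\<psi> (x + u *\<^sub>R (y - x)) < \<infinity>" by (auto simp: le_less_trans)
        then obtain p where p: "\<psi> (x + u *\<^sub>R (y - x)) = ereal p" using closed_convex_finite[OF cc] by blast
        then have "p \<le> (1 - u) * r + u * t" using le by simp
        then have "p - r \<le> (t - r) * u" by (simp add: algebra_simps)
        then show ?case using elim p r by (simp add: f_def pos_divide_le_eq)
      qed
    qed simp
    then show ?thesis by simp
  qed
  then show ?thesis using subdiff_iff[OF cc] r by blast
qed

text \<open>Once the linear function of \<open>w\<close> is subtracted, \<open>x\<close> is a local
  minimum, so the derivative vanishes there.\<close>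

lemma subdiff_eq_grad:
  assumes cc: "closed_convex_fun \<psi>" and g: "has_grad \<psi> x v" and w: "(x, w) \<in> subdiff \<psi>"
  shows "w = v"
proof -
  define f where "f y = real_of_ereal (\<psi> y)" for y
  have fin: "\<forall>\<^sub>F y in nhds x. \<bar>\<psi> y\<bar> \<noteq> \<infinity>" and d: "(f has_derivative (\<lambda>h. h \<bullet> v)) (at x)"
    using g unfolding has_grad_def gderiv_def f_def by auto
  have d2: "((\<lambda>y. f y - y \<bullet> w) has_derivative (\<lambda>h. h \<bullet> v - h \<bullet> w)) (at x)"
    by (intro derivative_intros d)
  obtain r where r: "\<psi> x = ereal r" using subdiff_iff[OF cc] w by blast
  have "\<forall>\<^sub>F y in nhds x. f x - x \<bullet> w \<le> f y - y \<bullet> w"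
    using fin
  proof eventually_elim
    case (elim y)
    then obtain t where t: "\<psi> y = ereal t" by auto
    show ?case using subdiff_ineq[OF cc w r t] r t by (simp add: f_def inner_diff_left)
  qed
  then have "\<forall>\<^sub>F y in at x. f x - x \<bullet> w \<le> f y - y \<bullet> w" 
    unfolding eventually_at_filter by (rule eventually_mono) auto 
  from has_derivative_local_min[OF d2 this] have "h \<bullet> v - h \<bullet> w = 0" for h by metis
  then have "(v - w) \<bullet> (v - w) = 0" by (metis inner_diff_right)
  then show ?thesis by simp
qed

text \<open>At a boundary point of the domain a nonzero outer normal can be added to any
  subgradient, which destroys uniqueness.\<close>

lemma subdiff_unique_imp_interior:
  assumes cc: "closed_convex_fun \<psi>" and v: "(x, v) \<in> subdiff \<psi>" and u: "x \<notin> multi_subdiff \<psi>"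
  shows "x \<in> interior (eff_dom \<psi>)"
proof (rule ccontr)
  assume "x \<notin> interior (eff_dom \<psi>)"
  then obtain a where a: "a \<noteq> 0" "\<And>y. y \<in> eff_dom \<psi> \<Longrightarrow> a \<bullet> y \<le> a \<bullet> x"
    using supporting_hyperplane_not_interior[OF convex_eff_dom[OF cc] subdiff_imp_eff_dom[OF v]] by metis
  obtain r where r: "\<psi> x = ereal r" using subdiff_iff[OF cc] v by blast
  have "r + (y - x) \<bullet> (v + a) \<le> t" if t: "\<psi> y = ereal t" for y t
  proof -
    have "y \<in> eff_dom \<psi>" using t by (simp add: eff_dom_def)
    then have "(y - x) \<bullet> a \<le> 0" using a(2)[of y] by (simp add: inner_diff_right inner_commute[of _ a])
    then show ?thesis using subdiff_ineq[OF cc v r t] by (simp add: inner_add_right)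
  qed
  then have "(x, v + a) \<in> subdiff \<psi>" using subdiff_iff[OF cc] r by blast
  then have "x \<in> multi_subdiff \<psi>" using v a(1) unfolding multi_subdiff_def by force
  then show False using u by simp
qed

text \<open>Subgradients are bounded by \<open>(\<psi>(y + s) - \<psi>(y)) / |s|\<close>, and the graph of the
  subdifferential is closed, so subgradients at points near \<open>x\<close> converge to the unique one at
  \<open>x\<close>.\<close>

lemma subdiff_continuous_at_unique:
  fixes \<psi> :: "'a::euclidean_space \<Rightarrow> ereal"
  assumes cc: "closed_convex_fun \<psi>" and v: "(x, v) \<in> subdiff \<psi>" and u: "x \<notin> multi_subdiff \<psi>"
    and e: "0 < e"
  shows "\<exists>d>0. \<forall>y w. norm (y - x) < d \<longrightarrow> (y, w) \<in> subdiff \<psi> \<longrightarrow> norm (w - v) < e"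
proof (rule ccontr)
  assume neg: "\<not> ?thesis"
  define f where "f y = real_of_ereal (\<psi> y)" for y
  have xi: "x \<in> interior (eff_dom \<psi>)" by (rule subdiff_unique_imp_interior[OF cc v u])
  then obtain R where R: "0 < R" "cball x R \<subseteq> interior (eff_dom \<psi>)"
    using open_interior by (meson open_contains_cball_eq)
  \<comment> \<open>Halving leaves room: a step of length \<open>r\<close> from a point within
    \<open>r\<close> of \<open>x\<close> stays in \<open>cball x (2 * r)\<close>, where \<psi> is
    bounded.\<close>
  define r where "r = R / 2"
  have r: "0 < r" "cball x (2 * r) \<subseteq> interior (eff_dom \<psi>)" using R by (auto simp: r_def)
  have "continuous_on (interior (eff_dom \<psi>)) f"
    unfolding f_def
    by (intro convex_on_continuous convex_on_subset[OF convex_on_eff_dom[OF cc]] interior_subset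
        open_interior convex_interior convex_eff_dom[OF cc])
  then have "compact (f ` cball x (2 * r))"
    using r by (intro compact_continuous_image) (auto intro: continuous_on_subset)
  then have "bounded (f ` cball x (2 * r))" by (rule compact_imp_bounded)
  then obtain M where "\<forall>y\<in>f ` cball x (2 * r). norm y \<le> M" by (auto simp: bounded_iff)
  then have M: "\<bar>f y\<bar> \<le> M" if "y \<in> cball x (2 * r)" for y using that by auto
  have bound: "norm w \<le> 2 * M / r" if y: "norm (y - x) < r" "(y, w) \<in> subdiff \<psi>" for y w
  proof (cases "w = 0")
    case True
    have "0 \<le> M" using M[of x] r by auto
    then show ?thesis using True r by simp
  next
    case False
    \<comment> \<open>Testing the subgradient inequality at distance \<open>r\<close> in the
      direction of \<open>w\<close> gives \<open>r * norm w \<le> 2 * M\<close>.\<close>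
    define z where "z = y + (r / norm w) *\<^sub>R w"
    have yb: "y \<in> cball x (2 * r)" using y r by (simp add: dist_norm norm_minus_commute)
    have "norm (z - x) \<le> norm (y - x) + norm ((r / norm w) *\<^sub>R w)"
      unfolding z_def by (metis add_diff_eq diff_add_eq norm_triangle_ineq)
    then have zb: "z \<in> cball x (2 * r)" using y r False by (simp add: dist_norm norm_minus_commute)
    have "\<psi> y = ereal (f y)" "\<psi> z = ereal (f z)"
      unfolding f_def using eff_dom_ereal[OF cc] r(2) yb zb interior_subset by blast+
    from subdiff_ineq[OF cc y(2) this] have "f y + (z - y) \<bullet> w \<le> f z" .
    moreover have "(z - y) \<bullet> w = r * norm w"
      using False by (simp add: z_def power2_norm_eq_inner[symmetric] power2_eq_square)
    ultimately have "r * norm w \<le> 2 * M" using M[OF yb] M[OF zb] by linarith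
    then show ?thesis using r by (simp add: field_simps)
  qed
  have "\<exists>p. norm (fst p - x) < min r (1 / Suc n) \<and> p \<in> subdiff \<psi> \<and> e \<le> norm (snd p - v)" for n
  proof -
    have "0 < min r (1 / Suc n)" using r by simp
    then obtain y w where "norm (y - x) < min r (1 / Suc n)" "(y, w) \<in> subdiff \<psi>" "\<not> norm (w - v) < e"
      using neg by blast
    then show ?thesis by (intro exI[of _ "(y, w)"]) auto
  qed
  then obtain p where p: "\<And>n. norm (fst (p n) - x) < min r (1 / Suc n)" "\<And>n. p n \<in> subdiff \<psi>"
    "\<And>n. e \<le> norm (snd (p n) - v)" by metis
  have "\<forall>n. snd (p n) \<in> cball 0 (2 * M / r)"
    using bound p(1,2) by (metis dist_0_norm mem_cball min_less_iff_conj prod.collapse)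
  then obtain w \<sigma> where w: "strict_mono \<sigma>" "(\<lambda>n. snd (p (\<sigma> n))) \<longlonglongrightarrow> w"
    using compact_cball[unfolded compact_def, rule_format, of "\<lambda>n. snd (p n)" 0 "2 * M / r"] by (auto simp: o_def)
  have "(\<lambda>n. fst (p n) - x) \<longlonglongrightarrow> 0"
  proof (rule Lim_null_comparison)
    show "\<forall>\<^sub>F n in sequentially. norm (fst (p n) - x) \<le> 1 / Suc n" using p(1) by (simp add: less_imp_le)
    show "(\<lambda>n. 1 / real (Suc n)) \<longlonglongrightarrow> 0" using LIMSEQ_inverse_real_of_nat by (simp add: inverse_eq_divide)
  qed
  then have "(\<lambda>n. fst (p n)) \<longlonglongrightarrow> x" by (simp add: LIM_zero_iff)
  then have "(\<lambda>n. fst (p (\<sigma> n))) \<longlonglongrightarrow> x" using w(1) LIMSEQ_subseq_LIMSEQ by (auto simp: o_def)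
  then have "(\<lambda>n. (fst (p (\<sigma> n)), snd (p (\<sigma> n)))) \<longlonglongrightarrow> (x, w)" using w(2) by (rule tendsto_Pair)
  then have xw: "(x, w) \<in> subdiff \<psi>"
    using closed_sequentially[OF closed_subdiff[OF cc]] p(2) by force
  have "e \<le> norm (w - v)"
    by (rule tendsto_lowerbound[OF tendsto_norm[OF tendsto_diff[OF w(2) tendsto_const]]]) (auto simp: p(3))
  then have "w \<noteq> v" using e by auto
  then show False using xw v u by (auto simp: multi_subdiff_def)
qed

text \<open>The first-order error at \<open>y\<close> lies between \<open>0\<close> and
  \<open>(y - x) \<bullet> (w - v)\<close> for any subgradient \<open>w\<close> at \<open>y\<close>,
  and \<open>w\<close> tends to \<open>v\<close> as \<open>y\<close> tends to
  \<open>x\<close>.\<close>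

lemma subdiff_unique_imp_has_grad:
  fixes \<psi> :: "'a::euclidean_space \<Rightarrow> ereal"
  assumes cc: "closed_convex_fun \<psi>" and v: "(x, v) \<in> subdiff \<psi>" and u: "x \<notin> multi_subdiff \<psi>"
  shows "has_grad \<psi> x v"
proof -
  define f where "f y = real_of_ereal (\<psi> y)" for y
  have xi: "x \<in> interior (eff_dom \<psi>)" by (rule subdiff_unique_imp_interior[OF cc v u])
  have ev: "\<forall>\<^sub>F y in nhds x. y \<in> interior (eff_dom \<psi>)"
    using xi open_interior by (intro eventually_nhds_in_open) auto
  have fe: "\<psi> y = ereal (f y)" if "y \<in> interior (eff_dom \<psi>)" for y
    unfolding f_def using eff_dom_ereal[OF cc] that interior_subset by blast
  have "(f has_derivative (\<lambda>h. h \<bullet> v)) (at x)"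
    unfolding has_derivative_at_alt
  proof (intro conjI allI impI)
    show "bounded_linear (\<lambda>h. h \<bullet> v)" by (rule bounded_linear_inner_left)
  next
    fix e :: real assume "0 < e"
    then obtain d where d: "0 < d" "\<And>y w. norm (y - x) < d \<Longrightarrow> (y, w) \<in> subdiff \<psi> \<Longrightarrow> norm (w - v) < e"
      using subdiff_continuous_at_unique[OF cc v u] by metis
    obtain r where r: "0 < r" "ball x r \<subseteq> interior (eff_dom \<psi>)"
      using xi open_interior by (meson openE)
    have "norm (f y - f x - (y - x) \<bullet> v) \<le> e * norm (y - x)" if y: "norm (y - x) < min d r" for y
    proof -
      have yi: "y \<in> interior (eff_dom \<psi>)" using y r(2) by (auto simp: dist_norm norm_minus_commute)
      then obtain w where w: "(y, w) \<in> subdiff \<psi>" using subdiff_exists_interior[OF cc] by blast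
      have 1: "f x + (y - x) \<bullet> v \<le> f y" by (rule subdiff_ineq[OF cc v fe[OF xi] fe[OF yi]])
      have 2: "f y + (x - y) \<bullet> w \<le> f x" by (rule subdiff_ineq[OF cc w fe[OF yi] fe[OF xi]])
      have "f y - f x - (y - x) \<bullet> v \<le> (y - x) \<bullet> (w - v)"
        using 2 by (simp add: inner_diff_left inner_diff_right)
      also have "\<dots> \<le> norm (y - x) * norm (w - v)" by (rule norm_cauchy_schwarz)
      also have "\<dots> \<le> norm (y - x) * e"
        using d(2)[OF _ w] y by (intro mult_left_mono) auto
      finally show ?thesis using 1 by (simp add: mult.commute)
    qed
    then show "\<exists>d>0. \<forall>y. norm (y - x) < d \<longrightarrow> norm (f y - f x - (y - x) \<bullet> v) \<le> e * norm (y - x)"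
      using d(1) r(1) by (intro exI[of _ "min d r"]) auto
  qed
  moreover have "\<forall>\<^sub>F y in nhds x. \<bar>\<psi> y\<bar> \<noteq> \<infinity>"
    using ev by eventually_elim (simp add: fe)
  ultimately show ?thesis unfolding has_grad_def gderiv_def f_def by auto
qed

text \<open>Turns differentiability into a condition on the closed graph
  \<open>subdiff \<psi>\<close>; measurability and almost everywhere existence of gradients rest on
  this identity.\<close>

lemma dom_grad_eq:
  assumes cc: "closed_convex_fun \<psi>"
  shows "dom_grad \<psi> = fst ` subdiff \<psi> - multi_subdiff \<psi>"
proof (intro equalityI subsetI)
  fix x assume "x \<in> dom_grad \<psi>"
  then obtain v where v: "has_grad \<psi> x v" by (auto simp: dom_grad_def)
  then have "(x, v) \<in> subdiff \<psi>" by (rule has_grad_imp_subdiff[OF cc])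
  then have "x \<in> fst ` subdiff \<psi>" by force
  moreover have "x \<notin> multi_subdiff \<psi>"
    using subdiff_eq_grad[OF cc v] unfolding multi_subdiff_def by blast
  ultimately show "x \<in> fst ` subdiff \<psi> - multi_subdiff \<psi>" by blast
qed (use subdiff_unique_imp_has_grad[OF cc] in \<open>force simp: dom_grad_def\<close>)

lemma subdiff_grad:
  assumes cc: "closed_convex_fun \<psi>" and x: "x \<in> dom_grad \<psi>"
  shows "(x, v) \<in> subdiff \<psi> \<longleftrightarrow> v = grad \<psi> x"
proof -
  obtain w where w: "has_grad \<psi> x w" using x by (auto simp: dom_grad_def)
  show ?thesis
    using has_grad_imp_subdiff[OF cc w] subdiff_eq_grad[OF cc w] grad_eq[OF w] by blast
qed

section \<open>Sigma-compactness and Borel measurability of the gradient\<close>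

lemma fsigma_compact_decomposition:
  fixes S :: "'a::euclidean_space set"
  assumes "fsigma_in euclidean S"
  obtains C :: "nat \<Rightarrow> 'a set" where "\<And>n. compact (C n)" "S = (\<Union>n. C n)"
proof -
  obtain C :: "nat \<Rightarrow> 'a set" where C: "\<forall>n. closedin euclidean (C n)" "\<Union> (range C) = S"
    using assms unfolding fsigma_in_ascending by blast
  have "fsigma S" using C(1) fsigma.intros[of C] C(2) by simp
  then obtain F :: "nat \<Rightarrow> 'a set" where "range F \<subseteq> Collect compact" "S = (\<Union>n. F n)"
    unfolding fsigma_Union_compact by blast
  then show ?thesis using that[of F] by blast
qed

text \<open>Continuous images of Borel sets need not be Borel. An F-sigma set in Euclidean space is
  a countable union of compact sets, and these have compact images; projections of subdifferentials
  are handled this way.\<close>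

lemma fsigma_continuous_image:
  fixes f :: "'a::euclidean_space \<Rightarrow> 'b::euclidean_space"
  assumes "fsigma_in euclidean S" "continuous_on UNIV f"
  shows "fsigma_in euclidean (f ` S)"
proof -
  obtain C :: "nat \<Rightarrow> 'a set" where C: "\<And>n. compact (C n)" "S = (\<Union>n. C n)"
    using fsigma_compact_decomposition[OF assms(1)] by metis
  have "fsigma_in euclidean (\<Union>n. f ` C n)"
    using C(1) assms(2) by (intro fsigma_in_Union)
      (auto intro!: closed_imp_fsigma_in compact_imp_closed compact_continuous_image continuous_on_subset[OF assms(2)])
  then show ?thesis using C(2) by (simp add: image_UN)
qed

lemma fsigma_in_borel: "fsigma_in euclidean S \<Longrightarrow> S \<in> sets borel"
  by (auto simp: fsigma_in_ascending)

lemma hausdorff_dim_mono: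
  assumes "A \<subseteq> B" shows "hausdorff_dim A \<le> hausdorff_dim B"
proof -
  have "hausdorff_measure s A \<le> hausdorff_measure s B" for s
    unfolding hausdorff_measure_def by (intro SUP_mono') (rule hausdorff_premeasure_mono[OF assms])
  then show ?thesis unfolding hausdorff_dim_def
    by (intro Inf_superset_mono) (auto, metis le_zero_eq)
qed

text \<open>The triples of a point and two distinct subgradients are the intersection of a closed
  and an open set; projecting to the point is continuous.\<close>

lemma fsigma_multi_subdiff:
  fixes \<psi> :: "'a::euclidean_space \<Rightarrow> ereal"
  assumes cc: "closed_convex_fun \<psi>"
  shows "fsigma_in euclidean (multi_subdiff \<psi>)"
proof -
  define C where "C = {p :: 'a \<times> 'a \<times> 'a. (fst p, fst (snd p)) \<in> subdiff \<psi> \<and> (fst p, snd (snd p)) \<in> subdiff \<psi>}"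
  define U where "U = {p :: 'a \<times> 'a \<times> 'a. fst (snd p) \<noteq> snd (snd p)}"
  have "C = (\<lambda>p. (fst p, fst (snd p))) -` subdiff \<psi> \<inter> (\<lambda>p. (fst p, snd (snd p))) -` subdiff \<psi>"
    by (auto simp: C_def)
  moreover have "closed \<dots>"
    by (intro closed_Int continuous_closed_vimage closed_subdiff[OF cc]) (auto intro!: continuous_intros)
  ultimately have "fsigma_in euclidean C" by (simp add: closed_imp_fsigma_in)
  moreover have "open U" unfolding U_def by (intro open_Collect_neq continuous_intros)
  then have "fsigma_in euclidean U"
    by (intro open_imp_fsigma_in metrizable_space_euclidean) simp
  ultimately have "fsigma_in euclidean (fst ` (C \<inter> U))"
    by (intro fsigma_continuous_image fsigma_in_Int continuous_on_fst continuous_on_id)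
  moreover have "fst ` (C \<inter> U) = multi_subdiff \<psi>"
  proof (intro equalityI subsetI)
    fix x assume "x \<in> multi_subdiff \<psi>"
    then obtain v w where "(x, v) \<in> subdiff \<psi>" "(x, w) \<in> subdiff \<psi>" "v \<noteq> w"
      unfolding multi_subdiff_def by blast
    then have "(x, v, w) \<in> C \<inter> U" by (simp add: C_def U_def)
    then show "x \<in> fst ` (C \<inter> U)" by (rule rev_image_eqI) simp
  qed (auto simp: multi_subdiff_def C_def U_def)
  ultimately show ?thesis by simp
qed

text \<open>Over \<open>dom_grad \<psi>\<close> the subdifferential is the graph of the gradient, so
  the preimage is the projection of the pairs with value in \<open>U\<close>, less the multivalued
  points.\<close>

lemma grad_vimage_open:
  fixes \<psi> :: "'a::euclidean_space \<Rightarrow> ereal"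
  assumes cc: "closed_convex_fun \<psi>" and U: "open U"
  shows "grad_vimage \<psi> U \<in> sets borel"
proof -
  have "open (UNIV \<times> U :: ('a \<times> 'a) set)" using U by (intro open_Times) auto
  then have "fsigma_in euclidean (subdiff \<psi> \<inter> UNIV \<times> U)"
    using closed_subdiff[OF cc]
    by (intro fsigma_in_Int closed_imp_fsigma_in open_imp_fsigma_in metrizable_space_euclidean) auto
  then have "fsigma_in euclidean (fst ` (subdiff \<psi> \<inter> UNIV \<times> U))"
    by (intro fsigma_continuous_image continuous_on_fst continuous_on_id)
  moreover have "grad_vimage \<psi> U = fst ` (subdiff \<psi> \<inter> UNIV \<times> U) - multi_subdiff \<psi>"
  proof (intro equalityI subsetI)
    fix x assume "x \<in> grad_vimage \<psi> U"
    then have x: "x \<in> dom_grad \<psi>" "grad \<psi> x \<in> U" by (auto simp: grad_vimage_def)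
    then have "(x, grad \<psi> x) \<in> subdiff \<psi> \<inter> UNIV \<times> U" using subdiff_grad[OF cc] by simp
    then show "x \<in> fst ` (subdiff \<psi> \<inter> UNIV \<times> U) - multi_subdiff \<psi>"
      using x(1) dom_grad_eq[OF cc] by (auto intro: rev_image_eqI)
  next
    fix x assume x: "x \<in> fst ` (subdiff \<psi> \<inter> UNIV \<times> U) - multi_subdiff \<psi>"
    then obtain v where v: "(x, v) \<in> subdiff \<psi>" "v \<in> U" by auto
    then have d: "x \<in> dom_grad \<psi>" using x dom_grad_eq[OF cc] by (auto intro: rev_image_eqI)
    then show "x \<in> grad_vimage \<psi> U" using subdiff_grad[OF cc d] v by (auto simp: grad_vimage_def)
  qed
  ultimately show ?thesis using fsigma_multi_subdiff[OF cc] by (auto intro: fsigma_in_borel)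
qed

lemma dom_grad_borel:
  assumes cc: "closed_convex_fun \<psi>" shows "dom_grad \<psi> \<in> sets borel"
  using grad_vimage_open[OF cc open_UNIV] by (simp add: grad_vimage_def)

lemma grad_measurable:
  fixes \<psi> :: "'a::euclidean_space \<Rightarrow> ereal"
  assumes cc: "closed_convex_fun \<psi>"
  shows "grad \<psi> \<in> borel_measurable (restrict_space borel (dom_grad \<psi>))"
proof (rule borel_measurableI)
  fix U :: "'a set" assume U: "open U"
  have "grad \<psi> -` U \<inter> dom_grad \<psi> = grad_vimage \<psi> U" by (auto simp: grad_vimage_def)
  then show "grad \<psi> -` U \<inter> space (restrict_space borel (dom_grad \<psi>)) \<in> sets (restrict_space borel (dom_grad \<psi>))"
    using grad_vimage_open[OF cc U] dom_grad_borel[OF cc]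
    by (subst sets_restrict_space_iff) (auto simp: space_restrict_space)
qed

lemma grad_vimage_borel:
  fixes \<psi> :: "'a::euclidean_space \<Rightarrow> ereal"
  assumes cc: "closed_convex_fun \<psi>" and B: "B \<in> sets borel"
  shows "grad_vimage \<psi> B \<in> sets borel"
proof -
  have "grad \<psi> -` B \<inter> space (restrict_space borel (dom_grad \<psi>)) \<in> sets (restrict_space borel (dom_grad \<psi>))"
    by (rule measurable_sets[OF grad_measurable[OF cc] B])
  then have "grad \<psi> -` B \<inter> dom_grad \<psi> \<in> sets borel"
    using dom_grad_borel[OF cc] by (subst (asm) sets_restrict_space_iff) (auto simp: space_restrict_space)
  also have "grad \<psi> -` B \<inter> dom_grad \<psi> = grad_vimage \<psi> B" by (auto simp: grad_vimage_def)
  finally show ?thesis .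
qed

section \<open>Indicator functions and maxima of closed convex functions\<close>

definition indicator_fun :: "'a set \<Rightarrow> 'a \<Rightarrow> ereal" where
  "indicator_fun C x = (if x \<in> C then 0 else \<infinity>)"

lemma closed_convex_indicator_fun:
  assumes "closed C" "convex C" shows "closed_convex_fun (indicator_fun C)"
proof -
  have "ereal_epigraph (indicator_fun C) = C \<times> {0..}"
    by (auto simp: ereal_epigraph_def indicator_fun_def zero_ereal_def split: if_splits)
  then have "closed (ereal_epigraph (indicator_fun C))"
    using assms(1) by (simp add: closed_Times)
  moreover have "indicator_fun C ((1 - t) *\<^sub>R x + t *\<^sub>R y)
      \<le> ereal (1 - t) * indicator_fun C x + ereal t * indicator_fun C y" if t: "t \<in> {0..1}" for x y t
  proof (cases "t = 0 \<or> t = 1 \<or> x \<in> C \<and> y \<in> C")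
    case True
    then show ?thesis using t assms(2) by (auto simp: indicator_fun_def zero_ereal_def[symmetric] one_ereal_def[symmetric] convex_alt)
  next
    \<comment> \<open>Away from the endpoints both coefficients are positive, so an infinite value
      is not cancelled by \<open>0 * \<infinity> = 0\<close>.\<close>
    case False
    then have "ereal (1 - t) * indicator_fun C x + ereal t * indicator_fun C y = \<infinity>"
      using t by (auto simp: indicator_fun_def)
    then show ?thesis by (metis ereal_less_eq(1))
  qed
  ultimately show ?thesis by (auto simp: closed_convex_fun_def indicator_fun_def)
qed

lemma subdiff_indicator_fun:
  assumes "x \<in> C" "\<And>y. y \<in> C \<Longrightarrow> (y - x) \<bullet> v \<le> 0"
  shows "(x, v) \<in> subdiff (indicator_fun C)"
  using assms by (auto simp: subdiff_def indicator_fun_def)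

text \<open>Subgradients of the indicator function are the normals of \<open>C\<close>, among them
  \<open>0\<close>. Thus hyperplanes and supported points of convex sets fall under the dimension
  bound for multivalued points.\<close>

lemma multi_subdiff_indicator_fun:
  assumes "x \<in> C" "v \<noteq> 0" "\<And>y. y \<in> C \<Longrightarrow> (y - x) \<bullet> v \<le> 0"
  shows "x \<in> multi_subdiff (indicator_fun C)"
  unfolding multi_subdiff_def
  using assms subdiff_indicator_fun[of x C v] subdiff_indicator_fun[of x C 0] by force

lemma closed_convex_max:
  assumes f: "closed_convex_fun f" and g: "closed_convex_fun g"
  shows "closed_convex_fun (\<lambda>x. max (f x) (g x))"
proof -
  have "ereal_epigraph (\<lambda>x. max (f x) (g x)) = ereal_epigraph f \<inter> ereal_epigraph g"
    by (auto simp: ereal_epigraph_def)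
  moreover have "max (f ((1 - t) *\<^sub>R x + t *\<^sub>R y)) (g ((1 - t) *\<^sub>R x + t *\<^sub>R y))
      \<le> ereal (1 - t) * max (f x) (g x) + ereal t * max (f y) (g y)" if t: "t \<in> {0..1}" for x y t
  proof (rule max.boundedI)
    have "f ((1 - t) *\<^sub>R x + t *\<^sub>R y) \<le> ereal (1 - t) * f x + ereal t * f y"
      using f t by (auto simp: closed_convex_fun_def)
    also have "\<dots> \<le> ereal (1 - t) * max (f x) (g x) + ereal t * max (f y) (g y)"
      using t by (intro add_mono ereal_mult_left_mono) auto
    finally show "f ((1 - t) *\<^sub>R x + t *\<^sub>R y) \<le> \<dots>" .
    have "g ((1 - t) *\<^sub>R x + t *\<^sub>R y) \<le> ereal (1 - t) * g x + ereal t * g y"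
      using g t by (auto simp: closed_convex_fun_def)
    also have "\<dots> \<le> ereal (1 - t) * max (f x) (g x) + ereal t * max (f y) (g y)"
      using t by (intro add_mono ereal_mult_left_mono) auto
    finally show "g ((1 - t) *\<^sub>R x + t *\<^sub>R y) \<le> \<dots>" .
  qed
  ultimately show ?thesis using f g by (auto simp: closed_convex_fun_def max_def)
qed

section \<open>Rockafellar's potential of a cyclically monotone set\<close>

lemma closed_convex_SUP_affine:
  fixes A :: "('a::euclidean_space \<times> real) set"
  assumes "A \<noteq> {}"
  shows "closed_convex_fun (\<lambda>z. SUP p\<in>A. ereal (z \<bullet> fst p + snd p))"
proof -
  define \<psi> where "\<psi> z = (SUP p\<in>A. ereal (z \<bullet> fst p + snd p))" for z
  have le: "ereal (z \<bullet> fst p + snd p) \<le> \<psi> z" if "p \<in> A" for z p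
    unfolding \<psi>_def using that by (rule SUP_upper)
  obtain p0 where p0: "p0 \<in> A" using assms by blast
  have nm: "\<psi> z \<noteq> - \<infinity>" for z using le[OF p0, of z] by auto
  have "ereal_epigraph \<psi> = (\<Inter>p\<in>A. {(z, t). z \<bullet> fst p + snd p \<le> t})"
    by (auto simp: ereal_epigraph_def \<psi>_def SUP_le_iff)
  moreover have "closed {(z :: 'a, t). z \<bullet> fst p + snd p \<le> t}" for p :: "'a \<times> real"
    unfolding case_prod_beta by (intro closed_Collect_le continuous_intros)
  ultimately have cl: "closed (ereal_epigraph \<psi>)" by (simp add: closed_INT)
  have "\<psi> ((1 - t) *\<^sub>R x + t *\<^sub>R y) \<le> ereal (1 - t) * \<psi> x + ereal t * \<psi> y" if t: "t \<in> {0..1}" for x y t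
    unfolding \<psi>_def[of "(1 - t) *\<^sub>R x + t *\<^sub>R y"]
  proof (rule SUP_least)
    fix p assume p: "p \<in> A"
    have "ereal (((1 - t) *\<^sub>R x + t *\<^sub>R y) \<bullet> fst p + snd p)
        = ereal (1 - t) * ereal (x \<bullet> fst p + snd p) + ereal t * ereal (y \<bullet> fst p + snd p)"
      by (simp add: inner_add_left algebra_simps)
    also have "\<dots> \<le> ereal (1 - t) * \<psi> x + ereal t * \<psi> y"
      using t by (intro add_mono ereal_mult_left_mono le[OF p]) auto
    finally show "ereal (((1 - t) *\<^sub>R x + t *\<^sub>R y) \<bullet> fst p + snd p) \<le> ereal (1 - t) * \<psi> x + ereal t * \<psi> y" .
  qed
  then show ?thesis using cl nm unfolding closed_convex_fun_def \<psi>_def by auto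
qed

text \<open>The pair \<open>(v, a)\<close> stands for the affine function \<open>z \<mapsto> z \<bullet> v + a\<close>; these are the functions
  occurring in Rockafellar's supremum over chains starting at \<open>(0, 0)\<close>.\<close>

inductive_set chain_affine :: "('a::real_inner \<times> 'a) set \<Rightarrow> ('a \<times> real) set" for T where
  start: "(0, 0) \<in> chain_affine T"
| extend: "(v, a) \<in> chain_affine T \<Longrightarrow> (x, y) \<in> T \<Longrightarrow> (y, x \<bullet> v + a - x \<bullet> y) \<in> chain_affine T"

text \<open>Unfolds the recursion into the sums that occur in cyclic monotonicity. The chain is
  numbered from its most recent pair \<open>0\<close> back to its starting pair
  \<open>n\<close>.\<close>

lemma chain_affine_path:
  assumes "(v, a) \<in> chain_affine T" "(0, 0) \<in> T"
  shows "\<exists>n x y. (\<forall>i\<le>n. (x i, y i) \<in> T) \<and> y 0 = v \<and> x n = 0 \<and>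
    a = (\<Sum>i<n. x i \<bullet> y (Suc i)) - (\<Sum>i\<le>n. x i \<bullet> y i)"
  using assms(1)
proof (induction rule: chain_affine.induct)
  case start
  then show ?case using assms(2) by (intro exI[of _ 0] exI[of _ "\<lambda>_. 0"]) auto
next
  case (extend v a x0 y0)
  then obtain n x y where *: "\<forall>i\<le>n. (x i, y i) \<in> T" "y 0 = v" "x n = 0"
    "a = (\<Sum>i<n. x i \<bullet> y (Suc i)) - (\<Sum>i\<le>n. x i \<bullet> y i)" by blast
  show ?case
  proof (intro exI conjI)
    show "\<forall>i\<le>Suc n. (case_nat x0 x i, case_nat y0 y i) \<in> T"
      using *(1) extend.hyps by (auto split: nat.split)
    show "x0 \<bullet> v + a - x0 \<bullet> y0 = (\<Sum>i<Suc n. case_nat x0 x i \<bullet> case_nat y0 y (Suc i))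
        - (\<Sum>i\<le>Suc n. case_nat x0 x i \<bullet> case_nat y0 y i)"
      by (simp add: sum.lessThan_Suc_shift sum.atMost_Suc_shift *(2,4) del: sum.lessThan_Suc sum.atMost_Suc)
  qed (use * in auto)
qed

text \<open>This is cyclic monotonicity of the closed chain: the closing term
  \<open>x n \<bullet> y 0\<close> vanishes because the chain starts at
  \<open>x n = 0\<close>.\<close>

lemma chain_affine_nonpos:
  assumes cm: "cyclically_monotone T" and T0: "(0, 0) \<in> T" and va: "(v, a) \<in> chain_affine T"
  shows "a \<le> 0"
proof -
  obtain n x y where *: "\<forall>i\<le>n. (x i, y i) \<in> T" "y 0 = v" "x n = 0"
    "a = (\<Sum>i<n. x i \<bullet> y (Suc i)) - (\<Sum>i\<le>n. x i \<bullet> y i)"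
    using chain_affine_path[OF va T0] by blast
  show ?thesis
  proof (cases "n = 0")
    case True then show ?thesis using * by simp
  next
    case False
    then have "(\<Sum>i<Suc n. x i \<bullet> y (Suc i mod Suc n)) \<le> (\<Sum>i<Suc n. x i \<bullet> y i)"
      using cm[unfolded cyclically_monotone_def, rule_format, of "Suc n" x y] *(1)
      by (simp only: less_Suc_eq_le)
    also have "(\<Sum>i<Suc n. x i \<bullet> y (Suc i mod Suc n)) = (\<Sum>i<n. x i \<bullet> y (Suc i))"
      using *(3) by simp
    finally show ?thesis using *(4) by (simp add: lessThan_Suc_atMost)
  qed
qed

lemma cyclically_monotone_imp_subdiff:
  fixes T :: "('a::euclidean_space \<times> 'a) set"
  assumes cm: "cyclically_monotone T" and T0: "(0, 0) \<in> T"
  shows "\<exists>\<psi>. closed_convex_fun \<psi> \<and> \<psi> 0 = 0 \<and> T \<subseteq> subdiff \<psi>"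
proof (intro exI conjI)
  define \<psi> where "\<psi> = (\<lambda>z. SUP p\<in>chain_affine T. ereal (z \<bullet> fst p + snd p))"
  show cc: "closed_convex_fun \<psi>"
    unfolding \<psi>_def by (rule closed_convex_SUP_affine) (use chain_affine.start in auto)
  have le: "ereal (z \<bullet> v + a) \<le> \<psi> z" if "(v, a) \<in> chain_affine T" for z v a
    unfolding \<psi>_def using SUP_upper[OF that, of "\<lambda>p. ereal (z \<bullet> fst p + snd p)"] by simp
  have least: "\<psi> z \<le> c" if "\<And>v a. (v, a) \<in> chain_affine T \<Longrightarrow> ereal (z \<bullet> v + a) \<le> c" for z c
    unfolding \<psi>_def using that by (intro SUP_least) auto
  show "\<psi> 0 = 0"
  proof (rule antisym)
    show "\<psi> 0 \<le> 0" by (rule least) (simp add: chain_affine_nonpos[OF cm T0])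
    show "0 \<le> \<psi> 0" using le[OF chain_affine.start, of 0] by (simp add: zero_ereal_def)
  qed
  show "T \<subseteq> subdiff \<psi>"
  proof clarify
    fix x y assume xy: "(x, y) \<in> T"
    \<comment> \<open>Appending \<open>(x, y)\<close> to a chain leaves a constant term that is at
      most \<open>0\<close>. This bounds every member of the supremum at \<open>x\<close>, so first
      coordinates of \<open>T\<close> lie in the domain.\<close>
    have "\<psi> x \<le> ereal (x \<bullet> y)"
      using chain_affine_nonpos[OF cm T0 chain_affine.extend[OF _ xy]] by (intro least) force
    then have "\<psi> x < \<infinity>" by (auto simp: le_less_trans)
    then obtain r where r: "\<psi> x = ereal r" using closed_convex_finite[OF cc] by blast
    have "r + (z - x) \<bullet> y \<le> t" if t: "\<psi> z = ereal t" for z t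
    proof -
      have "\<psi> x \<le> ereal (t - (z - x) \<bullet> y)"
      proof (rule least)
        fix v a assume "(v, a) \<in> chain_affine T"
        from le[OF chain_affine.extend[OF this xy], of z] t
        show "ereal (x \<bullet> v + a) \<le> ereal (t - (z - x) \<bullet> y)"
          by (simp add: inner_diff_left)
      qed
      then show ?thesis using r by simp
    qed
    then show "(x, y) \<in> subdiff \<psi>" using subdiff_iff[OF cc] r by blast
  qed
qed


section \<open>Limits of cyclically monotone sets\<close>

text \<open>The Kuratowski lower limit. The sets converge when every point that they approach
  frequently already belongs to it; this is the hypothesis \<open>K\<close> of later lemmas.\<close>

definition liminf_set :: "(nat \<Rightarrow> 'b::topological_space set) \<Rightarrow> 'b set" where
  "liminf_set T = {z. \<forall>U. open U \<longrightarrow> z \<in> U \<longrightarrow> (\<forall>\<^sub>F n in sequentially. T n \<inter> U \<noteq> {})}"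

text \<open>Sequential compactness of closed sets in the sense of Kuratowski: it suffices to decide, for
  the countably many members of a base, whether a subsequence hits them eventually or never.\<close>

lemma kuratowski_subsequence:
  fixes T :: "nat \<Rightarrow> 'b::second_countable_topology set"
  shows "\<exists>\<sigma>. strict_mono \<sigma> \<and> (\<forall>z. (\<forall>U. open U \<longrightarrow> z \<in> U \<longrightarrow> (\<exists>\<^sub>F n in sequentially. T (\<sigma> n) \<inter> U \<noteq> {})) \<longrightarrow>
    z \<in> liminf_set (\<lambda>n. T (\<sigma> n)))"
proof -
  obtain \<B> :: "'b set set" where \<B>: "countable \<B>" "topological_basis \<B>" using ex_countable_basis by blast
  \<comment> \<open>The empty set is added so that the enumeration of the base is legitimate in
    every case.\<close>
  then have ne: "insert {} \<B> \<noteq> {}" "countable (insert {} \<B>)" by auto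
  define V where "V = from_nat_into (insert {} \<B>)"
  have V: "range V = insert {} \<B>" unfolding V_def by (rule range_from_nat_into[OF ne])
  define P where "P k s \<longleftrightarrow> (\<forall>\<^sub>F n in sequentially. T (s n) \<inter> V k \<noteq> {}) \<or> (\<forall>\<^sub>F n in sequentially. T (s n) \<inter> V k = {})"
    for k :: nat and s :: "nat \<Rightarrow> nat"
  interpret subseqs P
  proof
    fix n and s :: "nat \<Rightarrow> nat" assume "strict_mono s"
    show "\<exists>r. strict_mono r \<and> P n (s \<circ> r)"
    proof (cases "\<exists>\<^sub>F i in sequentially. T (s i) \<inter> V n \<noteq> {}")
      case True
      then have inf: "infinite {i. T (s i) \<inter> V n \<noteq> {}}"
        by (simp add: frequently_cofinite cofinite_eq_sequentially[symmetric])
      then show ?thesis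
        using strict_mono_enumerate[OF inf] enumerate_in_set[OF inf]
        by (intro exI[of _ "enumerate {i. T (s i) \<inter> V n \<noteq> {}}"]) (auto simp: P_def)
    next
      case False
      then have "P n (s \<circ> id)" by (auto simp: P_def not_frequently)
      then show ?thesis using strict_mono_id by blast
    qed
  qed
  have "P k (diagseq \<circ> (+) (Suc k))" for k
    by (rule diagseq_holds) (auto simp: P_def o_def dest: eventually_subseq)
  then obtain \<sigma> where \<sigma>: "strict_mono \<sigma>" "\<And>k. P k (\<sigma> \<circ> (+) (Suc k))"
    using subseq_diagseq by blast
  \<comment> \<open>The diagonal sequence settles the \<open>k\<close>-th basic set only from index
    \<open>Suc k\<close> on, which does not matter for eventual properties.\<close>
  have Pd: "P k \<sigma>" for k
  proof -
    have shift: "eventually Q sequentially" if "eventually (\<lambda>n. Q (Suc k + n)) sequentially" for Q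
      using that eventually_sequentially_seg[of Q "Suc k"] by (simp add: add.commute)
    show ?thesis using \<sigma>(2)[of k] unfolding P_def o_def
      using shift[of "\<lambda>n. T (\<sigma> n) \<inter> V k \<noteq> {}"] shift[of "\<lambda>n. T (\<sigma> n) \<inter> V k = {}"] by blast
  qed
  show ?thesis
  proof (intro exI conjI allI impI)
    show "strict_mono \<sigma>" by (rule \<sigma>(1))
    fix z assume freq: "\<forall>U. open U \<longrightarrow> z \<in> U \<longrightarrow> (\<exists>\<^sub>F n in sequentially. T (\<sigma> n) \<inter> U \<noteq> {})"
    show "z \<in> liminf_set (\<lambda>n. T (\<sigma> n))" unfolding liminf_set_def
    proof (intro CollectI allI impI)
    fix U assume U: "open U" "z \<in> U"
    obtain B where B: "B \<in> \<B>" "z \<in> B" "B \<subseteq> U" using topological_basisE[OF \<B>(2) U] by metis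
    obtain k where k: "V k = B" using V B(1) by (metis imageE insertI2)
    have "open B" using \<B>(2) B(1) by (rule topological_basis_open)
    then have "\<not> (\<forall>\<^sub>F n in sequentially. T (\<sigma> n) \<inter> V k = {})"
      using freq B(2) k by (auto simp: frequently_def)
    then have "\<forall>\<^sub>F n in sequentially. T (\<sigma> n) \<inter> V k \<noteq> {}" using Pd[of k] by (simp add: P_def)
    then show "\<forall>\<^sub>F n in sequentially. T (\<sigma> n) \<inter> U \<noteq> {}"
      by eventually_elim (use k B(3) in blast)
    qed
  qed
qed

lemma closed_liminf_set: "closed (liminf_set T)"
  unfolding closed_def open_subopen[of "- liminf_set T"]
proof
  fix z assume "z \<in> - liminf_set T"
  then obtain U where "open U" "z \<in> U" "\<not> (\<forall>\<^sub>F n in sequentially. T n \<inter> U \<noteq> {})"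
    by (auto simp: liminf_set_def)
  then show "\<exists>U. open U \<and> z \<in> U \<and> U \<subseteq> - liminf_set T"
    by (intro exI[of _ U]) (auto simp: liminf_set_def)
qed

text \<open>Nearest points need not exist, so the sequence misses the distance to \<open>T n\<close>
  by less than \<open>1 / Suc n\<close>.\<close>

lemma liminf_set_sequence:
  fixes T :: "nat \<Rightarrow> 'b::metric_space set"
  assumes "z \<in> liminf_set T" "\<And>n. T n \<noteq> {}"
  obtains w where "\<And>n. w n \<in> T n" "w \<longlonglongrightarrow> z"
proof -
  have "\<exists>w\<in>T n. dist w z < infdist z (T n) + 1 / Suc n" for n
  proof -
    have "infdist z (T n) < infdist z (T n) + 1 / Suc n" by simp
    then show ?thesis using assms(2)[of n] unfolding infdist_notempty[OF assms(2)[of n]]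
      by (subst (asm) cINF_less_iff) (auto simp: dist_commute intro: bdd_belowI[of _ 0])
  qed
  then obtain w where w: "\<And>n. w n \<in> T n" "\<And>n. dist (w n) z < infdist z (T n) + 1 / Suc n" by metis
  have "w \<longlonglongrightarrow> z"
  proof (rule metric_LIMSEQ_I)
    fix e :: real assume e: "0 < e"
    have "\<forall>\<^sub>F n in sequentially. T n \<inter> ball z (e / 2) \<noteq> {}"
      using assms(1) e unfolding liminf_set_def by auto
    moreover have "\<forall>\<^sub>F n in sequentially. 1 / Suc n < e / 2"
      using e LIMSEQ_inverse_real_of_nat by (intro order_tendstoD(2)[of _ 0]) (auto simp: inverse_eq_divide)
    ultimately have "\<forall>\<^sub>F n in sequentially. dist (w n) z < e"
    proof eventually_elim
      case (elim n)
      then obtain u where "u \<in> T n" "dist z u < e / 2" by auto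
      then have "infdist z (T n) < e / 2" using infdist_le[of u "T n" z] by simp
      then show ?case using w(2)[of n] elim(2) by linarith
    qed
    then show "\<exists>no. \<forall>n\<ge>no. dist (w n) z < e" by (simp add: eventually_sequentially)
  qed
  then show ?thesis using that w(1) by blast
qed

lemma cyclically_monotone_liminf:
  fixes T :: "nat \<Rightarrow> ('a::euclidean_space \<times> 'a) set"
  assumes cm: "\<And>n. cyclically_monotone (T n)" and ne: "\<And>n. T n \<noteq> {}"
  shows "cyclically_monotone (liminf_set T)"
  unfolding cyclically_monotone_def
proof (intro allI impI)
  fix n :: nat and x y :: "nat \<Rightarrow> 'a"
  assume n: "2 \<le> n" and xy: "\<forall>i<n. (x i, y i) \<in> liminf_set T"
  have "\<exists>w. (\<forall>k. w k \<in> T k) \<and> w \<longlonglongrightarrow> (x i, y i)" if "i < n" for i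
    using liminf_set_sequence[of "(x i, y i)" T] xy that ne by metis
  then obtain w where w: "\<And>i k. i < n \<Longrightarrow> w i k \<in> T k" "\<And>i. i < n \<Longrightarrow> w i \<longlonglongrightarrow> (x i, y i)" by metis
  have lx: "(\<lambda>k. fst (w i k)) \<longlonglongrightarrow> x i" "(\<lambda>k. snd (w i k)) \<longlonglongrightarrow> y i" if "i < n" for i
    using tendsto_fst[OF w(2)[OF that]] tendsto_snd[OF w(2)[OF that]] by auto
  have le: "(\<Sum>i<n. fst (w i k) \<bullet> snd (w (Suc i mod n) k)) \<le> (\<Sum>i<n. fst (w i k) \<bullet> snd (w i k))" for k
    using cm[of k, unfolded cyclically_monotone_def, rule_format, of n "\<lambda>i. fst (w i k)" "\<lambda>i. snd (w i k)"]
      n w(1) by simp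
  show "(\<Sum>i<n. x i \<bullet> y (Suc i mod n)) \<le> (\<Sum>i<n. x i \<bullet> y i)"
  proof (rule LIMSEQ_le)
    show "(\<lambda>k. \<Sum>i<n. fst (w i k) \<bullet> snd (w (Suc i mod n) k)) \<longlonglongrightarrow> (\<Sum>i<n. x i \<bullet> y (Suc i mod n))"
      using n by (intro tendsto_sum tendsto_inner lx) auto
    show "(\<lambda>k. \<Sum>i<n. fst (w i k) \<bullet> snd (w i k)) \<longlonglongrightarrow> (\<Sum>i<n. x i \<bullet> y i)"
      by (intro tendsto_sum tendsto_inner lx) auto
  qed (use le in blast)
qed

text \<open>A substitute for weak convergence: estimates between events in two measure spaces pass
  to the lower limit on the left and the upper limit on the right. Finiteness provides continuity
  from above on the right.\<close>

lemma emeasure_liminf_le_limsup: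
  fixes A :: "nat \<Rightarrow> 'a set" and B :: "nat \<Rightarrow> 'b set"
  assumes A: "\<And>n. A n \<in> sets M" and B: "\<And>n. B n \<in> sets N"
    and le: "\<And>n. n \<ge> n0 \<Longrightarrow> emeasure M (A n) \<le> emeasure N (B n)"
    and fin: "emeasure N (\<Union>n. B n) < \<infinity>"
  shows "emeasure M (\<Union>k. \<Inter>n\<in>{k..}. A n) \<le> emeasure N (\<Inter>k. \<Union>n\<in>{k..}. B n)"
proof -
  have Us: "(\<Union>n\<in>{k..}. B n) \<in> sets N" for k using B by (intro sets.countable_UN') auto
  have Is: "(\<Inter>n\<in>{k..}. A n) \<in> sets M" for k using A by (intro sets.countable_INT') auto
  have "emeasure N (\<Union>n\<in>{k..}. B n) < \<infinity>" for k
    using B by (intro le_less_trans[OF emeasure_mono fin] sets.countable_UN') auto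
  then have "emeasure N (\<Inter>k. \<Union>n\<in>{k..}. B n) = (INF k. emeasure N (\<Union>n\<in>{k..}. B n))"
    using Us by (intro INF_emeasure_decseq[symmetric]) (auto simp: decseq_def less_top intro: order_trans)
  moreover have "emeasure M (\<Union>k. \<Inter>n\<in>{k..}. A n) = (SUP k. emeasure M (\<Inter>n\<in>{k..}. A n))"
    using Is by (intro SUP_emeasure_incseq[symmetric]) (auto simp: incseq_def)
  moreover have "emeasure M (\<Inter>n\<in>{k..}. A n) \<le> emeasure N (\<Union>n\<in>{j..}. B n)" for k j
  proof -
    define i where "i = max n0 (max k j)"
    have "emeasure M (\<Inter>n\<in>{k..}. A n) \<le> emeasure M (A i)"
      using A by (intro emeasure_mono) (auto simp: i_def)
    also have "\<dots> \<le> emeasure N (B i)" by (rule le) (simp add: i_def)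
    also have "\<dots> \<le> emeasure N (\<Union>n\<in>{j..}. B n)"
      using Us by (intro emeasure_mono) (auto simp: i_def intro!: bexI[of _ "max n0 (max k j)"])
    finally show ?thesis .
  qed
  ultimately show ?thesis by (auto intro!: SUP_least INF_greatest)
qed


section \<open>Semidiscrete transport\<close>

lemma sets_M0: "\<mu> \<in> M0 \<Longrightarrow> A \<in> sets borel \<Longrightarrow> 0 \<notin> A \<Longrightarrow> A \<in> sets \<mu>"
  by (auto simp: M0_def sets_restrict_space_iff)

lemma space_M0: "\<mu> \<in> M0 \<Longrightarrow> space \<mu> = - {0}"
  using sets_eq_imp_space_eq[of \<mu> punctured_borel] by (simp add: M0_def space_restrict_space)

lemma sets_M0_D: "\<mu> \<in> M0 \<Longrightarrow> A \<in> sets \<mu> \<Longrightarrow> A \<in> sets borel \<and> 0 \<notin> A"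
  by (auto simp: M0_def sets_restrict_space_iff)

lemma emeasure_M0_finite:
  assumes \<mu>: "\<mu> \<in> M0" and B: "B \<in> sets borel" "0 < r" "\<And>x. x \<in> B \<Longrightarrow> r \<le> norm x"
  shows "emeasure \<mu> B < \<infinity>"
proof -
  have "closure B \<subseteq> {x. r \<le> norm x}"
    using B(3) by (intro closure_minimal closed_Collect_le continuous_intros) auto
  then have "0 \<notin> closure B" using B(2) by auto
  then show ?thesis using \<mu> B(1) by (auto simp: M0_def)
qed

text \<open>Closed sets of finite mass that exhaust the punctured space; arguments that need
  subtraction or regularity are carried out on them.\<close>

definition away :: "nat \<Rightarrow> 'a::real_normed_vector set" where
  "away k = {y. 1 / real (Suc k) \<le> norm y}"

lemma closed_norm_ge: "closed {y :: 'a::real_normed_vector. r \<le> norm y}"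
  by (intro closed_Collect_le continuous_intros)

lemma closed_away [simp]: "closed (away k)"
  unfolding away_def by (rule closed_norm_ge)

lemma zero_notin_away [simp]: "0 \<notin> away k"
  by (simp add: away_def)

lemma away_borel [simp]: "away k \<in> sets borel"
  by (rule borel_closed) simp

lemma incseq_away: "incseq (\<lambda>k. B \<inter> away k)"
proof (rule incseq_SucI)
  fix k
  have "1 / real (Suc (Suc k)) \<le> 1 / real (Suc k)" by (simp add: field_simps)
  then show "B \<inter> away k \<subseteq> B \<inter> away (Suc k)" unfolding away_def by (auto simp del: of_nat_Suc)
qed

lemma UN_away:
  assumes "0 \<notin> B" shows "(\<Union>k. B \<inter> away k) = B"
proof (intro equalityI subsetI)
  fix y assume y: "y \<in> B"
  then have "0 < norm y" using assms by auto
  then obtain k where "1 / real (Suc k) < norm y" using nat_approx_posE by blast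
  then show "y \<in> (\<Union>k. B \<inter> away k)" using y by (auto simp: away_def intro!: exI[of _ k])
qed auto

lemma emeasure_away_finite:
  assumes "\<mu> \<in> M0" "B \<in> sets borel" shows "emeasure \<mu> (B \<inter> away k) < \<infinity>"
  using assms
  by (intro emeasure_M0_finite[of \<mu> _ "1 / real (Suc k)"]) (auto simp: away_def)

lemma ident_measurable_M0:
  assumes "\<mu> \<in> M0" shows "(\<lambda>x. x) \<in> measurable \<mu> borel"
  using space_M0[OF assms] by (intro measurableI sets_M0[OF assms]) auto

text \<open>The Laguerre cell of \<open>y\<close> for the maximum of the functions
  \<open>x \<bullet> y - b y\<close> and \<open>0\<close>. Strict inequalities make it open, and
  ties lie on hyperplanes.\<close>

definition cell :: "'a::euclidean_space set \<Rightarrow> ('a \<Rightarrow> real) \<Rightarrow> 'a \<Rightarrow> 'a set" where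
  "cell Y b y = {x. x \<noteq> 0 \<and> 0 < x \<bullet> y - b y \<and> (\<forall>y'\<in>Y - {y}. x \<bullet> y' - b y' < x \<bullet> y - b y)}"

text \<open>Only the differences to the weight of \<open>y\<close> matter, together with that weight
  itself, which measures the difference to the zero function.\<close>

lemma cell_subset:
  assumes "\<And>y'. y' \<in> Y \<Longrightarrow> b y' - b y \<le> c y' - c y" "c y \<le> b y"
  shows "cell Y b y \<subseteq> cell Y c y"
proof
  fix x assume x: "x \<in> cell Y b y"
  have "x \<bullet> y' - c y' < x \<bullet> y - c y" if "y' \<in> Y - {y}" for y'
  proof -
    have "x \<bullet> y' - b y' < x \<bullet> y - b y" using x that by (auto simp: cell_def)
    then show ?thesis using assms(1)[of y'] that by auto
  qed
  then show "x \<in> cell Y c y" using x assms(2) by (auto simp: cell_def)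
qed

lemma open_cell:
  assumes "finite Y" shows "open (cell Y b y)"
proof -
  have "cell Y b y = - {0} \<inter> {x. 0 < x \<bullet> y - b y} \<inter> (\<Inter>y'\<in>Y - {y}. {x. x \<bullet> y' - b y' < x \<bullet> y - b y})"
    by (auto simp: cell_def)
  moreover have "open \<dots>"
    using assms by (intro open_Int open_INT ballI open_Collect_less continuous_intros) auto
  ultimately show ?thesis by simp
qed

lemma emeasure_halfspace_finite:
  fixes \<mu> :: "'a::euclidean_space measure"
  assumes \<mu>: "\<mu> \<in> M0" and c: "0 < c" and B: "B \<in> sets borel" "\<And>x. x \<in> B \<Longrightarrow> c \<le> x \<bullet> y" and y: "y \<noteq> 0"
  shows "emeasure \<mu> B < \<infinity>"
proof (rule emeasure_M0_finite[OF \<mu> B(1)])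
  show "0 < c / norm y" using c y by simp
  fix x assume "x \<in> B"
  then have "c \<le> norm x * norm y" using B(2) norm_cauchy_schwarz[of x y] by fastforce
  then show "c / norm y \<le> norm x" using y by (simp add: pos_divide_le_eq)
qed

lemma emeasure_decseq_less:
  assumes "range A \<subseteq> sets M" "decseq A" "\<And>n. emeasure M (A n) \<noteq> \<infinity>" "emeasure M (\<Inter>n. A n) < c"
  shows "\<exists>n. emeasure M (A n) < c"
proof -
  have "(INF n. emeasure M (A n)) < c"
    using INF_emeasure_decseq[OF assms(1-3)] assms(4) by simp
  then show ?thesis by (auto simp: Inf_less_iff)
qed

text \<open>A cell lies in the half-space \<open>b y < x \<bullet> y\<close>. As \<open>b y\<close>
  grows, these half-spaces of finite mass shrink to the empty set, so large weights meet every
  constraint.\<close>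

lemma semidiscrete_weights_nonempty:
  fixes \<mu> :: "'a::euclidean_space measure"
  assumes \<mu>: "\<mu> \<in> M0" and Y: "finite Y" "0 \<notin> Y" and m: "\<And>y. y \<in> Y \<Longrightarrow> 0 < m y"
  shows "\<exists>b. \<forall>y\<in>Y. 0 \<le> b y \<and> emeasure \<mu> (cell Y b y) \<le> m y"
proof -
  have "\<exists>n. emeasure \<mu> {x. real (Suc n) < x \<bullet> y} < m y" if y: "y \<in> Y" for y
  proof (rule emeasure_decseq_less)
    have bor: "{x. real (Suc n) < x \<bullet> y} \<in> sets borel" for n
      by (intro borel_open open_Collect_less continuous_intros)
    show "range (\<lambda>n. {x. real (Suc n) < x \<bullet> y}) \<subseteq> sets \<mu>"
      using bor by (auto intro!: sets_M0[OF \<mu>])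
    show "decseq (\<lambda>n. {x. real (Suc n) < x \<bullet> y})" by (auto simp: decseq_def)
    have "emeasure \<mu> {x. real (Suc n) < x \<bullet> y} < \<infinity>" for n
      using bor y Y by (intro emeasure_halfspace_finite[OF \<mu>, of 1 _ y]) auto
    then show "emeasure \<mu> {x. real (Suc n) < x \<bullet> y} \<noteq> \<infinity>" for n by (simp add: less_top)
    have "(\<Inter>n. {x. real (Suc n) < x \<bullet> y}) = {}"
    proof safe
      fix x assume x: "x \<in> (\<Inter>n. {x. real (Suc n) < x \<bullet> y})"
      obtain n where "x \<bullet> y \<le> real n" using real_arch_simple by blast
      moreover have "real (Suc n) < x \<bullet> y" using x by blast
      ultimately show "x \<in> {}" by simp
    qed
    then show "emeasure \<mu> (\<Inter>n. {x. real (Suc n) < x \<bullet> y}) < m y" using m[OF y] by simp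
  qed
  then obtain n where n: "\<And>y. y \<in> Y \<Longrightarrow> emeasure \<mu> {x. real (Suc (n y)) < x \<bullet> y} < m y" by metis
  define b where "b y = real (Suc (n y))" for y
  have "emeasure \<mu> (cell Y b y) \<le> m y" if y: "y \<in> Y" for y
  proof -
    have "{x. b y < x \<bullet> y} \<in> sets \<mu>"
      by (intro sets_M0[OF \<mu>] borel_open open_Collect_less continuous_intros) (auto simp: b_def)
    then have "emeasure \<mu> (cell Y b y) \<le> emeasure \<mu> {x. b y < x \<bullet> y}"
      by (intro emeasure_mono) (auto simp: cell_def)
    then show ?thesis using n[OF y] by (simp add: b_def)
  qed
  then show ?thesis by (intro exI[of _ b]) (auto simp: b_def)
qed

text \<open>Points with margin \<open>1 / Suc k\<close> stay in the cell when the weights are raised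
  by less than the margin. This lets a mass bound for nearby weights pass to their infimum.\<close>

lemma cell_UN:
  fixes y :: "'a::euclidean_space"
  assumes "finite Y"
  shows "cell Y b y = (\<Union>k. {x. x \<noteq> 0 \<and> 1 / real (Suc k) < x \<bullet> y - b y \<and>
    (\<forall>y'\<in>Y - {y}. x \<bullet> y' - b y' + 1 / real (Suc k) < x \<bullet> y - b y)})" (is "_ = (\<Union>k. ?W k)")
proof (intro equalityI subsetI)
  fix x assume x: "x \<in> cell Y b y"
  have lim: "(\<lambda>k. 1 / real (Suc k)) \<longlonglongrightarrow> 0"
    using LIMSEQ_inverse_real_of_nat by (simp add: inverse_eq_divide)
  have small: "\<forall>\<^sub>F k in sequentially. 1 / real (Suc k) < c" if "0 < c" for c
    using order_tendstoD(2)[OF lim that] .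
  have "\<forall>\<^sub>F k in sequentially. \<forall>y'\<in>Y - {y}. x \<bullet> y' - b y' + 1 / real (Suc k) < x \<bullet> y - b y"
  proof (intro eventually_ball_finite ballI)
    fix y' assume "y' \<in> Y - {y}"
    then have "0 < (x \<bullet> y - b y) - (x \<bullet> y' - b y')" using x by (auto simp: cell_def)
    from eventually_mono[OF small[OF this]]
    show "\<forall>\<^sub>F k in sequentially. x \<bullet> y' - b y' + 1 / real (Suc k) < x \<bullet> y - b y"
      by (simp add: less_diff_eq add.commute)
  qed (use assms in simp)
  moreover have "\<forall>\<^sub>F k in sequentially. 1 / real (Suc k) < x \<bullet> y - b y"
    using x by (intro small) (auto simp: cell_def)
  ultimately have "\<forall>\<^sub>F k in sequentially. x \<in> ?W k"
    by eventually_elim (use x in \<open>auto simp: cell_def\<close>)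
  then show "x \<in> (\<Union>k. ?W k)" by (auto simp: eventually_sequentially)
next
  fix x assume "x \<in> (\<Union>k. ?W k)"
  then obtain k where k: "x \<in> ?W k" by blast
  have pos: "0 < 1 / real (Suc k)" by simp
  have "x \<bullet> y' - b y' < x \<bullet> y - b y" if "y' \<in> Y - {y}" for y'
  proof -
    have "x \<bullet> y' - b y' + 1 / real (Suc k) < x \<bullet> y - b y" using k that by blast
    then show ?thesis using pos by linarith
  qed
  moreover have "x \<noteq> 0" "1 / real (Suc k) < x \<bullet> y - b y" using k by auto
  ultimately show "x \<in> cell Y b y"
    using less_trans[OF pos] unfolding cell_def by blast
qed

text \<open>The feasible weights are closed under minima and under decreasing limits, so a least feasible
  weight exists; a constraint that is slack at a positive weight would allow decreasing it.\<close>

lemma semidiscrete_weights: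
  fixes \<mu> :: "'a::euclidean_space measure"
  assumes \<mu>: "\<mu> \<in> M0" and Y: "finite Y" "0 \<notin> Y" and m: "\<And>y. y \<in> Y \<Longrightarrow> 0 < m y"
    and hyp: "\<And>w c. w \<noteq> 0 \<Longrightarrow> emeasure \<mu> ({x. x \<bullet> w = c} - {0}) = 0"
  shows "\<exists>b. \<forall>y\<in>Y. 0 \<le> b y \<and> emeasure \<mu> (cell Y b y) \<le> m y \<and>
    (0 < b y \<longrightarrow> emeasure \<mu> (cell Y b y) = m y)"
proof -
  define F where "F = {b. \<forall>y\<in>Y. 0 \<le> b y \<and> emeasure \<mu> (cell Y b y) \<le> m y}"
  have cs: "cell Y b y \<in> sets \<mu>" for b y
    by (intro sets_M0[OF \<mu>] borel_open open_cell Y) (auto simp: cell_def)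
  have mono: "emeasure \<mu> (cell Y b y) \<le> emeasure \<mu> (cell Y c y)"
    if "\<And>y'. y' \<in> Y \<Longrightarrow> b y' - b y \<le> c y' - c y" "c y \<le> b y" for b c y
    by (intro emeasure_mono cell_subset cs that)
  have Fne: "F \<noteq> {}"
    using semidiscrete_weights_nonempty[OF \<mu> Y, of m] m by (auto simp: F_def)
  define bs where "bs y = (INF b\<in>F. b y)" for y
  have bdd: "bdd_below ((\<lambda>b. b y) ` F)" if "y \<in> Y" for y
    using that by (auto simp: F_def intro!: bdd_belowI[of _ 0])
  have bs_le: "bs y \<le> b y" if "b \<in> F" "y \<in> Y" for b y
    unfolding bs_def using that by (intro cINF_lower bdd)
  have bs0: "0 \<le> bs y" if "y \<in> Y" for y
    unfolding bs_def using that by (intro cINF_greatest Fne) (auto simp: F_def)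
  \<comment> \<open>At \<open>y\<close> the minimum is one of the two weights, and lowering the
    weights of the competitors only shrinks the cell of \<open>y\<close>.\<close>
  have minF: "(\<lambda>y. min (b y) (c y)) \<in> F" if bc: "b \<in> F" "c \<in> F" for b c
  proof -
    have "emeasure \<mu> (cell Y (\<lambda>y. min (b y) (c y)) y) \<le> m y" if y: "y \<in> Y" for y
    proof (cases "b y \<le> c y")
      case True
      have "emeasure \<mu> (cell Y (\<lambda>y. min (b y) (c y)) y) \<le> emeasure \<mu> (cell Y b y)"
        using True by (intro mono) auto
      then show ?thesis using bc y by (fastforce simp: F_def)
    next
      case False
      have "emeasure \<mu> (cell Y (\<lambda>y. min (b y) (c y)) y) \<le> emeasure \<mu> (cell Y c y)"
        using False by (intro mono) auto
      then show ?thesis using bc y by (fastforce simp: F_def)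
    qed
    then show ?thesis using bc by (auto simp: F_def)
  qed
  \<comment> \<open>Closure under minima yields one feasible weight close to the infimum at finitely
    many points simultaneously.\<close>
  have near: "\<exists>b\<in>F. \<forall>y\<in>Y'. b y < bs y + e" if "0 < e" "finite Y'" "Y' \<subseteq> Y" for e Y'
    using that(2,3)
  proof (induction Y' rule: finite_induct)
    case empty then show ?case using Fne by auto
  next
    case (insert y Y')
    then obtain b where b: "b \<in> F" "\<forall>y\<in>Y'. b y < bs y + e" by auto
    have "bs y < bs y + e" using that(1) by simp
    then obtain c where c: "c \<in> F" "c y < bs y + e"
      using cINF_less_iff[OF Fne bdd[of y], of "bs y + e"] insert.prems unfolding bs_def by blast
    show ?case by (rule bexI[OF _ minF[OF b(1) c(1)]]) (use b c in \<open>auto simp: min_less_iff_disj\<close>)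
  qed
  have bsF: "emeasure \<mu> (cell Y bs y) \<le> m y" if y: "y \<in> Y" for y
  proof -
    define W where "W k = {x. x \<noteq> 0 \<and> 1 / real (Suc k) < x \<bullet> y - bs y \<and>
      (\<forall>y'\<in>Y - {y}. x \<bullet> y' - bs y' + 1 / real (Suc k) < x \<bullet> y - bs y)}" for k
    have Wle: "emeasure \<mu> (W k) \<le> m y" for k
    proof -
      obtain b where b: "b \<in> F" "\<forall>y\<in>Y. b y < bs y + 1 / real (Suc k)"
        using near[of "1 / real (Suc k)" Y] Y by auto
      have "x \<in> cell Y b y" if "x \<in> W k" for x
      proof -
        have "b y < bs y + 1 / real (Suc k)" using b y by blast
        moreover have "bs y' \<le> b y'" if "y' \<in> Y" for y' using bs_le b that by blast
        ultimately show ?thesis using that unfolding W_def cell_def by force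
      qed
      then have "emeasure \<mu> (W k) \<le> emeasure \<mu> (cell Y b y)" by (intro emeasure_mono cs) auto
      then show ?thesis using b(1) y by (fastforce simp: F_def)
    qed
    \<comment> \<open>Each \<open>W k\<close> is itself a cell, for the weight raised at
      \<open>y\<close> by the margin; this gives measurability.\<close>
    have "W k = cell Y (\<lambda>z. if z = y then bs y + 1 / real (Suc k) else bs z) y" for k
      unfolding W_def cell_def by (auto simp: algebra_simps)
    then have Ws: "range W \<subseteq> sets \<mu>" using cs by auto
    have "incseq W"
    proof (rule incseq_SucI)
      fix k have *: "1 / real (Suc (Suc k)) \<le> 1 / real (Suc k)" by (simp add: field_simps)
      show "W k \<subseteq> W (Suc k)"
      proof
        fix x assume x: "x \<in> W k"
        have "x \<bullet> y' - bs y' + 1 / real (Suc (Suc k)) < x \<bullet> y - bs y" if "y' \<in> Y - {y}" for y'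
        proof -
          have "x \<bullet> y' - bs y' + 1 / real (Suc k) < x \<bullet> y - bs y" using x that by (auto simp: W_def)
          then show ?thesis using * by linarith
        qed
        moreover have "x \<noteq> 0" "1 / real (Suc (Suc k)) < x \<bullet> y - bs y"
          using x * by (simp_all add: W_def)
        ultimately show "x \<in> W (Suc k)" by (simp add: W_def)
      qed
    qed
    then have "emeasure \<mu> (\<Union>k. W k) = (SUP k. emeasure \<mu> (W k))"
      using SUP_emeasure_incseq[OF Ws] by simp
    also have "\<dots> \<le> m y" by (intro SUP_least Wle)
    finally show ?thesis unfolding cell_UN[OF Y(1)] W_def by simp
  qed
  have bs_in: "bs \<in> F" using bs0 bsF by (auto simp: F_def)
  have "emeasure \<mu> (cell Y bs y) = m y" if y: "y \<in> Y" "0 < bs y" for y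
  proof (rule ccontr)
    assume "emeasure \<mu> (cell Y bs y) \<noteq> m y"
    then have less: "emeasure \<mu> (cell Y bs y) < m y" using bsF[OF y(1)] by simp
    \<comment> \<open>The weight at \<open>y\<close> is lowered by at most half of it, since
      \<open>real k + 2 \<ge> 2\<close>; the cells stay in a half-space of finite mass, where
      continuity from above applies.\<close>
    define c where "c k = bs(y := bs y - bs y / (real k + 2))" for k :: nat
    have cy: "bs y / 2 \<le> c k y" "c k y < bs y" for k
      using y(2) by (auto simp: c_def field_simps)
    have cother: "c k z = bs z" if "z \<noteq> y" for k z using that by (simp add: c_def)
    have "\<exists>k. emeasure \<mu> (cell Y (c k) y) < m y"
    proof (rule emeasure_decseq_less)
      show "range (\<lambda>k. cell Y (c k) y) \<subseteq> sets \<mu>" using cs by auto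
      have "c k y \<le> c (Suc k) y" for k using y(2) by (auto simp: c_def field_simps)
      then show "decseq (\<lambda>k. cell Y (c k) y)"
        by (intro decseq_SucI cell_subset) (auto simp: c_def)
      have "emeasure \<mu> (cell Y (c k) y) < \<infinity>" for k
      proof (rule emeasure_halfspace_finite[OF \<mu>])
        show "0 < bs y / 2" using y by simp
        show "cell Y (c k) y \<in> sets borel" using sets_M0_D[OF \<mu> cs] by blast
        show "bs y / 2 \<le> x \<bullet> y" if "x \<in> cell Y (c k) y" for x
          using that cy(1)[of k] by (auto simp: cell_def)
        show "y \<noteq> 0" using y Y by auto
      qed
      then show "emeasure \<mu> (cell Y (c k) y) \<noteq> \<infinity>" for k by (simp add: less_top)
      define H where "H w q = {x. x \<bullet> w = q} - {0}" for w :: 'a and q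
      have Hn: "H w q \<in> null_sets \<mu>" if "w \<noteq> 0" for w q
      proof -
        have "closed {x. x \<bullet> w = q}" by (intro closed_Collect_eq continuous_intros)
        then show ?thesis using hyp[OF that] unfolding H_def
          by (intro null_setsI sets_M0[OF \<mu>]) auto
      qed
      \<comment> \<open>In the limit strict inequalities become weak ones; \<open>N\<close> catches
        the points where equality occurs.\<close>
      define N where "N = H y (bs y) \<union> (\<Union>y'\<in>Y - {y}. H (y - y') (bs y - bs y'))"
      have N: "N \<in> null_sets \<mu>"
        unfolding N_def using Y by (intro null_sets.Un null_sets.finite_UN Hn) (use y in auto)
      have sub: "(\<Inter>k. cell Y (c k) y) \<subseteq> cell Y bs y \<union> N"
      proof
        fix x assume x: "x \<in> (\<Inter>k. cell Y (c k) y)"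
        have lim: "(\<lambda>k. c k y) \<longlonglongrightarrow> bs y"
        proof -
          have "(\<lambda>k. bs y - bs y / (real k + 2)) \<longlonglongrightarrow> bs y - 0"
            using LIMSEQ_ignore_initial_segment[OF lim_const_over_n[of "bs y"], of 2]
            by (intro tendsto_diff tendsto_const) (simp add: add.commute)
          then show ?thesis by (simp add: c_def)
        qed
        have in_cell: "x \<in> cell Y (c k) y" for k using x by blast
        have x0: "x \<noteq> 0" using in_cell[of 0] by (simp add: cell_def)
        have "bs y \<le> x \<bullet> y"
          by (rule LIMSEQ_le_const2[OF lim]) (use in_cell in \<open>force simp: cell_def intro: less_imp_le\<close>)
        moreover have "bs y \<le> x \<bullet> y - (x \<bullet> y' - bs y')" if y': "y' \<in> Y - {y}" for y'
        proof (rule LIMSEQ_le_const2[OF lim], intro exI allI impI)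
          fix n
          have "x \<bullet> y' - c n y' < x \<bullet> y - c n y" using in_cell[of n] y' by (auto simp: cell_def)
          then show "c n y \<le> x \<bullet> y - (x \<bullet> y' - bs y')" using cother[of y' n] y' by auto
        qed
        ultimately have le: "bs y \<le> x \<bullet> y" "\<And>y'. y' \<in> Y - {y} \<Longrightarrow> x \<bullet> y' - bs y' \<le> x \<bullet> y - bs y"
          by (force simp: algebra_simps)+
        show "x \<in> cell Y bs y \<union> N"
        proof (cases "x \<in> N")
          case False
          then have "x \<bullet> y \<noteq> bs y" "\<And>y'. y' \<in> Y - {y} \<Longrightarrow> x \<bullet> (y - y') \<noteq> bs y - bs y'"
            using x0 by (auto simp: N_def H_def)
          moreover have "x \<bullet> (y - y') = bs y - bs y' \<longleftrightarrow> x \<bullet> y' - bs y' = x \<bullet> y - bs y" for y'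
            unfolding inner_diff_right by linarith
          ultimately have "x \<bullet> y \<noteq> bs y" "\<And>y'. y' \<in> Y - {y} \<Longrightarrow> x \<bullet> y' - bs y' \<noteq> x \<bullet> y - bs y"
            by blast+
          then have "x \<in> cell Y bs y" using le x0 by (force simp: cell_def order_less_le)
          then show ?thesis by blast
        qed auto
      qed
      have "emeasure \<mu> (\<Inter>k. cell Y (c k) y) \<le> emeasure \<mu> (cell Y bs y \<union> N)"
        using N by (intro emeasure_mono sub sets.Un cs) auto
      also have "\<dots> = emeasure \<mu> (cell Y bs y)" by (rule emeasure_Un_null_set[OF cs N])
      finally show "emeasure \<mu> (\<Inter>k. cell Y (c k) y) < m y" using less by simp
    qed
    then obtain k where k: "emeasure \<mu> (cell Y (c k) y) < m y" by blast
    \<comment> \<open>Lowering one weight shrinks the other cells, so \<open>c k\<close> is feasible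
      and undercuts the infimum \<open>bs\<close> at \<open>y\<close>.\<close>
    have "c k \<in> F" unfolding F_def
    proof (intro CollectI ballI conjI)
      fix z assume z: "z \<in> Y"
      show "0 \<le> c k z" using cy(1)[of k] y(2) bs0[OF z] cother[of z k] by (cases "z = y") auto
      show "emeasure \<mu> (cell Y (c k) z) \<le> m z"
      proof (cases "z = y")
        case True then show ?thesis using k by simp
      next
        case False
        have "emeasure \<mu> (cell Y (c k) z) \<le> emeasure \<mu> (cell Y bs z)"
        proof (rule mono)
          show "c k y' - c k z \<le> bs y' - bs z" for y'
            using cy(2)[of k] cother[of y' k] cother[OF False, of k] by (cases "y' = y") auto
        qed (simp add: cother[OF False])
        then show ?thesis using bsF[OF z] by simp
      qed
    qed
    from bs_le[OF this y(1)] show False using cy(2)[of k] by simp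
  qed
  then show ?thesis using bs0 bsF by blast
qed

text \<open>Along a cycle the weights cancel, because the cyclic shift permutes the indices.\<close>

lemma cyclically_monotone_argmax:
  "cyclically_monotone {(x, y). y \<in> Y \<and> (\<forall>y'\<in>Y. x \<bullet> y' - b y' \<le> x \<bullet> y - (b y :: real))}"
  unfolding cyclically_monotone_def
proof (intro allI impI)
  fix n :: nat and x y :: "nat \<Rightarrow> 'a"
  assume n: "2 \<le> n" and "\<forall>i<n. (x i, y i) \<in> {(x, y). y \<in> Y \<and> (\<forall>y'\<in>Y. x \<bullet> y' - b y' \<le> x \<bullet> y - b y)}"
  then have *: "y i \<in> Y" "y' \<in> Y \<Longrightarrow> x i \<bullet> y' - b y' \<le> x i \<bullet> y i - b (y i)" if "i < n" for i y' using that by auto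
  have img: "(\<lambda>i. Suc i mod n) ` {..<n} = {..<n}"
  proof (intro equalityI subsetI)
    fix j assume j: "j \<in> {..<n}"
    show "j \<in> (\<lambda>i. Suc i mod n) ` {..<n}"
    proof (cases j)
      case 0 then show ?thesis using n by (intro image_eqI[of _ _ "n - 1"]) auto
    next
      case (Suc k) then show ?thesis using j by (intro image_eqI[of _ _ k]) auto
    qed
  qed (use n in auto)
  then have inj: "inj_on (\<lambda>i. Suc i mod n) {..<n}" by (intro eq_card_imp_inj_on) auto
  have "(\<Sum>i<n. b (y (Suc i mod n))) = (\<Sum>i<n. b (y i))"
    using sum.reindex[OF inj, of "\<lambda>i. b (y i)"] img by simp
  moreover have "(\<Sum>i<n. x i \<bullet> y (Suc i mod n) - b (y (Suc i mod n))) \<le> (\<Sum>i<n. x i \<bullet> y i - b (y i))"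
    using * n by (intro sum_mono) auto
  ultimately show "(\<Sum>i<n. x i \<bullet> y (Suc i mod n)) \<le> (\<Sum>i<n. x i \<bullet> y i)"
    by (simp add: sum_subtractf)
qed

text \<open>The simple function \<open>g\<close> discretizes \<nu>. Unsaturated atoms have weight
  \<open>0\<close>, hence \<open>(0, y) \<in> T\<close>; therefore masses are equal on sets
  \<open>B\<close> that avoid the section of \<open>T\<close> over \<open>0\<close>.\<close>

lemma semidiscrete_plan:
  fixes \<mu> \<nu> :: "'a::euclidean_space measure"
  assumes \<mu>: "\<mu> \<in> M0" and \<nu>: "\<nu> \<in> M0"
    and hyp: "\<And>w c. w \<noteq> 0 \<Longrightarrow> emeasure \<mu> ({x. x \<bullet> w = c} - {0}) = 0"
    and g: "g \<in> borel_measurable borel" "finite (range g)" "g 0 = 0"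
  shows "\<exists>T s. cyclically_monotone T \<and> (0, 0) \<in> T \<and> s \<in> borel_measurable borel \<and>
    (AE x in \<mu>. (x, s x) \<in> T) \<and>
    (\<forall>B\<in>sets borel. 0 \<notin> B \<longrightarrow> emeasure \<mu> (s -` B - {0}) \<le> emeasure \<nu> (g -` B) \<and>
      (B \<inter> {y. (0, y) \<in> T} = {} \<longrightarrow> emeasure \<mu> (s -` B - {0}) = emeasure \<nu> (g -` B)))"
proof -
  define m where "m y = emeasure \<nu> (g -` {y})" for y
  define Y where "Y = {y \<in> range g. y \<noteq> 0 \<and> 0 < m y}"
  have Y: "finite Y" "0 \<notin> Y" using g(2) by (auto simp: Y_def)
  have m: "\<And>y. y \<in> Y \<Longrightarrow> 0 < m y" by (simp add: Y_def)
  obtain b where "\<forall>y\<in>Y. 0 \<le> b y \<and> emeasure \<mu> (cell Y b y) \<le> m y \<and>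
      (0 < b y \<longrightarrow> emeasure \<mu> (cell Y b y) = m y)"
    using exE[OF semidiscrete_weights[of \<mu> Y m, OF \<mu> Y m hyp]] by metis
  then have b: "\<And>y. y \<in> Y \<Longrightarrow> 0 \<le> b y" "\<And>y. y \<in> Y \<Longrightarrow> emeasure \<mu> (cell Y b y) \<le> m y"
    "\<And>y. y \<in> Y \<Longrightarrow> 0 < b y \<Longrightarrow> emeasure \<mu> (cell Y b y) = m y"
    by blast+
  define b0 where "b0 = b(0 := 0)"
  define T where "T = {(x, y). y \<in> insert 0 Y \<and> (\<forall>y'\<in>insert 0 Y. x \<bullet> y' - b0 y' \<le> x \<bullet> y - b0 y)}"
  \<comment> \<open>The cells are disjoint, so at most one summand is nonzero; outside all cells the
    value is \<open>0\<close>, the maximizer there up to ties.\<close>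
  define s where "s x = (\<Sum>y\<in>Y. indicator (cell Y b y) x *\<^sub>R y)" for x
  have b0Y: "b0 y = b y" if "y \<in> Y" for y using that Y by (auto simp: b0_def)
  have b00: "b0 0 = 0" by (simp add: b0_def)
  have cb: "cell Y b y \<in> sets borel" for y by (intro borel_open open_cell Y)
  have disj: "x \<notin> cell Y b y'" if "x \<in> cell Y b y" "y \<in> Y" "y' \<in> Y" "y' \<noteq> y" for x y y'
  proof
    assume "x \<in> cell Y b y'"
    then have "x \<bullet> y - b y < x \<bullet> y' - b y'" using that by (auto simp: cell_def)
    moreover have "x \<bullet> y' - b y' < x \<bullet> y - b y" using that by (auto simp: cell_def)
    ultimately show False by simp
  qed
  have s_in: "s x = y" if "x \<in> cell Y b y" "y \<in> Y" for x y
  proof -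
    have "s x = (\<Sum>y'\<in>Y. if y' = y then y else 0)"
      unfolding s_def using disj[OF that] that by (intro sum.cong) (auto simp: indicator_def)
    then show ?thesis using that Y by simp
  qed
  have s_out: "s x = 0" if "\<And>y. y \<in> Y \<Longrightarrow> x \<notin> cell Y b y" for x
    unfolding s_def using that by (intro sum.neutral) auto
  have "AE x in \<mu>. (x, s x) \<in> T"
  proof -
    define N where "N = (\<Union>y\<in>insert 0 Y. \<Union>y'\<in>insert 0 Y - {y}. {x. x \<bullet> (y - y') = b0 y - b0 y'} - {0})"
    have "N \<in> null_sets \<mu>" unfolding N_def
    proof (intro null_sets.finite_UN)
      fix y y' assume "y' \<in> insert 0 Y - {y}"
      then have "y - y' \<noteq> 0" by auto
      moreover have "closed {x. x \<bullet> (y - y') = b0 y - b0 y'}" by (intro closed_Collect_eq continuous_intros)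
      ultimately show "{x. x \<bullet> (y - y') = b0 y - b0 y'} - {0} \<in> null_sets \<mu>"
        by (intro null_setsI hyp sets_M0[OF \<mu>]) auto
    qed (use Y in auto)
    moreover have "{x \<in> space \<mu>. (x, s x) \<notin> T} \<subseteq> N"
    proof (intro subsetI, rule ccontr)
      fix x assume x: "x \<in> {x \<in> space \<mu>. (x, s x) \<notin> T}" and "x \<notin> N"
      then have x0: "x \<noteq> 0" and nt: "\<And>y y'. y \<in> insert 0 Y \<Longrightarrow> y' \<in> insert 0 Y \<Longrightarrow> y' \<noteq> y \<Longrightarrow>
          x \<bullet> y - b0 y \<noteq> x \<bullet> y' - b0 y'"
        using space_M0[OF \<mu>] by (auto simp: N_def inner_diff_right algebra_simps)
      define f where "f y = x \<bullet> y - b0 y" for y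
      have fin: "finite (f ` insert 0 Y)" using Y by auto
      obtain y where y: "y \<in> insert 0 Y" "f y = Max (f ` insert 0 Y)"
        using Max_in[OF fin] by (metis empty_is_image imageE insert_not_empty)
      have le: "f y' \<le> f y" if "y' \<in> insert 0 Y" for y' using Max_ge[OF fin] y(2) that by auto
      have lt: "f y' < f y" if "y' \<in> insert 0 Y" "y' \<noteq> y" for y'
        using le[OF that(1)] nt[OF y(1) that] by (simp add: f_def)
      have "s x = y"
      proof (cases "y = 0")
        case True
        have "x \<notin> cell Y b y'" if "y' \<in> Y" for y'
        proof -
          have "y' \<noteq> 0" using that Y by auto
          then have "x \<bullet> y' - b y' < 0" using lt[of y'] that True b00 b0Y[OF that] by (simp add: f_def)
          then show ?thesis by (simp add: cell_def)
        qed
        then show ?thesis using s_out True by blast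
      next
        case False
        then have yY: "y \<in> Y" using y by auto
        have "x \<in> cell Y b y"
          unfolding cell_def
        proof (intro CollectI conjI ballI)
          show "x \<noteq> 0" by (rule x0)
          show "0 < x \<bullet> y - b y" using lt[of 0] False b00 b0Y[OF yY] by (auto simp: f_def)
          fix y' assume "y' \<in> Y - {y}"
          then show "x \<bullet> y' - b y' < x \<bullet> y - b y" using lt[of y'] b0Y[OF yY] b0Y[of y'] by (auto simp: f_def)
        qed
        then show ?thesis using s_in yY by blast
      qed
      moreover have "\<forall>y'\<in>insert 0 Y. x \<bullet> y' - b0 y' \<le> x \<bullet> y - b0 y" using le unfolding f_def by blast
      ultimately have "(x, s x) \<in> T" using y(1) unfolding T_def by blast
      then show False using x by simp
    qed
    ultimately show ?thesis by (rule AE_I')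
  qed
  moreover have "cyclically_monotone T" unfolding T_def by (rule cyclically_monotone_argmax)
  moreover have "(0, 0) \<in> T" using b(1) b0Y b00 by (auto simp: T_def)
  moreover have "s \<in> borel_measurable borel"
    unfolding s_def using cb by (intro borel_measurable_sum borel_measurable_scaleR borel_measurable_indicator) auto
  moreover have "emeasure \<mu> (s -` B - {0}) \<le> emeasure \<nu> (g -` B) \<and>
      (B \<inter> {y. (0, y) \<in> T} = {} \<longrightarrow> emeasure \<mu> (s -` B - {0}) = emeasure \<nu> (g -` B))"
    if B: "B \<in> sets borel" "0 \<notin> B" for B
  proof -
    have "s -` B - {0} = (\<Union>y\<in>Y \<inter> B. cell Y b y)"
    proof (intro equalityI subsetI)
      fix x assume x: "x \<in> s -` B - {0}"
      then obtain y where "y \<in> Y" "x \<in> cell Y b y" using s_out B(2) by force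
      then show "x \<in> (\<Union>y\<in>Y \<inter> B. cell Y b y)" using s_in x by auto
    qed (use s_in in \<open>auto simp: cell_def\<close>)
    then have 1: "emeasure \<mu> (s -` B - {0}) = (\<Sum>y\<in>Y \<inter> B. emeasure \<mu> (cell Y b y))"
    proof -
      have "disjoint_family_on (cell Y b) (Y \<inter> B)"
        unfolding disjoint_family_on_def using disj by blast
      moreover have "cell Y b y \<in> sets \<mu>" for y by (intro sets_M0[OF \<mu>] cb) (simp add: cell_def)
      ultimately show ?thesis
        using sum_emeasure[of "cell Y b" "Y \<inter> B" \<mu>] Y \<open>s -` B - {0} = _\<close> by (auto simp: image_subset_iff)
    qed
    have gs: "g -` {y} \<in> sets \<nu>" if "y \<noteq> 0" for y
      using that g measurable_sets[OF g(1), of "{y}"] by (intro sets_M0[OF \<nu>]) auto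
    have gsB: "(\<lambda>y. g -` {y}) ` (range g \<inter> B) \<subseteq> sets \<nu>"
    proof (rule image_subsetI)
      fix y assume "y \<in> range g \<inter> B"
      then have "y \<noteq> 0" using B(2) by auto
      then show "g -` {y} \<in> sets \<nu>" by (rule gs)
    qed
    have "g -` B = (\<Union>y\<in>range g \<inter> B. g -` {y})" by auto
    moreover have "emeasure \<nu> \<dots> = (\<Sum>y\<in>range g \<inter> B. m y)"
      unfolding m_def using g(2)
      by (intro sum_emeasure[symmetric] gsB) (auto simp: disjoint_family_on_def)
    \<comment> \<open>Values of \<open>g\<close> in \<open>B\<close> that are missing from
      \<open>Y\<close> carry no mass, since \<open>0\<close> is not in \<open>B\<close>.\<close>
    moreover have "\<dots> = (\<Sum>y\<in>Y \<inter> B. m y)"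
      using g(2) B(2) by (intro sum.mono_neutral_right) (auto simp: Y_def zero_less_iff_neq_zero)
    ultimately have 2: "emeasure \<nu> (g -` B) = (\<Sum>y\<in>Y \<inter> B. m y)" by simp
    have "emeasure \<mu> (cell Y b y) = m y" if "B \<inter> {y. (0, y) \<in> T} = {}" "y \<in> Y \<inter> B" for y
    proof (rule b(3))
      have "(0, y) \<notin> T" using that by auto
      then have "b y \<noteq> 0" using that b(1) b0Y b00 by (auto simp: T_def)
      then show "0 < b y" using b(1)[of y] that by auto
    qed (use that in auto)
    then show ?thesis unfolding 1 2 using b(2) by (auto intro!: sum_mono sum.cong)
  qed
  ultimately show ?thesis by blast
qed

section \<open>Convergence of selections from the graphs\<close>

lemma compact_avoids_liminf:
  fixes T :: "nat \<Rightarrow> 'b::topological_space set"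
  assumes K: "\<And>z. (\<And>U. open U \<Longrightarrow> z \<in> U \<Longrightarrow> \<exists>\<^sub>F n in sequentially. T n \<inter> U \<noteq> {}) \<Longrightarrow> z \<in> L"
    and Q: "compact Q" "Q \<inter> L = {}"
  shows "\<forall>\<^sub>F n in sequentially. T n \<inter> Q = {}"
proof -
  have "\<exists>U. open U \<and> z \<in> U \<and> (\<forall>\<^sub>F n in sequentially. T n \<inter> U = {})" if "z \<in> Q" for z
  proof -
    have "z \<notin> L" using that Q(2) by blast
    then obtain U where "open U" "z \<in> U" "\<not> (\<exists>\<^sub>F n in sequentially. T n \<inter> U \<noteq> {})" using K by blast
    then show ?thesis by (auto simp: frequently_def)
  qed
  then obtain U where U: "\<And>z. z \<in> Q \<Longrightarrow> open (U z)" "\<And>z. z \<in> Q \<Longrightarrow> z \<in> U z"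
    "\<And>z. z \<in> Q \<Longrightarrow> \<forall>\<^sub>F n in sequentially. T n \<inter> U z = {}" by metis
  have "Q \<subseteq> (\<Union>z\<in>Q. U z)" using U(2) by blast
  then obtain D where D: "D \<subseteq> Q" "finite D" "Q \<subseteq> (\<Union>z\<in>D. U z)"
    using compactE_image[OF Q(1), of Q U] U(1) by metis
  have "\<forall>\<^sub>F n in sequentially. \<forall>z\<in>D. T n \<inter> U z = {}"
    using D U(3) by (intro eventually_ball_finite) auto
  then show ?thesis by eventually_elim (use D(3) in blast)
qed

lemma frequently_subsequence:
  assumes "\<And>k. \<exists>\<^sub>F n in sequentially. P k n"
  obtains \<tau> :: "nat \<Rightarrow> nat" where "strict_mono \<tau>" "\<And>k. P k (\<tau> k)"
proof -
  have ex: "\<exists>n>N. P k n" for k N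
    using assms[of k] unfolding frequently_def eventually_sequentially
    by (metis Suc_le_eq)
  have "\<exists>\<tau>. \<forall>k. P k (\<tau> k) \<and> \<tau> k < \<tau> (Suc k)"
    by (rule dependent_nat_choice) (use ex in blast)+
  then show ?thesis using that by (auto simp: strict_mono_Suc_iff)
qed

lemma cyclically_monotone_pair:
  assumes "cyclically_monotone T" "(x, v) \<in> T" "(y, w) \<in> T"
  shows "0 \<le> (x - y) \<bullet> (v - w)"
proof -
  have "(\<Sum>i<(2::nat). (if i = 0 then x else y) \<bullet> (if Suc i mod 2 = 0 then v else w))
      \<le> (\<Sum>i<(2::nat). (if i = 0 then x else y) \<bullet> (if i = 0 then v else w))"
    using assms(1)[unfolded cyclically_monotone_def, rule_format, of 2 "\<lambda>i. if i = 0 then x else y"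
      "\<lambda>i. if i = 0 then v else w"] assms(2,3) by simp
  then show ?thesis by (simp add: numeral_2_eq_2 inner_diff_left inner_diff_right)
qed

text \<open>A blow-up of the selection at \<open>x\<close> would make \<open>x\<close> a support point of the closed convex
  hull of the domain of the limit, that is, a point where the subdifferential of the indicator
  function is multivalued.\<close>

lemma selection_bounded:
  fixes T :: "nat \<Rightarrow> ('a::euclidean_space \<times> 'a) set"
  assumes cm: "\<And>n. cyclically_monotone (T n)" and v: "\<And>n. (x, v n) \<in> T n"
    and x: "x \<in> fst ` liminf_set T"
    and ind: "x \<notin> multi_subdiff (indicator_fun (closure (convex hull (fst ` liminf_set T))))"
  shows "\<exists>R. \<forall>\<^sub>F n in sequentially. norm (v n) \<le> R"
proof (rule ccontr)
  assume "\<not> ?thesis"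
  then have "\<exists>\<^sub>F n in sequentially. real k < norm (v n)" for k
    by (auto simp: frequently_def not_less)
  then obtain \<tau> where \<tau>: "strict_mono \<tau>" "\<And>k. real k < norm (v (\<tau> k))"
    using frequently_subsequence[of "\<lambda>k n. real k < norm (v n)"] by metis
  have pos: "0 < norm (v (\<tau> k))" for k using \<tau>(2)[of k] by (meson le_less_trans of_nat_0_le_iff)
  define u where "u k = v (\<tau> k) /\<^sub>R norm (v (\<tau> k))" for k
  have nu: "norm (u k) = 1" for k using pos[of k] by (simp add: u_def)
  then have "\<forall>k. u k \<in> sphere 0 1" by simp
  \<comment> \<open>The directions of the unbounded values accumulate at a unit vector
    \<open>w\<close>, which turns out to be an outer normal at \<open>x\<close>.\<close>
  then obtain w \<rho> where w: "w \<in> sphere 0 1" and \<rho>: "strict_mono \<rho>" and lim: "(\<lambda>k. u (\<rho> k)) \<longlonglongrightarrow> w"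
    using compact_sphere[of "0::'a" 1] unfolding compact_def o_def by metis
  define \<sigma> where "\<sigma> k = \<tau> (\<rho> k)" for k
  have \<sigma>: "strict_mono \<sigma>" unfolding \<sigma>_def using \<tau>(1) \<rho> by (simp add: strict_mono_def)
  have inf: "(\<lambda>k. inverse (norm (v (\<sigma> k)))) \<longlonglongrightarrow> 0"
  proof (rule Lim_null_comparison)
    have "norm (inverse (norm (v (\<sigma> k)))) \<le> inverse (real k)" if "0 < k" for k
    proof -
      have "real k \<le> real (\<rho> k)" using seq_suble[OF \<rho>, of k] by simp
      then have "real k \<le> norm (v (\<sigma> k))" using \<tau>(2)[of "\<rho> k"] by (simp add: \<sigma>_def)
      then show ?thesis using that by (simp add: le_imp_inverse_le)
    qed
    then show "\<forall>\<^sub>F k in sequentially. norm (inverse (norm (v (\<sigma> k)))) \<le> inverse (real k)"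
      using eventually_gt_at_top[of 0] by (rule eventually_mono[rotated]) auto
  qed (rule lim_inverse_n)
  have halfspace: "(z - x) \<bullet> w \<le> 0" if zT: "z \<in> fst ` liminf_set T" for z
  proof -
    obtain y where y: "(z, y) \<in> liminf_set T" using zT by auto
    obtain p where p: "\<And>n. p n \<in> T n" "p \<longlonglongrightarrow> (z, y)"
      using liminf_set_sequence[OF y] v by blast
    have lz: "(\<lambda>k. fst (p (\<sigma> k))) \<longlonglongrightarrow> z" and ly: "(\<lambda>k. snd (p (\<sigma> k))) \<longlonglongrightarrow> y"
      using tendsto_fst[OF LIMSEQ_subseq_LIMSEQ[OF p(2) \<sigma>]] tendsto_snd[OF LIMSEQ_subseq_LIMSEQ[OF p(2) \<sigma>]]
      by (auto simp: o_def)
    \<comment> \<open>Monotonicity between \<open>(x, v n)\<close> and points of \<open>T n\<close>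
      near \<open>(z, y)\<close>, divided by the norm of \<open>v n\<close>; the bounded second
      coordinate then disappears in the limit.\<close>
    have "0 \<le> (x - fst (p (\<sigma> k))) \<bullet> (u (\<rho> k) - inverse (norm (v (\<sigma> k))) *\<^sub>R snd (p (\<sigma> k)))" for k
    proof -
      have "0 \<le> (x - fst (p (\<sigma> k))) \<bullet> (v (\<sigma> k) - snd (p (\<sigma> k)))"
        using p(1) by (intro cyclically_monotone_pair[OF cm v]) auto
      then have "0 \<le> inverse (norm (v (\<sigma> k))) * ((x - fst (p (\<sigma> k))) \<bullet> (v (\<sigma> k) - snd (p (\<sigma> k))))"
        by (intro mult_nonneg_nonneg) auto
      also have "\<dots> = (x - fst (p (\<sigma> k))) \<bullet> (inverse (norm (v (\<sigma> k))) *\<^sub>R (v (\<sigma> k) - snd (p (\<sigma> k))))"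
        by (simp only: inner_scaleR_right)
      also have "inverse (norm (v (\<sigma> k))) *\<^sub>R (v (\<sigma> k) - snd (p (\<sigma> k)))
          = u (\<rho> k) - inverse (norm (v (\<sigma> k))) *\<^sub>R snd (p (\<sigma> k))"
        by (simp add: u_def \<sigma>_def scaleR_diff_right)
      finally show ?thesis .
    qed
    moreover have "(\<lambda>k. (x - fst (p (\<sigma> k))) \<bullet> (u (\<rho> k) - inverse (norm (v (\<sigma> k))) *\<^sub>R snd (p (\<sigma> k))))
        \<longlonglongrightarrow> (x - z) \<bullet> (w - 0 *\<^sub>R y)"
      by (intro tendsto_intros lz ly lim inf)
    ultimately have "0 \<le> (x - z) \<bullet> (w - 0 *\<^sub>R y)" by (intro LIMSEQ_le_const) auto
    then show ?thesis by (simp add: inner_diff_left)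
  qed
  have "closure (convex hull (fst ` liminf_set T)) \<subseteq> {z. w \<bullet> z \<le> w \<bullet> x}"
    using halfspace
    by (intro closure_minimal hull_minimal closed_halfspace_le convex_halfspace_le subsetI)
      (simp add: inner_diff_left inner_commute[of w])
  then have "(z - x) \<bullet> w \<le> 0" if "z \<in> closure (convex hull (fst ` liminf_set T))" for z
    using that by (auto simp: inner_diff_right inner_commute[of _ w])
  moreover have "x \<in> closure (convex hull (fst ` liminf_set T))"
    using x by (meson closure_subset hull_subset subsetD)
  moreover have "w \<noteq> 0" using w by auto
  ultimately show False using ind multi_subdiff_indicator_fun by blast
qed

text \<open>The values are bounded, so they can accumulate only at values of the limit graph over
  \<open>x\<close>, and \<open>grad \<psi> x\<close> is the sole one.\<close>

lemma selection_convergence: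
  fixes T :: "nat \<Rightarrow> ('a::euclidean_space \<times> 'a) set"
  assumes cc: "closed_convex_fun \<psi>" and sub: "liminf_set T \<subseteq> subdiff \<psi>"
    and K: "\<And>z. (\<And>U. open U \<Longrightarrow> z \<in> U \<Longrightarrow> \<exists>\<^sub>F n in sequentially. T n \<inter> U \<noteq> {}) \<Longrightarrow> z \<in> liminf_set T"
    and cm: "\<And>n. cyclically_monotone (T n)" and v: "\<And>n. (x, v n) \<in> T n"
    and x: "x \<in> fst ` liminf_set T" "x \<notin> multi_subdiff \<psi>"
    and ind: "x \<notin> multi_subdiff (indicator_fun (closure (convex hull (fst ` liminf_set T))))"
  shows "x \<in> dom_grad \<psi> \<and> (x, grad \<psi> x) \<in> liminf_set T \<and> v \<longlonglongrightarrow> grad \<psi> x"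
proof -
  obtain w where w: "(x, w) \<in> liminf_set T" using x(1) by auto
  have "(x, w) \<in> subdiff \<psi>" using w sub by blast
  then have d: "x \<in> dom_grad \<psi>" using x(2) dom_grad_eq[OF cc] by (auto intro: rev_image_eqI)
  have only: "y = grad \<psi> x" if "(x, y) \<in> liminf_set T" for y
    using that sub subdiff_grad[OF cc d] by blast
  obtain R where R: "\<forall>\<^sub>F n in sequentially. norm (v n) \<le> R"
    using selection_bounded[OF cm v x(1) ind] by blast
  have "v \<longlonglongrightarrow> grad \<psi> x"
  proof (rule tendstoI)
    fix e :: real assume e: "0 < e"
    define Q where "Q = {x} \<times> (cball 0 R \<inter> {y. e \<le> dist y (grad \<psi> x)})"
    have "closed {y. e \<le> dist y (grad \<psi> x)}" by (intro closed_Collect_le continuous_intros)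
    then have "compact Q" unfolding Q_def by (intro compact_Times compact_Int_closed) auto
    moreover have "Q \<inter> liminf_set T = {}" using only e by (auto simp: Q_def)
    ultimately have "\<forall>\<^sub>F n in sequentially. T n \<inter> Q = {}"
      using compact_avoids_liminf[OF K] by blast
    with R show "\<forall>\<^sub>F n in sequentially. dist (v n) (grad \<psi> x) < e"
    proof eventually_elim
      case (elim n)
      then have "(x, v n) \<notin> Q" using v by blast
      then show ?case using elim(1) by (auto simp: Q_def)
    qed
  qed
  then show ?thesis using d w only by metis
qed

text \<open>Inner regularity of finite Borel measures, applied on the pieces
  \<open>B \<inter> away k\<close>.\<close>

lemma emeasure_le_of_compact_subsets:
  fixes \<rho>1 \<rho>2 :: "'a::euclidean_space measure"
  assumes \<rho>1: "\<rho>1 \<in> M0" and B: "B \<in> sets borel" "0 \<notin> B" "B \<in> sets \<rho>2"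
    and le: "\<And>K. compact K \<Longrightarrow> K \<subseteq> B \<Longrightarrow> emeasure \<rho>1 K \<le> emeasure \<rho>2 K"
  shows "emeasure \<rho>1 B \<le> emeasure \<rho>2 B"
proof -
  have Es: "away k \<in> sets \<rho>1" for k by (intro sets_M0[OF \<rho>1]) simp_all
  have piece: "emeasure \<rho>1 (B \<inter> away k) \<le> emeasure \<rho>2 B" for k
  proof -
    define M where "M = distr (restrict_space \<rho>1 (away k)) borel (\<lambda>y. y)"
    have meas: "(\<lambda>y. y) \<in> measurable (restrict_space \<rho>1 (away k)) borel"
      by (rule measurable_restrict_space1[OF ident_measurable_M0[OF \<rho>1]])
    have Mv: "emeasure M A = emeasure \<rho>1 (A \<inter> away k)" if A: "A \<in> sets borel" for A
    proof -
      have "y \<noteq> 0" if "y \<in> away k" for y :: 'a using that by (auto simp: away_def)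
      then have "(\<lambda>y. y) -` A \<inter> space (restrict_space \<rho>1 (away k)) = A \<inter> away k"
        using space_M0[OF \<rho>1] by (auto simp: space_restrict_space)
      then have "emeasure M A = emeasure (restrict_space \<rho>1 (away k)) (A \<inter> away k)"
        unfolding M_def using emeasure_distr[OF meas A] by simp
      also have "\<dots> = emeasure \<rho>1 (A \<inter> away k)"
        using Es by (intro emeasure_restrict_space) (auto simp: sets.Int_space_eq2)
      finally show ?thesis .
    qed
    have sM: "sets M = sets borel" by (simp add: M_def)
    have "emeasure M (space M) = emeasure \<rho>1 (away k)" using Mv[of UNIV] by (simp add: M_def)
    also have "\<dots> < \<infinity>" using emeasure_away_finite[OF \<rho>1, of UNIV] by simp
    finally have fin: "emeasure M (space M) \<noteq> \<infinity>" by (simp add: less_top)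
    have "emeasure \<rho>1 (B \<inter> away k) = emeasure M B" using Mv B by simp
    also have "\<dots> = (SUP C\<in>{C. C \<subseteq> B \<and> compact C}. emeasure M C)"
      by (rule inner_regular[OF sM fin B(1)])
    also have "\<dots> \<le> emeasure \<rho>2 B"
    proof (rule SUP_least, clarify)
      fix C assume C: "C \<subseteq> B" "compact C"
      have "emeasure M C = emeasure \<rho>1 (C \<inter> away k)" using C by (intro Mv borel_closed compact_imp_closed)
      also have "\<dots> \<le> emeasure \<rho>2 (C \<inter> away k)"
        using C closed_away by (intro le compact_Int_closed) auto
      also have "\<dots> \<le> emeasure \<rho>2 B" using C B by (intro emeasure_mono) auto
      finally show "emeasure M C \<le> emeasure \<rho>2 B" .
    qed
    finally show ?thesis .
  qed
  have "range (\<lambda>k. B \<inter> away k) \<subseteq> sets \<rho>1" using Es sets_M0[OF \<rho>1 B(1,2)] by blast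
  from SUP_emeasure_incseq[OF this incseq_away]
  have "emeasure \<rho>1 B = (SUP k. emeasure \<rho>1 (B \<inter> away k))" by (simp only: UN_away[OF B(2)])
  also have "\<dots> \<le> emeasure \<rho>2 B" by (intro SUP_least piece)
  finally show ?thesis .
qed

text \<open>The closed neighbourhoods decrease to \<open>K\<close> and avoid \<open>0\<close>, so
  they have finite mass and continuity from above applies.\<close>

lemma emeasure_compact_outer_limit:
  fixes \<rho> :: "'a::euclidean_space measure"
  assumes \<rho>: "\<rho> \<in> M0" and K: "compact K" "K \<noteq> {}" and e: "0 < e" and e0: "\<And>y. infdist y K \<le> e \<Longrightarrow> y \<noteq> 0"
    and le: "\<And>t. 0 < t \<Longrightarrow> t \<le> e \<Longrightarrow> c \<le> emeasure \<rho> {y. infdist y K \<le> t}"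
  shows "c \<le> emeasure \<rho> K"
proof -
  define t where "t j = e / real (Suc j)" for j
  have t: "0 < t j" "t j \<le> e" for j using e by (auto simp: t_def field_simps)
  define C where "C j = {y. infdist y K \<le> t j}" for j
  have Ccl: "compact (C j)" for j unfolding C_def using K t(1)[of j] by (intro compact_infdist_le) auto
  have C0: "0 \<notin> C j" for j using e0[of 0] t(2)[of j] by (auto simp: C_def)
  have Cs: "C j \<in> sets \<rho>" for j using Ccl C0 by (intro sets_M0[OF \<rho>] borel_closed compact_imp_closed)
  have "(INF j. emeasure \<rho> (C j)) = emeasure \<rho> (\<Inter>j. C j)"
  proof (rule INF_emeasure_decseq)
    show "decseq C"
    proof (rule decseq_SucI, rule subsetI)
      fix j y assume "y \<in> C (Suc j)"
      moreover have "t (Suc j) \<le> t j" using e by (simp add: t_def frac_le)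
      ultimately show "y \<in> C j" unfolding C_def by simp
    qed
    fix j
    have "0 \<notin> closure (C j)" using C0 Ccl by (simp add: closure_closed compact_imp_closed)
    moreover have "C j \<in> sets borel" using Ccl by (intro borel_closed compact_imp_closed)
    ultimately have "emeasure \<rho> (C j) < \<infinity>" using \<rho> by (auto simp: M0_def)
    then show "emeasure \<rho> (C j) \<noteq> \<infinity>" by (simp add: less_top)
  qed (use Cs in auto)
  moreover have "(\<Inter>j. C j) = K"
  proof (intro equalityI subsetI)
    fix y assume y: "y \<in> (\<Inter>j. C j)"
    have "t \<longlonglongrightarrow> 0" unfolding t_def
      using LIMSEQ_Suc[OF lim_const_over_n[of e]] by simp
    then have "infdist y K \<le> 0" by (rule LIMSEQ_le_const) (use y in \<open>auto simp: C_def\<close>)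
    then have "infdist y K = 0" using infdist_nonneg[of y K] by simp
    then show "y \<in> K" using K by (metis compact_imp_closed in_closed_iff_infdist_zero)
  next
    fix y assume "y \<in> K" then show "y \<in> (\<Inter>j. C j)" using t(1) by (simp add: C_def less_imp_le)
  qed
  moreover have "c \<le> (INF j. emeasure \<rho> (C j))"
    unfolding C_def using t le by (intro INF_greatest) auto
  ultimately show ?thesis by simp
qed


section \<open>Existence of a potential\<close>

lemma grad_measurable_M0:
  assumes \<mu>: "\<mu> \<in> M0" and cc: "closed_convex_fun \<psi>"
  shows "grad \<psi> \<in> measurable (restrict_space \<mu> (dom_grad \<psi>)) borel"
proof (rule measurableI)
  fix B :: "'a set" assume B: "B \<in> sets borel"
  have "grad \<psi> -` B \<inter> space (restrict_space \<mu> (dom_grad \<psi>)) = dom_grad \<psi> \<inter> (grad_vimage \<psi> B - {0})"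
    using space_M0[OF \<mu>] by (auto simp: space_restrict_space grad_vimage_def)
  moreover have "grad_vimage \<psi> B - {0} \<in> sets \<mu>"
    using grad_vimage_borel[OF cc B] by (intro sets_M0[OF \<mu>]) auto
  ultimately show "grad \<psi> -` B \<inter> space (restrict_space \<mu> (dom_grad \<psi>)) \<in> sets (restrict_space \<mu> (dom_grad \<psi>))"
    unfolding sets_restrict_space by blast
qed auto

lemma emeasure_distr_dom_grad:
  assumes \<mu>: "\<mu> \<in> M0" and cc: "closed_convex_fun \<psi>"
    and f: "f \<in> measurable (restrict_space \<mu> (dom_grad \<psi>)) N" and E: "E \<in> sets N"
  shows "emeasure (distr (restrict_space \<mu> (dom_grad \<psi>)) N f) E = emeasure \<mu> {x \<in> dom_grad \<psi> - {0}. f x \<in> E}"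
proof -
  have "f -` E \<inter> space (restrict_space \<mu> (dom_grad \<psi>)) = {x \<in> dom_grad \<psi> - {0}. f x \<in> E}"
    using space_M0[OF \<mu>] by (auto simp: space_restrict_space)
  moreover have "dom_grad \<psi> \<inter> space \<mu> \<in> sets \<mu>"
    using dom_grad_borel[OF cc] space_M0[OF \<mu>] by (intro sets_M0[OF \<mu>]) auto
  ultimately show ?thesis
    using emeasure_distr[OF f E] by (simp add: emeasure_restrict_space)
qed

lemma emeasure_grad_push:
  assumes \<mu>: "\<mu> \<in> M0" and cc: "closed_convex_fun \<psi>" and B: "B \<in> sets borel"
  shows "emeasure (grad_push \<psi> \<mu>) B = emeasure \<mu> (grad_vimage \<psi> B - {0})"
proof -
  have "{x \<in> dom_grad \<psi> - {0}. grad \<psi> x \<in> B} = grad_vimage \<psi> B - {0}" by (auto simp: grad_vimage_def)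
  then show ?thesis
    unfolding grad_push_def using emeasure_distr_dom_grad[OF \<mu> cc grad_measurable_M0[OF \<mu> cc] B] by simp
qed

lemma emeasure_punctured_grad_push:
  assumes "\<mu> \<in> M0" "closed_convex_fun \<psi>" "B \<in> sets borel" "0 \<notin> B"
  shows "emeasure (restrict_space (grad_push \<psi> \<mu>) (- {0})) B = emeasure \<mu> (grad_vimage \<psi> B - {0})"
proof -
  have "emeasure (restrict_space (grad_push \<psi> \<mu>) (- {0})) B = emeasure (grad_push \<psi> \<mu>) B"
    using assms(3,4) by (intro emeasure_restrict_space) (auto simp: grad_push_def)
  then show ?thesis using emeasure_grad_push[OF assms(1-3)] by simp
qed

locale small_sets_null =
  fixes \<mu> :: "'a::euclidean_space measure"
  assumes \<mu>: "\<mu> \<in> M0"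
    and small_null: "\<And>A. A \<in> sets borel \<Longrightarrow> A \<subseteq> - {0} \<Longrightarrow>
      hausdorff_dim A \<le> ereal (real DIM('a) - 1) \<Longrightarrow> emeasure \<mu> A = 0"
begin

text \<open>The dimension hypothesis enters through this statement alone.\<close>

lemma multi_subdiff_null:
  assumes cc: "closed_convex_fun \<psi>" shows "multi_subdiff \<psi> - {0} \<in> null_sets \<mu>"
proof -
  have bor: "multi_subdiff \<psi> - {0} \<in> sets borel"
    using fsigma_in_borel[OF fsigma_multi_subdiff[OF cc]] by auto
  have "hausdorff_dim (multi_subdiff \<psi> - {0}) \<le> hausdorff_dim (multi_subdiff \<psi>)"
    by (rule hausdorff_dim_mono) auto
  then have "emeasure \<mu> (multi_subdiff \<psi> - {0}) = 0"
    using hausdorff_dim_multi_subdiff[OF cc] by (intro small_null[OF bor]) auto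
  then show ?thesis using bor by (intro null_setsI sets_M0[OF \<mu>]) auto
qed

lemma AE_not_multi_subdiff:
  assumes "closed_convex_fun \<psi>" shows "AE x in \<mu>. x \<notin> multi_subdiff \<psi>"
  by (rule AE_I'[OF multi_subdiff_null[OF assms]]) (use space_M0[OF \<mu>] in auto)

lemma hyperplane_null:
  assumes "w \<noteq> 0" shows "emeasure \<mu> ({x. x \<bullet> w = c} - {0}) = 0"
proof -
  have cl: "closed {x. x \<bullet> w = c}" by (intro closed_Collect_eq continuous_intros)
  have "{x. x \<bullet> w = c} = {x. w \<bullet> x = c}" by (simp add: inner_commute)
  then have "convex {x. x \<bullet> w = c}" by (simp add: convex_hyperplane)
  then have cc: "closed_convex_fun (indicator_fun {x. x \<bullet> w = c})" by (intro closed_convex_indicator_fun cl)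
  have "{x. x \<bullet> w = c} \<subseteq> multi_subdiff (indicator_fun {x. x \<bullet> w = c})"
    using assms by (auto intro!: multi_subdiff_indicator_fun[of _ _ w] simp: inner_diff_left)
  then have "{x. x \<bullet> w = c} - {0} \<in> null_sets \<mu>"
    using cl by (intro null_sets_subset[OF multi_subdiff_null[OF cc]] sets_M0[OF \<mu>]) auto
  then show ?thesis by auto
qed

text \<open>The bound \<open>2 * norm y\<close> fixes \<open>0\<close> and forces
  \<open>norm y \<ge> r / 2\<close> whenever \<open>norm (g n y) \<ge> r\<close>, so preimages of
  sets away from \<open>0\<close> have finite mass uniformly in \<open>n\<close>.\<close>

lemma exists_discrete_plans:
  assumes \<nu>: "\<nu> \<in> M0"
  obtains T :: "nat \<Rightarrow> ('a \<times> 'a) set" and s g :: "nat \<Rightarrow> 'a \<Rightarrow> 'a" where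
    "\<And>n. cyclically_monotone (T n)" "\<And>n. (0, 0) \<in> T n"
    "\<And>z. (\<And>U. open U \<Longrightarrow> z \<in> U \<Longrightarrow> \<exists>\<^sub>F n in sequentially. T n \<inter> U \<noteq> {}) \<Longrightarrow> z \<in> liminf_set T"
    "\<And>n. s n \<in> borel_measurable borel" "\<And>n. AE x in \<mu>. (x, s n x) \<in> T n"
    "\<And>n. g n \<in> borel_measurable borel" "\<And>n y. norm (g n y) \<le> 2 * norm y" "\<And>y. (\<lambda>n. g n y) \<longlonglongrightarrow> y"
    "\<And>n B. B \<in> sets borel \<Longrightarrow> 0 \<notin> B \<Longrightarrow> emeasure \<mu> (s n -` B - {0}) \<le> emeasure \<nu> (g n -` B)"
    "\<And>n B. B \<in> sets borel \<Longrightarrow> 0 \<notin> B \<Longrightarrow> B \<inter> {y. (0, y) \<in> T n} = {} \<Longrightarrow>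
      emeasure \<mu> (s n -` B - {0}) = emeasure \<nu> (g n -` B)"
proof -
  obtain F :: "nat \<Rightarrow> 'a \<Rightarrow> 'a" where F: "\<And>i. simple_function borel (F i)"
    "\<And>y. (\<lambda>i. F i y) \<longlonglongrightarrow> y" "\<And>i y. dist (F i y) 0 \<le> 2 * dist y 0"
    using borel_measurable_implies_sequence_metric[of "\<lambda>y::'a. y" borel 0] by auto
  have Fm: "F i \<in> borel_measurable borel" for i by (rule borel_measurable_simple_function[OF F(1)])
  have Ff: "finite (range (F i))" for i using simple_functionD(1)[OF F(1)[of i]] by simp
  have F0: "F i 0 = 0" for i using F(3)[of i 0] by simp
  let ?P = "\<lambda>n T s. cyclically_monotone T \<and> (0, 0) \<in> T \<and> s \<in> borel_measurable borel \<and>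
    (AE x in \<mu>. (x, s x) \<in> T) \<and>
    (\<forall>B\<in>sets borel. 0 \<notin> B \<longrightarrow> emeasure \<mu> (s -` B - {0}) \<le> emeasure \<nu> (F n -` B) \<and>
      (B \<inter> {y. (0, y) \<in> T} = {} \<longrightarrow> emeasure \<mu> (s -` B - {0}) = emeasure \<nu> (F n -` B)))"
  have "\<forall>n. \<exists>p. ?P n (fst p) (snd p)"
  proof
    fix n
    have "\<exists>T s. ?P n T s" by (rule semidiscrete_plan[OF \<mu> \<nu> hyperplane_null Fm Ff F0])
    then show "\<exists>p. ?P n (fst p) (snd p)" by (simp only: split_paired_Ex fst_conv snd_conv)
  qed
  from choice[OF this] obtain p where p: "\<forall>n. ?P n (fst (p n)) (snd (p n))" ..
  define T where "T n = fst (p n)" for n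
  define s where "s n = snd (p n)" for n
  have Ts: "?P n (T n) (s n)" for n unfolding T_def s_def using p by (rule spec)
  obtain \<sigma> :: "nat \<Rightarrow> nat" where \<sigma>: "strict_mono \<sigma>"
    "\<forall>z. (\<forall>U. open U \<longrightarrow> z \<in> U \<longrightarrow> (\<exists>\<^sub>F n in sequentially. T (\<sigma> n) \<inter> U \<noteq> {})) \<longrightarrow>
      z \<in> liminf_set (\<lambda>n. T (\<sigma> n))"
    using kuratowski_subsequence[of T] by blast
  show ?thesis
  proof (rule that[of "\<lambda>n. T (\<sigma> n)" "\<lambda>n. s (\<sigma> n)" "\<lambda>n. F (\<sigma> n)"])
    fix z assume "\<And>U. open U \<Longrightarrow> z \<in> U \<Longrightarrow> \<exists>\<^sub>F n in sequentially. T (\<sigma> n) \<inter> U \<noteq> {}"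
    then show "z \<in> liminf_set (\<lambda>n. T (\<sigma> n))" using \<sigma>(2) by blast
  next
    show "(\<lambda>n. F (\<sigma> n) y) \<longlonglongrightarrow> y" for y
      using LIMSEQ_subseq_LIMSEQ[OF F(2) \<sigma>(1)] by (simp add: o_def)
    show "norm (F (\<sigma> n) y) \<le> 2 * norm y" for n y using F(3)[of "\<sigma> n" y] by simp
  qed (use Ts Fm in blast)+
qed

text \<open>Passing to the limit: the discrete plans converge almost everywhere to the gradient of a
  Rockafellar potential of the limit of their graphs, and no mass escapes because their second
  marginals are dominated by images of \<open>\<nu>\<close>.\<close>

lemma exists_potential:
  assumes \<nu>: "\<nu> \<in> M0"
  obtains \<psi> T where "closed_convex_fun \<psi>" "closed T" "cyclically_monotone T" "(0, 0) \<in> T" "T \<subseteq> subdiff \<psi>"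
    "AE x in \<mu>. x \<in> dom_grad \<psi> \<and> (x, grad \<psi> x) \<in> T"
    "\<And>B. B \<in> sets borel \<Longrightarrow> 0 \<notin> B \<Longrightarrow> emeasure \<mu> (grad_vimage \<psi> B - {0}) \<le> emeasure \<nu> B"
    "\<And>B. B \<in> sets borel \<Longrightarrow> 0 \<notin> B \<Longrightarrow> B \<inter> {y. (0, y) \<in> T} = {} \<Longrightarrow>
      emeasure \<mu> (grad_vimage \<psi> B - {0}) = emeasure \<nu> B"
proof -
  obtain T :: "nat \<Rightarrow> ('a \<times> 'a) set" and s g :: "nat \<Rightarrow> 'a \<Rightarrow> 'a" where
    cm: "\<And>n. cyclically_monotone (T n)" and T0: "\<And>n. (0, 0) \<in> T n" and
    K: "\<And>z. (\<And>U. open U \<Longrightarrow> z \<in> U \<Longrightarrow> \<exists>\<^sub>F n in sequentially. T n \<inter> U \<noteq> {}) \<Longrightarrow> z \<in> liminf_set T" and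
    sm: "\<And>n. s n \<in> borel_measurable borel" and sT: "\<And>n. AE x in \<mu>. (x, s n x) \<in> T n" and
    gm: "\<And>n. g n \<in> borel_measurable borel" and gb: "\<And>n y. norm (g n y) \<le> 2 * norm y" and
    glim: "\<And>y. (\<lambda>n. g n y) \<longlonglongrightarrow> y" and
    le: "\<And>n B. B \<in> sets borel \<Longrightarrow> 0 \<notin> B \<Longrightarrow> emeasure \<mu> (s n -` B - {0}) \<le> emeasure \<nu> (g n -` B)" and
    eq: "\<And>n B. B \<in> sets borel \<Longrightarrow> 0 \<notin> B \<Longrightarrow> B \<inter> {y. (0, y) \<in> T n} = {} \<Longrightarrow>
      emeasure \<mu> (s n -` B - {0}) = emeasure \<nu> (g n -` B)"
    using exists_discrete_plans[OF \<nu>] by blast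
  define L where "L = liminf_set T"
  have L0: "(0, 0) \<in> L" unfolding L_def liminf_set_def using T0 by (auto intro!: always_eventually)
  have Lcm: "cyclically_monotone L"
    unfolding L_def using T0 by (intro cyclically_monotone_liminf cm) blast
  have Lcl: "closed L" unfolding L_def by (rule closed_liminf_set)
  obtain \<psi> where cc: "closed_convex_fun \<psi>" and L\<psi>: "L \<subseteq> subdiff \<psi>"
    using cyclically_monotone_imp_subdiff[OF Lcm L0] by blast
  have svs: "s n -` B - {0} \<in> sets \<mu>" if "B \<in> sets borel" for n B
    using measurable_sets[OF sm that, of n] by (intro sets_M0[OF \<mu>]) auto
  have g0: "g n 0 = 0" for n using gb[of n 0] by simp
  have gvs: "g n -` B \<in> sets \<nu>" if "B \<in> sets borel" "0 \<notin> B" for n B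
    using measurable_sets[OF gm that(1), of n] that(2) g0 by (intro sets_M0[OF \<nu>]) auto
  \<comment> \<open>Points sent into \<open>U\<close> by all late selections are compared with
    points \<open>y\<close> for which \<open>g n y\<close> lies in \<open>U\<close> infinitely
    often; as \<open>g n y\<close> tends to \<open>y\<close>, the latter belong to the closure of
    \<open>U\<close>.\<close>
  have liminf_le: "emeasure \<mu> (\<Union>k. \<Inter>n\<in>{k..}. s n -` U - {0}) \<le> emeasure \<nu> (closure U)"
    if U: "open U" "0 < r" "\<And>y. y \<in> U \<Longrightarrow> r \<le> norm y" for U r
  proof -
    have Ub: "U \<in> sets borel" "0 \<notin> U" using U(1,2) U(3)[of 0] by auto
    have far: "r / 2 \<le> norm y" if "g n y \<in> U" for n y using U(3)[OF that] gb[of n y] by linarith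
    have "emeasure \<nu> (\<Union>n. g n -` U) < \<infinity>"
    proof (rule emeasure_M0_finite[OF \<nu>, of _ "r / 2"])
      show "(\<Union>n. g n -` U) \<in> sets borel"
        using measurable_sets[OF gm Ub(1)] by (intro sets.countable_UN) auto
    qed (use U far in auto)
    then have "emeasure \<mu> (\<Union>k. \<Inter>n\<in>{k..}. s n -` U - {0}) \<le> emeasure \<nu> (\<Inter>k. \<Union>n\<in>{k..}. g n -` U)"
      using svs[OF Ub(1)] gvs[OF Ub] le[OF Ub] by (intro emeasure_liminf_le_limsup[where ?n0.0 = 0])
    also have "\<dots> \<le> emeasure \<nu> (closure U)"
    proof (rule emeasure_mono)
      show "(\<Inter>k. \<Union>n\<in>{k..}. g n -` U) \<subseteq> closure U"
      proof
        fix y assume y: "y \<in> (\<Inter>k. \<Union>n\<in>{k..}. g n -` U)"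
        show "y \<in> closure U" unfolding closure_approachable
        proof (intro allI impI)
          fix e :: real assume "0 < e"
          then obtain k where k: "\<And>n. n \<ge> k \<Longrightarrow> dist (g n y) y < e"
            using metric_LIMSEQ_D[OF glim] by blast
          obtain n where "n \<ge> k" "g n y \<in> U" using y by auto
          then show "\<exists>u\<in>U. dist u y < e" using k by blast
        qed
      qed
      have "closure U \<subseteq> {y. r \<le> norm y}" using U(3) by (intro closure_minimal closed_norm_ge) auto
      then have "0 \<notin> closure U" using U(2) by auto
      then show "closure U \<in> sets \<nu>" by (intro sets_M0[OF \<nu>]) auto
    qed
    finally show ?thesis .
  qed
  have AET: "AE x in \<mu>. \<forall>n. (x, s n x) \<in> T n" using sT by (simp add: AE_all_countable)
  \<comment> \<open>If the values tend to infinity at \<open>x\<close>, then \<open>x\<close>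
    belongs to every \<open>E R\<close>, whose mass is at most that of \<nu> outside a ball of
    radius \<open>Suc R\<close>. One bounded subsequence is all that this excludes from failing, and
    it suffices below.\<close>
  have tight: "AE x in \<mu>. \<exists>R. \<exists>\<^sub>F n in sequentially. norm (s n x) \<le> R"
  proof -
    define U where "U R = {y::'a. real (Suc R) < norm y}" for R
    have Uo: "open (U R)" for R unfolding U_def by (intro open_Collect_less continuous_intros)
    define E where "E R = (\<Union>k. \<Inter>n\<in>{k..}. s n -` U R - {0})" for R
    have Es: "E R \<in> sets \<mu>" for R
      unfolding E_def using svs[OF borel_open[OF Uo]]
      by (intro sets.countable_UN sets.countable_INT' image_subsetI) auto
    define C where "C R = {y::'a. real (Suc R) \<le> norm y}" for R
    have Ccl: "closed (C R)" for R unfolding C_def by (rule closed_norm_ge)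
    have Cs: "C R \<in> sets \<nu>" for R using Ccl by (intro sets_M0[OF \<nu>]) (auto simp: C_def)
    have EC: "emeasure \<mu> (E R) \<le> emeasure \<nu> (C R)" for R
    proof -
      have "emeasure \<mu> (E R) \<le> emeasure \<nu> (closure (U R))"
        unfolding E_def by (rule liminf_le[OF Uo, of "real (Suc R)"]) (auto simp: U_def)
      also have "\<dots> \<le> emeasure \<nu> (C R)"
        using Ccl by (intro emeasure_mono Cs closure_minimal) (auto simp: U_def C_def)
      finally show ?thesis .
    qed
    have "(INF R. emeasure \<nu> (C R)) = emeasure \<nu> (\<Inter>R. C R)"
    proof (rule INF_emeasure_decseq)
      show "decseq C" by (auto simp: decseq_def C_def)
      fix R
      have "emeasure \<nu> (C R) < \<infinity>"
        using Ccl by (intro emeasure_M0_finite[OF \<nu>, of _ "real (Suc R)"]) (auto simp: C_def)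
      then show "emeasure \<nu> (C R) \<noteq> \<infinity>" by (simp add: less_top)
    qed (use Cs in auto)
    also have "(\<Inter>R. C R) = {}"
    proof safe
      fix y assume y: "y \<in> (\<Inter>R. C R)"
      obtain n where "norm y \<le> real n" using real_arch_simple by blast
      moreover have "real (Suc n) \<le> norm y" using y by (auto simp: C_def)
      ultimately show "y \<in> {}" by simp
    qed
    finally have "(INF R. emeasure \<nu> (C R)) = 0" by simp
    moreover have "emeasure \<mu> (\<Inter>R. E R) \<le> (INF R. emeasure \<nu> (C R))"
      using Es by (intro INF_greatest order_trans[OF emeasure_mono EC]) auto
    ultimately have "(\<Inter>R. E R) \<in> null_sets \<mu>"
      using Es by (intro null_setsI sets.countable_INT) auto
    then show ?thesis
    proof (rule AE_I')
      show "{x \<in> space \<mu>. \<not> (\<exists>R. \<exists>\<^sub>F n in sequentially. norm (s n x) \<le> R)} \<subseteq> (\<Inter>R. E R)"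
      proof safe
        fix x R assume x: "x \<in> space \<mu>" and n: "\<nexists>R. \<exists>\<^sub>F n in sequentially. norm (s n x) \<le> R"
        have "\<forall>\<^sub>F n in sequentially. real (Suc R) < norm (s n x)"
          using n by (auto simp: frequently_def not_le)
        then show "x \<in> E R" using x space_M0[OF \<mu>] by (auto simp: E_def U_def eventually_sequentially)
      qed
    qed
  qed
  define C where "C = closure (convex hull (fst ` L))"
  have Ccc: "closed_convex_fun (indicator_fun C)"
    unfolding C_def by (intro closed_convex_indicator_fun convex_closure convex_convex_hull) auto
  have conv: "AE x in \<mu>. (\<forall>n. (x, s n x) \<in> T n) \<and> x \<in> dom_grad \<psi> \<and> (x, grad \<psi> x) \<in> L \<and> (\<lambda>n. s n x) \<longlonglongrightarrow> grad \<psi> x"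
    using AET tight AE_not_multi_subdiff[OF cc] AE_not_multi_subdiff[OF Ccc]
  proof eventually_elim
    case (elim x)
    then obtain R where R: "\<exists>\<^sub>F n in sequentially. norm (s n x) \<le> R" by blast
    \<comment> \<open>Otherwise all late graphs would avoid this compact set, although it contains
      \<open>(x, s n x)\<close> for infinitely many \<open>n\<close>.\<close>
    have "({x} \<times> cball 0 R) \<inter> L \<noteq> {}"
    proof
      assume "({x} \<times> cball 0 R) \<inter> L = {}"
      then have "\<forall>\<^sub>F n in sequentially. T n \<inter> ({x} \<times> cball 0 R) = {}"
        unfolding L_def by (intro compact_avoids_liminf[OF K] compact_Times) auto
      then have "\<forall>\<^sub>F n in sequentially. \<not> norm (s n x) \<le> R"
        by eventually_elim (use elim(1) in auto)
      then show False using R by (simp add: frequently_def)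
    qed
    then have "x \<in> fst ` L" by force
    then show ?case
      using selection_convergence[OF cc L\<psi>[unfolded L_def] K cm, of x "\<lambda>n. s n x"] elim
      unfolding L_def C_def by blast
  qed
  have gvi: "grad_vimage \<psi> B - {0} \<in> sets \<mu>" if "B \<in> sets borel" for B
    using grad_vimage_borel[OF cc that] by (intro sets_M0[OF \<mu>]) auto
  \<comment> \<open>The second marginal of the limit plan, restricted to the punctured space. Its
    comparison with \<nu> passes from open to compact to Borel sets.\<close>
  define \<rho> where "\<rho> = restrict_space (grad_push \<psi> \<mu>) (- {0})"
  note \<rho> = emeasure_punctured_grad_push[OF \<mu> cc, folded \<rho>_def]
  have \<rho>U: "emeasure \<rho> U \<le> emeasure \<nu> (closure U)"
    if U: "open U" "0 < r" "\<And>y. y \<in> U \<Longrightarrow> r \<le> norm y" for U r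
  proof -
    have Ub: "U \<in> sets borel" "0 \<notin> U" using U(1,2) U(3)[of 0] by auto
    have "emeasure \<mu> (grad_vimage \<psi> U - {0}) \<le> emeasure \<mu> (\<Union>k. \<Inter>n\<in>{k..}. s n -` U - {0})"
    proof (rule emeasure_mono_AE)
      show "AE x in \<mu>. x \<in> grad_vimage \<psi> U - {0} \<longrightarrow> x \<in> (\<Union>k. \<Inter>n\<in>{k..}. s n -` U - {0})"
        using conv
      proof eventually_elim
        case (elim x)
        show ?case
        proof
          assume x: "x \<in> grad_vimage \<psi> U - {0}"
          then have "\<forall>\<^sub>F n in sequentially. s n x \<in> U"
            using elim U(1) by (auto simp: grad_vimage_def intro: topological_tendstoD)
          then show "x \<in> (\<Union>k. \<Inter>n\<in>{k..}. s n -` U - {0})"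
            using x by (auto simp: eventually_sequentially)
        qed
      qed
      show "(\<Union>k. \<Inter>n\<in>{k..}. s n -` U - {0}) \<in> sets \<mu>"
        using svs[OF Ub(1)] by (intro sets.countable_UN sets.countable_INT' image_subsetI) auto
    qed
    also have "\<dots> \<le> emeasure \<nu> (closure U)" by (rule liminf_le[OF U])
    finally show ?thesis using \<rho>[OF Ub] by simp
  qed
  have \<rho>M: "\<rho> \<in> M0" unfolding M0_def
  proof (intro CollectI conjI ballI impI)
    show sets_\<rho>: "sets \<rho> = sets punctured_borel"
      unfolding \<rho>_def by (intro sets_restrict_space_cong) (simp add: grad_push_def)
    fix B :: "'a set" assume B: "B \<in> sets borel" "0 \<notin> closure B"
    then obtain r where r: "0 < r" "\<And>y. y \<in> B \<Longrightarrow> r \<le> norm y"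
      by (auto simp: closure_approachable not_less)
    define U where "U = {y::'a. r / 2 < norm y}"
    have Uo: "open U" unfolding U_def by (intro open_Collect_less continuous_intros)
    have cU: "closure U \<subseteq> {y. r / 2 \<le> norm y}"
      by (intro closure_minimal closed_norm_ge) (auto simp: U_def)
    have "U \<in> sets \<rho>" using Uo r(1) unfolding sets_\<rho> by (auto simp: sets_restrict_space_iff U_def)
    moreover have "B \<subseteq> U" using r by (force simp: U_def)
    ultimately have "emeasure \<rho> B \<le> emeasure \<rho> U" by (intro emeasure_mono)
    also have "\<dots> \<le> emeasure \<nu> (closure U)" using r by (intro \<rho>U[OF Uo, of "r / 2"]) (auto simp: U_def)
    also have "\<dots> < \<infinity>" using r cU by (intro emeasure_M0_finite[OF \<nu>, of _ "r / 2"]) auto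
    finally show "emeasure \<rho> B < \<infinity>" .
  qed
  have inf_cl: "closed {y. infdist y X \<le> t}" for X :: "'a set" and t
    by (intro closed_Collect_le continuous_intros continuous_on_infdist)
  have inf_op: "open {y. infdist y X < t}" for X :: "'a set" and t
    by (intro open_Collect_less continuous_intros continuous_on_infdist)
  have 1: "emeasure \<rho> B \<le> emeasure \<nu> B" if B: "B \<in> sets borel" "0 \<notin> B" for B
  proof (rule emeasure_le_of_compact_subsets[OF \<rho>M B sets_M0[OF \<nu> B]])
    fix X assume X: "compact X" "X \<subseteq> B"
    show "emeasure \<rho> X \<le> emeasure \<nu> X"
    proof (cases "X = {}")
      case False
      \<comment> \<open>Half the distance from \<open>0\<close> to \<open>X\<close>, so that the
        closed \<open>e\<close>-neighbourhood of \<open>X\<close> stays at distance at least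
        \<open>e\<close> from \<open>0\<close>.\<close>
      define e where "e = infdist 0 X / 2"
      have "infdist 0 X \<noteq> 0"
        using X B(2) False by (metis compact_imp_closed in_closed_iff_infdist_zero subsetD)
      then have e: "0 < e" using infdist_nonneg[of 0 X] by (simp add: e_def)
      have far: "e \<le> norm y" if "infdist y X \<le> e" for y
        using infdist_triangle[of 0 X y] that by (simp add: e_def)
      show ?thesis
      proof (rule emeasure_compact_outer_limit[OF \<nu> X(1) False e])
        show "y \<noteq> 0" if "infdist y X \<le> e" for y using far[OF that] e by auto
        fix t assume t: "0 < t" "t \<le> e"
        define U where "U = {y. infdist y X < t}"
        have Uo: "open U" unfolding U_def by (rule inf_op)
        have U0: "0 \<notin> U" using far[of 0] t e by (auto simp: U_def)
        have "emeasure \<rho> X \<le> emeasure \<rho> U"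
          using t Uo U0 by (intro emeasure_mono sets_M0[OF \<rho>M]) (auto simp: U_def)
        also have "\<dots> \<le> emeasure \<nu> (closure U)"
          using far t e by (intro \<rho>U[OF Uo, of e]) (auto simp: U_def)
        also have "\<dots> \<le> emeasure \<nu> {y. infdist y X \<le> t}"
        proof (rule emeasure_mono)
          show "closure U \<subseteq> {y. infdist y X \<le> t}"
            by (rule closure_minimal[OF _ inf_cl]) (auto simp: U_def)
          show "{y. infdist y X \<le> t} \<in> sets \<nu>"
            using far[of 0] t e inf_cl by (intro sets_M0[OF \<nu>] borel_closed) auto
        qed
        finally show "emeasure \<rho> X \<le> emeasure \<nu> {y. infdist y X \<le> t}" .
      qed
    qed simp
  qed
  have 2: "emeasure \<nu> B \<le> emeasure \<rho> B" if B: "B \<in> sets borel" "0 \<notin> B" and BL: "B \<inter> {y. (0, y) \<in> L} = {}" for B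
  proof (rule emeasure_le_of_compact_subsets[OF \<nu> B sets_M0[OF \<rho>M B]])
    fix X assume X: "compact X" "X \<subseteq> B"
    show "emeasure \<nu> X \<le> emeasure \<rho> X"
    proof (cases "X = {}")
      case False
      have "compact ({0::'a} \<times> X)" using X by (intro compact_Times) auto
      moreover have "({0} \<times> X) \<inter> L = {}" using BL X by auto
      ultimately obtain d where d: "0 < d" "\<And>p q. p \<in> {0} \<times> X \<Longrightarrow> q \<in> L \<Longrightarrow> d \<le> dist p q"
        using separate_compact_closed[of "{0} \<times> X" L] Lcl by metis
      \<comment> \<open>Pairs in \<open>Q\<close> are within \<open>e + e < d\<close> of
        \<open>{0} \<times> X\<close>, hence not in \<open>L\<close>.\<close>
      define e where "e = d / 3"
      have e: "0 < e" using d by (simp add: e_def)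
      define Q where "Q = cball (0::'a) e \<times> {y. infdist y X \<le> e}"
      have QL: "Q \<inter> L = {}"
      proof (rule ccontr)
        assume "Q \<inter> L \<noteq> {}"
        then obtain x y where xy: "norm x \<le> e" "infdist y X \<le> e" "(x, y) \<in> L" by (auto simp: Q_def)
        obtain k where k: "k \<in> X" "infdist y X = dist y k"
          using infdist_attains_inf[OF compact_imp_closed[OF X(1)] False] by metis
        have "d \<le> dist (0, k) (x, y)" using d(2) k(1) xy(3) by auto
        also have "\<dots> \<le> dist 0 x + dist k y"
          unfolding dist_Pair_Pair by (intro order_trans[OF sqrt_sum_squares_le_sum]) auto
        also have "\<dots> \<le> e + e" using xy k by (simp add: dist_commute)
        finally show False using d(1) by (simp add: e_def)
      qed
      have "compact Q" unfolding Q_def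
        using X False e by (intro compact_Times compact_infdist_le) auto
      then have "\<forall>\<^sub>F n in sequentially. T n \<inter> Q = {}"
        using QL unfolding L_def by (intro compact_avoids_liminf[OF K])
      then obtain n0 where n0: "\<And>n. n \<ge> n0 \<Longrightarrow> T n \<inter> Q = {}"
        by (auto simp: eventually_sequentially)
      have near0: "y \<noteq> 0" if "infdist y X \<le> e" for y
      proof
        assume "y = 0"
        then have "(0, 0) \<in> Q" using that e by (simp add: Q_def)
        then show False using QL L0 by blast
      qed
      show ?thesis
      proof (rule emeasure_compact_outer_limit[OF \<rho>M X(1) False e near0])
        fix t assume t: "0 < t" "t \<le> e"
        define U where "U = {y. infdist y X < t}"
        have Uo: "open U" unfolding U_def by (rule inf_op)
        have Ub: "U \<in> sets borel" "0 \<notin> U" using Uo near0[of 0] t by (auto simp: U_def)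
        \<comment> \<open>Infinite \<mu>-mass near \<open>0\<close> would spoil continuity from
          above. Late graphs avoid \<open>Q\<close>, so points sent into \<open>U\<close> have norm
          above \<open>e\<close> almost everywhere, and \<open>F\<close> has finite mass.\<close>
        define F where "F = {x::'a. e \<le> norm x}"
        have Fcl: "closed F" unfolding F_def by (rule closed_norm_ge)
        have F0: "0 \<notin> F" using e by (simp add: F_def)
        have Fs: "F \<in> sets \<mu>" using Fcl F0 by (intro sets_M0[OF \<mu>]) auto
        have Fsv: "(s n -` U - {0}) \<inter> F \<in> sets \<mu>" for n using svs[OF Ub(1)] Fs by auto
        have "emeasure \<nu> (g n -` U) \<le> emeasure \<mu> ((s n -` U - {0}) \<inter> F)" if n: "n \<ge> n0" for n
        proof -
          have "U \<inter> {y. (0, y) \<in> T n} = {}"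
            using n0[OF n] e t by (fastforce simp: Q_def U_def)
          then have "emeasure \<nu> (g n -` U) = emeasure \<mu> (s n -` U - {0})" using eq[OF Ub] by simp
          also have "\<dots> \<le> emeasure \<mu> ((s n -` U - {0}) \<inter> F)"
          proof (rule emeasure_mono_AE[OF _ Fsv])
            show "AE x in \<mu>. x \<in> s n -` U - {0} \<longrightarrow> x \<in> (s n -` U - {0}) \<inter> F"
              using sT[of n]
            proof eventually_elim
              case (elim x)
              then have "(x, s n x) \<notin> Q" using n0[OF n] by blast
              then show ?case using t by (auto simp: Q_def U_def F_def)
            qed
          qed
          finally show ?thesis .
        qed
        moreover have "emeasure \<mu> (\<Union>n. (s n -` U - {0}) \<inter> F) < \<infinity>"
        proof (rule emeasure_M0_finite[OF \<mu> _ e])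
          have "(\<Union>n. (s n -` U - {0}) \<inter> F) \<in> sets \<mu>" using Fsv by (intro sets.countable_UN) auto
          then show "(\<Union>n. (s n -` U - {0}) \<inter> F) \<in> sets borel" using sets_M0_D[OF \<mu>] by blast
        qed (auto simp: F_def)
        ultimately have "emeasure \<nu> (\<Union>k. \<Inter>n\<in>{k..}. g n -` U)
            \<le> emeasure \<mu> (\<Inter>k. \<Union>n\<in>{k..}. (s n -` U - {0}) \<inter> F)"
          by (intro emeasure_liminf_le_limsup[where ?n0.0 = n0] gvs[OF Ub] Fsv)
        moreover have "emeasure \<nu> X \<le> emeasure \<nu> (\<Union>k. \<Inter>n\<in>{k..}. g n -` U)"
        proof (rule emeasure_mono)
          show "X \<subseteq> (\<Union>k. \<Inter>n\<in>{k..}. g n -` U)"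
          proof
            fix y assume "y \<in> X"
            then have "y \<in> U" using t by (simp add: U_def)
            then have "\<forall>\<^sub>F n in sequentially. g n y \<in> U" by (rule topological_tendstoD[OF glim Uo])
            then show "y \<in> (\<Union>k. \<Inter>n\<in>{k..}. g n -` U)" by (auto simp: eventually_sequentially)
          qed
          show "(\<Union>k. \<Inter>n\<in>{k..}. g n -` U) \<in> sets \<nu>"
            using gvs[OF Ub] by (intro sets.countable_UN sets.countable_INT' image_subsetI) auto
        qed
        moreover have "emeasure \<mu> (\<Inter>k. \<Union>n\<in>{k..}. (s n -` U - {0}) \<inter> F)
            \<le> emeasure \<mu> (grad_vimage \<psi> {y. infdist y X \<le> t} - {0})"
        proof (rule emeasure_mono_AE)
          show "AE x in \<mu>. x \<in> (\<Inter>k. \<Union>n\<in>{k..}. (s n -` U - {0}) \<inter> F) \<longrightarrow>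
              x \<in> grad_vimage \<psi> {y. infdist y X \<le> t} - {0}"
            using conv
          proof eventually_elim
            case (elim x)
            show ?case
            proof
              assume x: "x \<in> (\<Inter>k. \<Union>n\<in>{k..}. (s n -` U - {0}) \<inter> F)"
              have "infdist (grad \<psi> x) X \<le> t"
              proof (rule ccontr)
                assume "\<not> infdist (grad \<psi> x) X \<le> t"
                then have "grad \<psi> x \<in> - {y. infdist y X \<le> t}" by simp
                then have "\<forall>\<^sub>F n in sequentially. s n x \<in> - {y. infdist y X \<le> t}"
                  using elim inf_cl by (intro topological_tendstoD) auto
                then obtain k where "\<And>n. n \<ge> k \<Longrightarrow> \<not> infdist (s n x) X \<le> t"
                  by (auto simp: eventually_sequentially)
                then show False using x by (force simp: U_def)
              qed
              then show "x \<in> grad_vimage \<psi> {y. infdist y X \<le> t} - {0}"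
                using elim x by (auto simp: grad_vimage_def)
            qed
          qed
          show "grad_vimage \<psi> {y. infdist y X \<le> t} - {0} \<in> sets \<mu>"
            by (intro gvi borel_closed inf_cl)
        qed
        moreover have "emeasure \<rho> {y. infdist y X \<le> t} = emeasure \<mu> (grad_vimage \<psi> {y. infdist y X \<le> t} - {0})"
          using near0[of 0] t by (intro \<rho> borel_closed inf_cl) auto
        ultimately show "emeasure \<nu> X \<le> emeasure \<rho> {y. infdist y X \<le> t}" by simp
      qed
    qed simp
  qed
  show ?thesis
  proof (rule that[OF cc Lcl Lcm L0 L\<psi>])
    show "AE x in \<mu>. x \<in> dom_grad \<psi> \<and> (x, grad \<psi> x) \<in> L" using conv by eventually_elim blast
    fix B :: "'a set" assume B: "B \<in> sets borel" "0 \<notin> B"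
    show "emeasure \<mu> (grad_vimage \<psi> B - {0}) \<le> emeasure \<nu> B" using 1[OF B] \<rho>[OF B] by simp
    show "emeasure \<mu> (grad_vimage \<psi> B - {0}) = emeasure \<nu> B" if "B \<inter> {y. (0, y) \<in> L} = {}"
      using 1[OF B] 2[OF B that] \<rho>[OF B] by simp
  qed
qed

end


section \<open>Zero-couplings\<close>

lemma sigma_finite_M0:
  assumes \<nu>: "\<nu> \<in> M0" shows "sigma_finite_measure \<nu>"
proof
  have "away k \<in> sets \<nu>" for k by (intro sets_M0[OF \<nu>]) simp_all
  moreover have "emeasure \<nu> (away k) < \<infinity>" for k using emeasure_away_finite[OF \<nu>, of UNIV] by simp
  moreover have "(\<Union>k. away k) = - {0 :: 'a}" using UN_away[of "- {0}"] zero_notin_away by blast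
  ultimately show "\<exists>A. countable A \<and> A \<subseteq> sets \<nu> \<and> \<Union> A = space \<nu> \<and> (\<forall>a\<in>A. emeasure \<nu> a \<noteq> \<infinity>)"
    using space_M0[OF \<nu>] by (intro exI[of _ "range away"]) (auto simp: less_top)
qed

text \<open>Setwise subtraction fails where masses are infinite. Instead \<rho> has a density
  \<open>f \<le> 1\<close> with respect to \<nu>, and \<open>1 - f\<close> is the density of the
  complement.\<close>

lemma exists_complementary_measure:
  assumes "sigma_finite_measure \<nu>" and sets: "sets \<rho> = sets \<nu>"
    and le: "\<And>B. B \<in> sets \<nu> \<Longrightarrow> emeasure \<rho> B \<le> emeasure \<nu> B"
  shows "\<exists>\<kappa>. sets \<kappa> = sets \<nu> \<and> (\<forall>B\<in>sets \<nu>. emeasure \<rho> B + emeasure \<kappa> B = emeasure \<nu> B)"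
proof -
  interpret sigma_finite_measure \<nu> by fact
  have "absolutely_continuous \<nu> \<rho>"
    unfolding absolutely_continuous_def null_sets_def using le sets by (auto simp: le_zero_eq) (metis le_zero_eq)
  then obtain f where f: "f \<in> borel_measurable \<nu>" "density \<nu> f = \<rho>"
    using Radon_Nikodym sets by blast
  obtain A :: "nat \<Rightarrow> 'a set" where A: "range A \<subseteq> sets \<nu>" "(\<Union>i. A i) = space \<nu>" "\<And>i. emeasure \<nu> (A i) \<noteq> \<infinity>"
    using sigma_finite by metis
  have null: "AE x in \<nu>. x \<in> A i \<longrightarrow> f x \<le> 1" for i
  proof -
    \<comment> \<open>The integral of \<open>f - 1\<close> over \<open>D\<close> is the mass
      difference of \<rho> and \<nu>, hence zero, although the integrand is positive on
      \<open>D\<close>.\<close>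
    define D where "D = {x \<in> space \<nu>. 1 < f x} \<inter> A i"
    have D: "D \<in> sets \<nu>" unfolding D_def using f(1) A(1) by (intro sets.Int) auto
    have fin: "emeasure \<nu> D < \<infinity>"
      using A(1,3) by (intro le_less_trans[OF emeasure_mono[of D "A i"]]) (auto simp: D_def less_top)
    have \<rho>D: "(\<integral>\<^sup>+x. f x * indicator D x \<partial>\<nu>) = emeasure \<rho> D"
      using emeasure_density[OF f(1) D] f(2) by simp
    have "(\<integral>\<^sup>+x. f x * indicator D x - indicator D x \<partial>\<nu>)
        = (\<integral>\<^sup>+x. f x * indicator D x \<partial>\<nu>) - (\<integral>\<^sup>+x. indicator D x \<partial>\<nu>)"
    proof (rule nn_integral_diff)
      show "(\<lambda>x. f x * indicator D x) \<in> borel_measurable \<nu>"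
        using f(1) D by (intro borel_measurable_times_ennreal borel_measurable_indicator)
      show "indicator D \<in> borel_measurable \<nu>" using D by (rule borel_measurable_indicator)
      show "(\<integral>\<^sup>+x. indicator D x \<partial>\<nu>) \<noteq> \<infinity>" using fin D by (simp add: less_top)
      show "AE x in \<nu>. indicator D x \<le> f x * indicator D x"
        by (rule AE_I2) (auto simp: D_def split: split_indicator intro: less_imp_le)
    qed
    also have "\<dots> = emeasure \<rho> D - emeasure \<nu> D" using \<rho>D D by simp
    also have "\<dots> = 0" using le[OF D] fin by (intro diff_eq_0_ennreal) auto
    finally have "AE x in \<nu>. f x * indicator D x - indicator D x = 0"
      using f(1) D by (subst (asm) nn_integral_0_iff_AE) auto
    with AE_space show ?thesis
    proof eventually_elim
      case (elim x)
      then show ?case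
        using ennreal_minus_eq_0[of "f x" 1] by (cases "x \<in> D") (auto simp: D_def not_less)
    qed
  qed
  have le1: "AE x in \<nu>. f x \<le> 1"
  proof -
    have "AE x in \<nu>. \<forall>i. x \<in> A i \<longrightarrow> f x \<le> 1"
      unfolding AE_all_countable using null by blast
    with AE_space show ?thesis by eventually_elim (use A(2) in blast)
  qed
  have mf: "(\<lambda>x. 1 - f x) \<in> borel_measurable \<nu>" using f(1) by measurable
  have "emeasure \<rho> B + emeasure (density \<nu> (\<lambda>x. 1 - f x)) B = emeasure \<nu> B" if B: "B \<in> sets \<nu>" for B
  proof -
    have mf: "(\<lambda>x. 1 - f x) \<in> borel_measurable \<nu>" using f(1) by measurable
  have "emeasure \<rho> B + emeasure (density \<nu> (\<lambda>x. 1 - f x)) B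
        = (\<integral>\<^sup>+x. f x * indicator B x \<partial>\<nu>) + (\<integral>\<^sup>+x. (1 - f x) * indicator B x \<partial>\<nu>)"
      using emeasure_density[OF f(1) B] emeasure_density[OF mf B] f(2) by simp
    also have "\<dots> = (\<integral>\<^sup>+x. f x * indicator B x + (1 - f x) * indicator B x \<partial>\<nu>)"
      using f(1) mf B by (intro nn_integral_add[symmetric] borel_measurable_times_ennreal borel_measurable_indicator)
    also have "\<dots> = (\<integral>\<^sup>+x. indicator B x \<partial>\<nu>)"
      using le1 by (intro nn_integral_cong_AE)
        (auto simp: indicator_def add_diff_inverse_ennreal elim!: eventually_mono)
    finally show ?thesis using B by simp
  qed
  then show ?thesis by (intro exI[of _ "density \<nu> (\<lambda>x. 1 - f x)"]) auto
qed

lemma exists_sum_measure: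
  assumes sets: "sets M2 = sets M1"
  shows "\<exists>M. sets M = sets M1 \<and> (\<forall>E\<in>sets M1. emeasure M E = emeasure M1 E + emeasure M2 E)"
proof -
  define M where "M = measure_of (space M1) (sets M1) (\<lambda>E. emeasure M1 E + emeasure M2 E)"
  have sM: "sets M = sets M1" unfolding M_def by (simp add: sets.sets_measure_of_eq)
  have "emeasure M E = emeasure M1 E + emeasure M2 E" if E: "E \<in> sets M1" for E
  proof (rule emeasure_measure_of[OF M_def])
    show "sets M1 \<subseteq> Pow (space M1)" by (rule sets.space_closed)
    show "positive (sets M) (\<lambda>E. emeasure M1 E + emeasure M2 E)" by (simp add: positive_def)
    show "countably_additive (sets M) (\<lambda>E. emeasure M1 E + emeasure M2 E)"
    proof (rule countably_additiveI)
      fix A :: "nat \<Rightarrow> 'a set" assume A: "range A \<subseteq> sets M" "disjoint_family A"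
      then show "(\<Sum>i. emeasure M1 (A i) + emeasure M2 (A i)) = emeasure M1 (\<Union>i. A i) + emeasure M2 (\<Union>i. A i)"
        using suminf_emeasure[of A M1] suminf_emeasure[of A M2] sets sM
        by (subst suminf_add[symmetric]) auto
    qed
    show "E \<in> sets M" using E sM by simp
  qed
  then show ?thesis using sM by blast
qed

section \<open>Supports and marginals of couplings\<close>

lemma closed_spt: "closed (spt \<gamma>)"
  unfolding closed_def open_subopen[of "- spt \<gamma>"]
proof
  fix z assume "z \<in> - spt \<gamma>"
  then obtain U where "open U" "z \<in> U" "\<not> emeasure \<gamma> (U - {0}) > 0" by (auto simp: spt_def)
  then show "\<exists>U. open U \<and> z \<in> U \<and> U \<subseteq> - spt \<gamma>"
    by (intro exI[of _ U]) (auto simp: spt_def)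
qed

lemma spt_subset_closed:
  assumes "closed T" "emeasure \<gamma> (- T - {0}) = 0" shows "spt \<gamma> \<subseteq> T"
proof
  fix z assume "z \<in> spt \<gamma>"
  then show "z \<in> T" using assms open_Compl[of T] unfolding spt_def by force
qed

text \<open>By Lindelof, countably many null open sets cover the complement of the support.\<close>

lemma AE_spt:
  assumes sets: "sets \<gamma> = sets punctured_borel"
  shows "AE z in \<gamma>. z \<in> spt \<gamma>"
proof -
  define F where "F = {U. open U \<and> emeasure \<gamma> (U - {0}) = 0}"
  obtain F' where F': "F' \<subseteq> F" "countable F'" "\<Union> F' = \<Union> F"
    using Lindelof[of F] by (auto simp: F_def)
  have "(\<Union>U\<in>F'. U - {0}) \<in> null_sets \<gamma>"
  proof (rule null_sets_UN'[OF F'(2)])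
    fix U assume "U \<in> F'"
    then show "U - {0} \<in> null_sets \<gamma>"
      using F'(1) sets by (intro null_setsI) (auto simp: F_def sets_restrict_space_iff)
  qed
  then show ?thesis
  proof (rule AE_I')
    show "{z \<in> space \<gamma>. z \<notin> spt \<gamma>} \<subseteq> (\<Union>U\<in>F'. U - {0})"
    proof
      fix z assume z: "z \<in> {z \<in> space \<gamma>. z \<notin> spt \<gamma>}"
      have "space \<gamma> = - {0}" using sets_eq_imp_space_eq[OF sets] by (simp add: space_restrict_space)
      then have "z \<noteq> 0" using z by auto
      obtain U where "U \<in> F" "z \<in> U" using z by (auto simp: spt_def F_def zero_less_iff_neq_zero)
      then have "z \<in> \<Union> F'" using F'(3) by auto
      then show "z \<in> (\<Union>U\<in>F'. U - {0})" using \<open>z \<noteq> 0\<close> by auto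
    qed
  qed
qed

lemma sets_coupling:
  assumes "zero_coupling \<mu> \<nu> \<gamma>" "E \<in> sets borel" "0 \<notin> E" shows "E \<in> sets \<gamma>"
  using assms by (auto simp: zero_coupling_def sets_restrict_space_iff)

lemma coupling_marginals:
  assumes "zero_coupling \<mu> \<nu> \<gamma>" "A \<in> sets borel" "0 \<notin> A"
  shows "emeasure \<gamma> (A \<times> UNIV) = emeasure \<mu> A" "emeasure \<gamma> (UNIV \<times> A) = emeasure \<nu> A"
    "A \<times> UNIV \<in> sets \<gamma>" "UNIV \<times> A \<in> sets \<gamma>"
  using assms by (auto simp: zero_coupling_def subset_iff zero_prod_def intro!: sets_coupling[OF assms(1)] borel_Times)

text \<open>A pair of norm at least \<open>r\<close> has a coordinate of norm at least
  \<open>r / 2\<close>, so both marginals together control the mass.\<close>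

lemma coupling_finite:
  assumes \<mu>: "\<mu> \<in> M0" and \<nu>: "\<nu> \<in> M0" and \<gamma>: "zero_coupling \<mu> \<nu> \<gamma>"
    and r: "0 < r" and E: "\<And>z. z \<in> E \<Longrightarrow> r \<le> norm z"
  shows "emeasure \<gamma> E < \<infinity>"
proof -
  define A where "A = {x :: 'a. r / 2 \<le> norm x}"
  have "closed A" unfolding A_def by (rule closed_norm_ge)
  then have A: "A \<in> sets borel" "0 \<notin> A" using r by (auto simp: A_def)
  note m = coupling_marginals[OF \<gamma> A]
  have "E \<subseteq> A \<times> UNIV \<union> UNIV \<times> A"
  proof
    fix z assume z: "z \<in> E"
    have "norm z \<le> norm (fst z) + norm (snd z)"
      unfolding norm_prod_def by (rule sqrt_sum_squares_le_sum) auto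
    then have "r / 2 \<le> norm (fst z) \<or> r / 2 \<le> norm (snd z)" using E[OF z] by linarith
    then show "z \<in> A \<times> UNIV \<union> UNIV \<times> A" by (cases z) (auto simp: A_def)
  qed
  then have "emeasure \<gamma> E \<le> emeasure \<gamma> (A \<times> UNIV \<union> UNIV \<times> A)"
    using m by (intro emeasure_mono) auto
  also have "\<dots> \<le> emeasure \<mu> A + emeasure \<nu> A"
    using emeasure_subadditive[OF m(3,4)] m by simp
  also have "\<dots> < \<infinity>"
    using emeasure_M0_finite[OF \<mu> A(1), of "r / 2"] emeasure_M0_finite[OF \<nu> A(1), of "r / 2"] r
    by (simp add: A_def)
  finally show ?thesis .
qed

text \<open>Otherwise \<gamma> would vanish on a punctured neighbourhood of the origin and be finite
  outside it, so both marginals would have finite total mass.\<close>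

lemma zero_in_spt:
  assumes \<mu>: "\<mu> \<in> M0" and \<nu>: "\<nu> \<in> M0" and \<gamma>: "zero_coupling \<mu> \<nu> \<gamma>"
    and inf: "emeasure \<mu> (- {0}) = \<infinity> \<or> emeasure \<nu> (- {0}) = \<infinity>"
  shows "(0, 0) \<in> spt \<gamma>"
proof (rule ccontr)
  assume "(0, 0) \<notin> spt \<gamma>"
  then obtain U where U: "open U" "0 \<in> U" "emeasure \<gamma> (U - {0}) = 0"
    by (auto simp: spt_def zero_prod_def)
  obtain r where r: "0 < r" "ball 0 r \<subseteq> U" using U by (meson openE)
  have far: "emeasure \<gamma> (- U) < \<infinity>"
    by (rule coupling_finite[OF \<mu> \<nu> \<gamma> r(1)]) (use r(2) in \<open>force simp: not_less\<close>)
  have s: "U - {0} \<in> sets \<gamma>" "- U \<in> sets \<gamma>" using U by (auto intro!: sets_coupling[OF \<gamma>])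
  have m: "(- {0}) \<in> sets (borel :: 'a measure)" by simp
  have "emeasure \<gamma> E < \<infinity>" if "E \<in> sets \<gamma>" "0 \<notin> E" for E
  proof -
    have "emeasure \<gamma> E \<le> emeasure \<gamma> ((U - {0}) \<union> - U)" using s that by (intro emeasure_mono) auto
    also have "\<dots> \<le> emeasure \<gamma> (U - {0}) + emeasure \<gamma> (- U)" by (rule emeasure_subadditive[OF s])
    finally show ?thesis using U far by simp
  qed
  from this[OF coupling_marginals(3)[OF \<gamma> m]] this[OF coupling_marginals(4)[OF \<gamma> m]]
  show False using inf coupling_marginals[OF \<gamma> m] by (auto simp: zero_prod_def)
qed

section \<open>A coupling built from the potential\<close>

context small_sets_null
begin

lemma exists_coupling:
  assumes \<nu>: "\<nu> \<in> M0"
  shows "\<exists>\<gamma>. zero_coupling \<mu> \<nu> \<gamma> \<and> cyclically_monotone (spt \<gamma>)"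
proof -
  obtain \<psi> :: "'a \<Rightarrow> ereal" and T where cc: "closed_convex_fun \<psi>" and T: "closed T" "cyclically_monotone T" "(0, 0) \<in> T" "T \<subseteq> subdiff \<psi>"
    and aeT: "AE x in \<mu>. x \<in> dom_grad \<psi> \<and> (x, grad \<psi> x) \<in> T"
    and le: "\<And>B. B \<in> sets borel \<Longrightarrow> 0 \<notin> B \<Longrightarrow> emeasure \<mu> (grad_vimage \<psi> B - {0}) \<le> emeasure \<nu> B"
    and eq: "\<And>B. B \<in> sets borel \<Longrightarrow> 0 \<notin> B \<Longrightarrow> B \<inter> {y. (0, y) \<in> T} = {} \<Longrightarrow>
      emeasure \<mu> (grad_vimage \<psi> B - {0}) = emeasure \<nu> B"
    using exists_potential[OF \<nu>] by blast
  define \<rho> where "\<rho> = restrict_space (grad_push \<psi> \<mu>) (- {0})"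
  note \<rho> = emeasure_punctured_grad_push[OF \<mu> cc, folded \<rho>_def]
  have s\<nu>: "sets \<nu> = sets punctured_borel" using \<nu> by (simp add: M0_def)
  have "sets \<rho> = sets \<nu>" unfolding s\<nu> \<rho>_def by (intro sets_restrict_space_cong) (simp add: grad_push_def)
  then obtain \<kappa> where \<kappa>: "sets \<kappa> = sets \<nu>" "\<And>B. B \<in> sets \<nu> \<Longrightarrow> emeasure \<rho> B + emeasure \<kappa> B = emeasure \<nu> B"
    using exists_complementary_measure[OF sigma_finite_M0[OF \<nu>], of \<rho>] \<rho> le sets_M0_D[OF \<nu>] by metis
  \<comment> \<open>The value \<open>0\<close> off the domain is invisible to the second marginal,
    which is tested only on sets that avoid \<open>0\<close>.\<close>
  define S where "S x = (if x \<in> dom_grad \<psi> then grad \<psi> x else 0)" for x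
  have Sm: "S \<in> measurable borel borel"
    unfolding S_def using dom_grad_borel[OF cc] grad_measurable[OF cc]
    by (intro measurable_If_restrict_space_iff[THEN iffD2]) auto
  define P where "P = (\<lambda>x::'a. (x, S x))"
  have P: "P \<in> measurable \<mu> punctured_borel"
  proof (rule measurable_restrict_space2)
    show "P \<in> space \<mu> \<rightarrow> - {0}" using space_M0[OF \<mu>] by (auto simp: P_def zero_prod_def)
    have "P \<in> measurable borel borel" unfolding P_def using Sm by (intro borel_measurable_Pair) auto
    then have "P \<in> measurable punctured_borel borel" by (rule measurable_restrict_space1)
    then show "P \<in> measurable \<mu> borel" using \<mu> measurable_cong_sets[of \<mu> punctured_borel borel borel] by (auto simp: M0_def)
  qed
  define J where "J = (\<lambda>y::'a. (0::'a, y))"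
  have sp\<kappa>: "space \<kappa> = - {0}" using \<kappa>(1) space_M0[OF \<nu>] sets_eq_imp_space_eq by metis
  have J: "J \<in> measurable \<kappa> punctured_borel"
  proof (rule measurable_restrict_space2)
    show "J \<in> space \<kappa> \<rightarrow> - {0}" using sp\<kappa> by (auto simp: J_def zero_prod_def)
    have "J \<in> measurable borel borel" unfolding J_def by (intro borel_measurable_Pair) auto
    then have "J \<in> measurable punctured_borel borel" by (rule measurable_restrict_space1)
    then show "J \<in> measurable \<kappa> borel"
      using \<kappa>(1) s\<nu> measurable_cong_sets[of \<kappa> punctured_borel borel borel] by auto
  qed
  obtain \<gamma> where s\<gamma>: "sets \<gamma> = sets (punctured_borel :: ('a \<times> 'a) measure)"
    and \<gamma>0: "\<And>E. E \<in> sets (punctured_borel :: ('a \<times> 'a) measure) \<Longrightarrow>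
      emeasure \<gamma> E = emeasure (distr \<mu> punctured_borel P) E + emeasure (distr \<kappa> punctured_borel J) E"
    using exists_sum_measure[of "distr \<kappa> punctured_borel J" "distr \<mu> punctured_borel P"] by auto
  have \<gamma>: "emeasure \<gamma> E = emeasure \<mu> {x \<in> - {0}. (x, S x) \<in> E} + emeasure \<kappa> {y \<in> - {0}. (0, y) \<in> E}"
    if E: "E \<in> sets borel" "0 \<notin> E" for E
  proof -
    have Ep: "E \<in> sets punctured_borel" using E by (auto simp: sets_restrict_space_iff)
    have "P -` E \<inter> space \<mu> = {x \<in> - {0}. (x, S x) \<in> E}" "J -` E \<inter> space \<kappa> = {y \<in> - {0}. (0, y) \<in> E}"
      using space_M0[OF \<mu>] sp\<kappa> by (auto simp: P_def J_def)
    then show ?thesis using \<gamma>0[OF Ep] emeasure_distr[OF P Ep] emeasure_distr[OF J Ep] by simp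
  qed
  have "zero_coupling \<mu> \<nu> \<gamma>" unfolding zero_coupling_def
  proof (intro conjI ballI impI s\<gamma>)
    fix A :: "'a set" assume A: "A \<in> sets borel" "A \<subseteq> - {0}"
    have b: "A \<times> UNIV \<in> sets borel" "UNIV \<times> A \<in> sets borel" using A by (auto intro!: borel_Times)
    have z: "0 \<notin> A \<times> (UNIV :: 'a set)" "0 \<notin> (UNIV :: 'a set) \<times> A" using A by (auto simp: zero_prod_def)
    have "{x \<in> - {0}. (x, S x) \<in> A \<times> UNIV} = A" "{y \<in> - {0}. (0, y) \<in> A \<times> (UNIV :: 'a set)} = {}"
      using A by auto
    then show "emeasure \<gamma> (A \<times> UNIV) = emeasure \<mu> A"
      by (simp only: \<gamma>[OF b(1) z(1)] emeasure_empty add_0_right)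
    have "{x \<in> - {0}. (x, S x) \<in> UNIV \<times> A} = grad_vimage \<psi> A - {0}" "{y \<in> - {0}. (0, y) \<in> (UNIV :: 'a set) \<times> A} = A"
      using A by (auto simp: S_def grad_vimage_def split: if_splits)
    then have "emeasure \<gamma> (UNIV \<times> A) = emeasure \<mu> (grad_vimage \<psi> A - {0}) + emeasure \<kappa> A"
      by (simp only: \<gamma>[OF b(2) z(2)])
    moreover have "A \<in> sets \<nu>" "0 \<notin> A" using A by (auto intro: sets_M0[OF \<nu>])
    ultimately show "emeasure \<gamma> (UNIV \<times> A) = emeasure \<nu> A" using \<kappa>(2)[of A] \<rho>[of A] A(1) by simp
  qed
  moreover have "spt \<gamma> \<subseteq> T"
  proof (rule spt_subset_closed[OF T(1)])
    have bor: "- T - {0} \<in> sets borel" using T(1) by auto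
    have "emeasure \<mu> {x \<in> - {0}. (x, S x) \<in> - T - {0}} = emeasure \<mu> {}"
    proof (rule emeasure_eq_AE)
      show "AE x in \<mu>. x \<in> {x \<in> - {0}. (x, S x) \<in> - T - {0}} \<longleftrightarrow> x \<in> {}"
        using aeT by eventually_elim (auto simp: S_def)
      have "- T - {0} \<in> sets punctured_borel" using bor by (auto simp: sets_restrict_space_iff)
      from measurable_sets[OF P this] show "{x \<in> - {0}. (x, S x) \<in> - T - {0}} \<in> sets \<mu>"
        using space_M0[OF \<mu>] by (auto simp: P_def vimage_def Int_def conj_commute cong: conj_cong)
    qed simp
    moreover have "emeasure \<kappa> {y \<in> - {0}. (0, y) \<in> - T - {0}} = 0"
    proof -
      \<comment> \<open>Mass of \<kappa> on \<open>B\<close> would push the support out of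
        \<open>T\<close>. Saturation gives equality of \<rho> and \<nu> there, and \<kappa> is
        cancelled on pieces of finite mass.\<close>
      define B where "B = {y :: 'a. y \<noteq> 0 \<and> (0, y) \<notin> T}"
      have "closed {y. (0, y) \<in> T}"
        using continuous_closed_vimage[OF T(1), of "\<lambda>y. (0, y)"] by (auto simp: vimage_def intro!: continuous_intros)
      moreover have "B = - {0} - {y. (0, y) \<in> T}" by (auto simp: B_def)
      ultimately have Bb: "B \<in> sets borel" by auto
      have BE: "B \<inter> away k \<in> sets borel" "0 \<notin> B \<inter> away k" for k using Bb by (auto simp: B_def)
      have "emeasure \<kappa> (B \<inter> away k) = 0" for k
      proof -
        have r: "emeasure \<rho> (B \<inter> away k) = emeasure \<nu> (B \<inter> away k)"
          using eq[OF BE] \<rho>[OF BE] by (auto simp: B_def)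
        have "emeasure \<nu> (B \<inter> away k) < \<infinity>" by (rule emeasure_away_finite[OF \<nu> Bb])
        moreover have "emeasure \<nu> (B \<inter> away k) + emeasure \<kappa> (B \<inter> away k) = emeasure \<nu> (B \<inter> away k)"
          using \<kappa>(2)[OF sets_M0[OF \<nu> BE]] r by metis
        ultimately show ?thesis by auto
      qed
      then have "emeasure \<kappa> (\<Union>k. B \<inter> away k) = 0"
        using \<kappa>(1) sets_M0[OF \<nu> BE] by (intro emeasure_UN_eq_0) auto
      moreover have "(\<Union>k. B \<inter> away k) = B" by (rule UN_away) (simp add: B_def)
      moreover have "{y \<in> - {0}. (0, y) \<in> - T - {0}} = B" by (auto simp: B_def zero_prod_def)
      ultimately show ?thesis by simp
    qed
    ultimately show "emeasure \<gamma> (- T - {0}) = 0" using \<gamma>[OF bor] by simp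
  qed
  moreover have "cyclically_monotone S" if "S \<subseteq> T" for S
    using T(2) that unfolding cyclically_monotone_def by blast
  ultimately show ?thesis by blast
qed

end


section \<open>Uniqueness\<close>

lemma sublevel_closed:
  assumes cc: "closed_convex_fun \<psi>" shows "closed {x. \<psi> x \<le> ereal a}"
proof -
  have "closed ((\<lambda>x. (x, a)) -` ereal_epigraph \<psi>)"
    using cc by (intro continuous_closed_vimage) (auto simp: closed_convex_fun_def intro!: continuous_intros)
  then show ?thesis by (simp add: vimage_def ereal_epigraph_def)
qed

definition excess_set :: "('a \<Rightarrow> ereal) \<Rightarrow> ('a \<Rightarrow> ereal) \<Rightarrow> real \<Rightarrow> 'a set" where
  "excess_set \<psi>1 \<psi>2 q = {x. \<psi>2 x + ereal q < \<psi>1 x}"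

text \<open>A rational \<open>a\<close> with \<open>\<psi>2 x \<le> a\<close> and
  \<open>a + q < \<psi>1 x\<close> witnesses the excess: a closed sublevel set meets an open
  superlevel set.\<close>

lemma fsigma_excess_set:
  fixes \<psi>1 \<psi>2 :: "'a::euclidean_space \<Rightarrow> ereal"
  assumes cc1: "closed_convex_fun \<psi>1" and cc2: "closed_convex_fun \<psi>2"
  shows "fsigma_in euclidean (excess_set \<psi>1 \<psi>2 q)"
proof -
  have "excess_set \<psi>1 \<psi>2 q = (\<Union>a\<in>\<rat>. {x. \<psi>2 x \<le> ereal a} \<inter> - {x. \<psi>1 x \<le> ereal (a + q)})"
  proof (intro equalityI subsetI)
    fix x assume x: "x \<in> excess_set \<psi>1 \<psi>2 q"
    then have lt: "\<psi>2 x + ereal q < \<psi>1 x" by (simp add: excess_set_def)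
    then have "\<psi>2 x < \<infinity>" by (cases "\<psi>2 x") auto
    then obtain t where t: "\<psi>2 x = ereal t" using closed_convex_finite[OF cc2] by blast
    obtain s where s: "ereal (t + q) < ereal s" "ereal s < \<psi>1 x" using ereal_dense2[OF lt] t by auto
    then obtain a where a: "a \<in> \<rat>" "t < a" "a < s - q" using Rats_dense_in_real[of t "s - q"] by auto
    have "ereal (a + q) < \<psi>1 x" by (rule le_less_trans[OF _ s(2)]) (use a in simp)
    then show "x \<in> (\<Union>a\<in>\<rat>. {x. \<psi>2 x \<le> ereal a} \<inter> - {x. \<psi>1 x \<le> ereal (a + q)})"
      using a t by (auto simp: not_le intro!: bexI[of _ a])
  next
    fix x assume "x \<in> (\<Union>a\<in>\<rat>. {x. \<psi>2 x \<le> ereal a} \<inter> - {x. \<psi>1 x \<le> ereal (a + q)})"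
    then obtain a where a: "\<psi>2 x \<le> ereal a" "ereal (a + q) < \<psi>1 x" by (auto simp: not_le)
    have "\<psi>2 x + ereal q \<le> ereal a + ereal q" using a(1) by (rule add_right_mono)
    then show "x \<in> excess_set \<psi>1 \<psi>2 q" using a(2) by (simp add: excess_set_def)
  qed
  moreover have "fsigma_in euclidean (\<Union>a\<in>\<rat>. {x. \<psi>2 x \<le> ereal a} \<inter> - {x. \<psi>1 x \<le> ereal (a + q)})"
  proof (rule fsigma_in_Union)
    show "countable ((\<lambda>a. {x. \<psi>2 x \<le> ereal a} \<inter> - {x. \<psi>1 x \<le> ereal (a + q)}) ` \<rat>)"
      using countable_rat by (rule countable_image)
    fix S assume "S \<in> (\<lambda>a. {x. \<psi>2 x \<le> ereal a} \<inter> - {x. \<psi>1 x \<le> ereal (a + q)}) ` \<rat>"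
    then obtain a where S: "S = {x. \<psi>2 x \<le> ereal a} \<inter> - {x. \<psi>1 x \<le> ereal (a + q)}" by blast
    show "fsigma_in euclidean S" unfolding S
      using sublevel_closed[OF cc1] sublevel_closed[OF cc2]
      by (intro fsigma_in_Int closed_imp_fsigma_in open_imp_fsigma_in metrizable_space_euclidean) auto
  qed
  ultimately show ?thesis by simp
qed

definition excess_image :: "('a::euclidean_space \<Rightarrow> ereal) \<Rightarrow> ('a \<Rightarrow> ereal) \<Rightarrow> real \<Rightarrow> 'a set" where
  "excess_image \<psi>1 \<psi>2 q = {y. \<exists>x\<in>excess_set \<psi>1 \<psi>2 q. (x, y) \<in> subdiff \<psi>1}"

lemma excess_image_borel:
  assumes cc1: "closed_convex_fun \<psi>1" and cc2: "closed_convex_fun \<psi>2"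
  shows "excess_image \<psi>1 \<psi>2 q \<in> sets borel"
proof -
  obtain C :: "nat \<Rightarrow> 'a set" where C: "\<And>n. compact (C n)" "excess_set \<psi>1 \<psi>2 q = (\<Union>n. C n)"
    using fsigma_compact_decomposition[OF fsigma_excess_set[OF cc1 cc2]] by metis
  have "fsigma_in euclidean (snd ` (subdiff \<psi>1 \<inter> C n \<times> UNIV))" for n
    using C(1)[of n] closed_subdiff[OF cc1]
    by (intro fsigma_continuous_image fsigma_in_Int closed_imp_fsigma_in continuous_on_snd continuous_on_id)
      (auto intro: closed_Times compact_imp_closed)
  then have "(\<Union>n. snd ` (subdiff \<psi>1 \<inter> C n \<times> UNIV)) \<in> sets borel"
    by (intro sets.countable_UN) (auto intro: fsigma_in_borel)
  also have "(\<Union>n. snd ` (subdiff \<psi>1 \<inter> C n \<times> UNIV)) = excess_image \<psi>1 \<psi>2 q"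
    unfolding excess_image_def C(2) by force
  finally show ?thesis .
qed

text \<open>This is the inclusion behind Aleksandrov's lemma.\<close>

lemma excess_image_subdiff:
  assumes cc1: "closed_convex_fun \<psi>1" and cc2: "closed_convex_fun \<psi>2"
    and y: "y \<in> excess_image \<psi>1 \<psi>2 q" and x: "(x, y) \<in> subdiff \<psi>2"
  shows "x \<in> excess_set \<psi>1 \<psi>2 q"
proof -
  obtain z where z: "\<psi>2 z + ereal q < \<psi>1 z" "(z, y) \<in> subdiff \<psi>1"
    using y by (auto simp: excess_image_def excess_set_def)
  obtain s where s: "\<psi>1 z = ereal s" using z(2) subdiff_iff[OF cc1] by blast
  then have "\<psi>2 z < \<infinity>" using z(1) by (cases "\<psi>2 z") auto
  then obtain t where t: "\<psi>2 z = ereal t" using closed_convex_finite[OF cc2] by blast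
  obtain r where r: "\<psi>2 x = ereal r" using x subdiff_iff[OF cc2] by blast
  have 1: "r + (z - x) \<bullet> y \<le> t" by (rule subdiff_ineq[OF cc2 x r t])
  have 2: "t + q < s" using z(1) s t by simp
  have "ereal r + ereal q < \<psi>1 x"
  proof (cases "\<psi>1 x")
    case (real u)
    have "s + (x - z) \<bullet> y \<le> u" by (rule subdiff_ineq[OF cc1 z(2) s real])
    then show ?thesis using 1 2 real by (simp add: inner_diff_left)
  qed (use cc1 in \<open>auto simp: closed_convex_fun_def\<close>)
  then show ?thesis using r by (simp add: excess_set_def)
qed

text \<open>The assumption says that \<open>y\<close> is a \<open>\<psi>1\<close>-subgradient at points with excess arbitrarily close to
  that of \<open>x\<close>; in the limit both subgradient inequalities between these points and \<open>x\<close> become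
  equalities.\<close>

lemma subdiff_of_excess_images:
  assumes cc1: "closed_convex_fun \<psi>1" and cc2: "closed_convex_fun \<psi>2"
    and x: "(x, y) \<in> subdiff \<psi>2" and r: "\<psi>1 x = ereal r1" "\<psi>2 x = ereal r2" "r2 < r1"
    and im: "\<And>q. q \<in> \<rat> \<Longrightarrow> 0 < q \<Longrightarrow> q < r1 - r2 \<Longrightarrow> y \<in> excess_image \<psi>1 \<psi>2 q"
  shows "(x, y) \<in> subdiff \<psi>1"
proof -
  have "r1 + (z - x) \<bullet> y \<le> u" if u: "\<psi>1 z = ereal u" for z u
  proof (rule ccontr)
    assume "\<not> ?thesis"
    \<comment> \<open>This leaves room for a \<open>q\<close> that is positive, below the excess at
      \<open>x\<close>, and larger than the failing inequality at \<open>z\<close> allows.\<close>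
    then have "max 0 (u - (z - x) \<bullet> y - r2) < r1 - r2" using r(3) by auto
    then obtain q where q: "q \<in> \<rat>" "max 0 (u - (z - x) \<bullet> y - r2) < q" "q < r1 - r2"
      using Rats_dense_in_real by blast
    then have "y \<in> excess_image \<psi>1 \<psi>2 q" by (intro im) auto
    then obtain w where w: "\<psi>2 w + ereal q < \<psi>1 w" "(w, y) \<in> subdiff \<psi>1"
      by (auto simp: excess_image_def excess_set_def)
    obtain p1 where p1: "\<psi>1 w = ereal p1" using w(2) subdiff_iff[OF cc1] by blast
    then have "\<psi>2 w < \<infinity>" using w(1) by (cases "\<psi>2 w") auto
    then obtain p2 where p2: "\<psi>2 w = ereal p2" using closed_convex_finite[OF cc2] by blast
    have "p1 + (z - w) \<bullet> y \<le> u" by (rule subdiff_ineq[OF cc1 w(2) p1 u])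
    moreover have "r2 + (w - x) \<bullet> y \<le> p2" by (rule subdiff_ineq[OF cc2 x r(2) p2])
    moreover have "p2 + q < p1" using w(1) p1 p2 by simp
    ultimately show False using q(2) by (simp add: inner_diff_left)
  qed
  then show ?thesis using subdiff_iff[OF cc1] r(1) by blast
qed

text \<open>The normalization at the origin makes \<open>\<psi>2\<close> nonnegative, so an excess
  of \<open>q\<close> forces \<open>\<psi>1\<close> above \<open>q\<close>.\<close>

lemma excess_le:
  assumes cc2: "closed_convex_fun \<psi>2" and z2: "\<psi>2 0 = 0" "(0, 0) \<in> subdiff \<psi>2"
    and x: "x \<in> excess_set \<psi>1 \<psi>2 q" and r: "\<psi>1 x = ereal r"
  shows "q < r"
proof -
  have lt: "\<psi>2 x + ereal q < ereal r" using x r by (simp add: excess_set_def)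
  then have "\<psi>2 x < \<infinity>" by (cases "\<psi>2 x") auto
  then obtain t where t: "\<psi>2 x = ereal t" using closed_convex_finite[OF cc2] by blast
  have "0 \<le> t" using subdiff_ineq[OF cc2 z2(2) _ t, of 0] z2(1) by (simp add: zero_ereal_def)
  then show ?thesis using lt t by simp
qed

text \<open>With \<open>A\<close> the excess set and \<open>Y\<close> its image, \<open>\<mu>(A) =
  \<gamma>1(A \<times> UNIV) \<le> \<gamma>1(UNIV \<times> Y) = \<nu>(Y) = \<gamma>2(UNIV \<times>
  Y) \<le> \<gamma>2(A \<times> Y) \<le> \<mu>(A)\<close>. Since \<open>\<mu>(A)\<close> is finite,
  equality throughout leaves no mass of \<open>\<gamma>2\<close> on
  \<open>A \<times> - Y\<close>.\<close>

lemma excess_mass_bound: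
  assumes \<mu>: "\<mu> \<in> M0" and \<nu>: "\<nu> \<in> M0" and \<gamma>1: "zero_coupling \<mu> \<nu> \<gamma>1" and \<gamma>2: "zero_coupling \<mu> \<nu> \<gamma>2"
    and cc1: "closed_convex_fun \<psi>1" and cc2: "closed_convex_fun \<psi>2"
    and s1: "spt \<gamma>1 \<subseteq> subdiff \<psi>1" and s2: "spt \<gamma>2 \<subseteq> subdiff \<psi>2"
    and z1: "\<psi>1 0 = 0" and z2: "\<psi>2 0 = 0" "(0, 0) \<in> subdiff \<psi>2" and q: "0 < q"
  shows "emeasure \<gamma>2 (excess_set \<psi>1 \<psi>2 q \<times> - excess_image \<psi>1 \<psi>2 q) = 0"
proof -
  define A where "A = excess_set \<psi>1 \<psi>2 q"
  define Y where "Y = excess_image \<psi>1 \<psi>2 q"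
  have A: "A \<in> sets borel" unfolding A_def by (rule fsigma_in_borel[OF fsigma_excess_set[OF cc1 cc2]])
  have A0: "0 \<notin> A" using q z1 z2 by (simp add: A_def excess_set_def zero_ereal_def)
  \<comment> \<open>The subgradient inequality tested at \<open>0\<close> gives
    \<open>x \<bullet> y \<ge> \<psi>1 x > q\<close>; this keeps \<open>0\<close> out of
    \<open>Y\<close> and bounds \<open>y\<close> from below when \<open>x\<close> is small.\<close>
  have grow: "q < x \<bullet> y" if xA: "x \<in> A" and xy: "(x, y) \<in> subdiff \<psi>1" for x y
  proof -
    obtain r where r: "\<psi>1 x = ereal r" using xy subdiff_iff[OF cc1, of x y] by blast
    have "q < r" using excess_le[OF cc2 z2, of x \<psi>1 q r] xA r by (simp add: A_def)
    moreover have "r + (0 - x) \<bullet> y \<le> 0"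
      using z1 by (intro subdiff_ineq[OF cc1 xy r]) (simp add: zero_ereal_def)
    ultimately show ?thesis by simp
  qed
  have Y: "Y \<in> sets borel" unfolding Y_def by (rule excess_image_borel[OF cc1 cc2])
  have Y0: "0 \<notin> Y" using grow q unfolding Y_def excess_image_def A_def by fastforce
  have ae1: "AE z in \<gamma>1. z \<in> subdiff \<psi>1" and ae2: "AE z in \<gamma>2. z \<in> subdiff \<psi>2"
    using AE_spt[of \<gamma>1] AE_spt[of \<gamma>2] \<gamma>1 \<gamma>2 s1 s2
    by (auto simp: zero_coupling_def elim!: eventually_mono)
  note mA1 = coupling_marginals[OF \<gamma>1 A A0] and mA2 = coupling_marginals[OF \<gamma>2 A A0]
  note mY1 = coupling_marginals[OF \<gamma>1 Y Y0] and mY2 = coupling_marginals[OF \<gamma>2 Y Y0]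
  have fin: "emeasure \<mu> A < \<infinity>"
  proof -
    \<comment> \<open>Split at radius \<open>1\<close>: points of \<open>A\<close> inside are
      coupled by \<open>\<gamma>1\<close> to \<open>y\<close> with \<open>norm y \<ge> q\<close>,
      where \<nu> is finite; outside, \<mu> itself is finite.\<close>
    define B where "B = {x :: 'a. 1 \<le> norm x}"
    define D where "D = {y :: 'a. q \<le> norm y}"
    have B: "B \<in> sets borel" "0 \<notin> B" unfolding B_def
      by (auto intro!: borel_closed closed_norm_ge)
    have D: "D \<in> sets borel" "0 \<notin> D" unfolding D_def using q
      by (auto intro!: borel_closed closed_norm_ge)
    have AB: "A - B \<in> sets borel" "0 \<notin> A - B" using A B A0 by auto
    have "emeasure \<mu> (A - B) = emeasure \<gamma>1 ((A - B) \<times> UNIV)" using coupling_marginals(1)[OF \<gamma>1 AB] by simp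
    also have "\<dots> \<le> emeasure \<gamma>1 (UNIV \<times> D)"
    proof (rule emeasure_mono_AE)
      show "AE z in \<gamma>1. z \<in> (A - B) \<times> UNIV \<longrightarrow> z \<in> UNIV \<times> D"
        using ae1
      proof eventually_elim
        case (elim z)
        show ?case
        proof
          assume z: "z \<in> (A - B) \<times> UNIV"
          obtain x y where xy: "z = (x, y)" by fastforce
          have "q < x \<bullet> y" using grow[of x y] elim z xy by auto
          also have "\<dots> \<le> norm x * norm y" by (rule norm_cauchy_schwarz)
          also have "\<dots> \<le> 1 * norm y" using z xy by (intro mult_right_mono) (auto simp: B_def)
          finally show "z \<in> UNIV \<times> D" by (simp add: xy D_def)
        qed
      qed
    qed (rule coupling_marginals(4)[OF \<gamma>1 D])
    also have "\<dots> = emeasure \<nu> D" by (rule coupling_marginals(2)[OF \<gamma>1 D])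
    also have "\<dots> < \<infinity>" using q by (intro emeasure_M0_finite[OF \<nu> D(1), of q]) (auto simp: D_def)
    finally have 1: "emeasure \<mu> (A - B) < \<infinity>" .
    have 2: "emeasure \<mu> B < \<infinity>" by (intro emeasure_M0_finite[OF \<mu> B(1), of 1]) (auto simp: B_def)
    have "emeasure \<mu> A \<le> emeasure \<mu> ((A - B) \<union> B)"
      using AB B by (intro emeasure_mono sets.Un sets_M0[OF \<mu>]) auto
    also have "\<dots> \<le> emeasure \<mu> (A - B) + emeasure \<mu> B"
      using AB B by (intro emeasure_subadditive sets_M0[OF \<mu>]) auto
    finally show ?thesis using 1 2 by (metis ennreal_add_less_top infinity_ennreal_def le_less_trans)
  qed
  have AY: "A \<times> Y \<in> sets \<gamma>2" "A \<times> - Y \<in> sets \<gamma>2"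
    using A Y A0 by (auto intro!: sets_coupling[OF \<gamma>2] borel_Times simp: zero_prod_def)
  have "emeasure \<mu> A = emeasure \<gamma>1 (A \<times> UNIV)" using mA1(1) by simp
  also have "\<dots> \<le> emeasure \<gamma>1 (UNIV \<times> Y)"
  proof (rule emeasure_mono_AE[OF _ mY1(4)])
    show "AE z in \<gamma>1. z \<in> A \<times> UNIV \<longrightarrow> z \<in> UNIV \<times> Y"
      using ae1 by eventually_elim (auto simp: Y_def A_def excess_image_def)
  qed
  also have "\<dots> = emeasure \<gamma>2 (UNIV \<times> Y)" using mY1(2) mY2(2) by simp
  also have "\<dots> \<le> emeasure \<gamma>2 (A \<times> Y)"
  proof (rule emeasure_mono_AE[OF _ AY(1)])
    show "AE z in \<gamma>2. z \<in> UNIV \<times> Y \<longrightarrow> z \<in> A \<times> Y"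
      using ae2 by eventually_elim (auto simp: Y_def A_def intro: excess_image_subdiff[OF cc1 cc2])
  qed
  finally have le: "emeasure \<mu> A \<le> emeasure \<gamma>2 (A \<times> Y)" .
  have "emeasure \<mu> A = emeasure \<gamma>2 (A \<times> Y \<union> A \<times> - Y)"
  proof -
    have "A \<times> Y \<union> A \<times> - Y = A \<times> UNIV" by auto
    then show ?thesis using mA2(1) by simp
  qed
  also have "\<dots> = emeasure \<gamma>2 (A \<times> Y) + emeasure \<gamma>2 (A \<times> - Y)"
    using AY by (intro plus_emeasure[symmetric]) auto
  finally have eq: "emeasure \<mu> A = emeasure \<gamma>2 (A \<times> Y) + emeasure \<gamma>2 (A \<times> - Y)" .
  then have "emeasure \<gamma>2 (A \<times> Y) \<le> emeasure \<mu> A" by simp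
  then have "emeasure \<gamma>2 (A \<times> Y) = emeasure \<mu> A" using le by simp
  then have "emeasure \<mu> A + emeasure \<gamma>2 (A \<times> - Y) = emeasure \<mu> A" using eq by metis
  then have "emeasure \<gamma>2 (A \<times> - Y) = 0" using fin by auto
  then show ?thesis by (simp add: A_def Y_def)
qed

section \<open>Couplings as graph measures, and their uniqueness\<close>

context small_sets_null
begin

text \<open>The projection of the closed support is sigma-compact and, by the first marginal, of
  full \<mu>-mass. Subgradients exist over it and are unique outside a null set.\<close>

lemma coupling_AE_grad:
  assumes \<gamma>: "zero_coupling \<mu> \<nu> \<gamma>" and cc: "closed_convex_fun \<psi>" and s: "spt \<gamma> \<subseteq> subdiff \<psi>"
  shows "AE x in \<mu>. x \<in> dom_grad \<psi> \<and> (x, grad \<psi> x) \<in> spt \<gamma>"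
proof -
  define F where "F = fst ` spt \<gamma>"
  have "F \<in> sets borel"
    unfolding F_def by (intro fsigma_in_borel fsigma_continuous_image closed_imp_fsigma_in)
      (auto simp: closed_spt intro!: continuous_intros)
  then have F: "- F - {0} \<in> sets borel" "0 \<notin> - F - {0}" by auto
  have "emeasure \<mu> (- F - {0}) = emeasure \<gamma> ((- F - {0}) \<times> UNIV)" using coupling_marginals(1)[OF \<gamma> F] by simp
  also have "\<dots> = emeasure \<gamma> {}"
  proof (rule emeasure_eq_AE[OF _ coupling_marginals(3)[OF \<gamma> F]])
    have "AE z in \<gamma>. z \<in> spt \<gamma>" using \<gamma> by (intro AE_spt) (simp add: zero_coupling_def)
    then show "AE z in \<gamma>. z \<in> (- F - {0}) \<times> UNIV \<longleftrightarrow> z \<in> {}"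
    proof eventually_elim
      case (elim z)
      then have "fst z \<in> F" unfolding F_def by (rule imageI)
      then show ?case by auto
    qed
  qed simp
  finally have "- F - {0} \<in> null_sets \<mu>" using F by (intro null_setsI sets_M0[OF \<mu>]) auto
  then have "AE x in \<mu>. x \<in> F" by (rule AE_I') (use space_M0[OF \<mu>] in auto)
  with AE_not_multi_subdiff[OF cc] show ?thesis
  proof eventually_elim
    case (elim x)
    then obtain y where y: "(x, y) \<in> spt \<gamma>" by (auto simp: F_def)
    then have xy: "(x, y) \<in> subdiff \<psi>" using s by blast
    then have d: "x \<in> dom_grad \<psi>" using dom_grad_eq[OF cc] elim by (auto intro: rev_image_eqI)
    then show ?case using subdiff_grad[OF cc d, of y] xy y d by simp
  qed
qed

lemma id_grad_measurable:
  assumes cc: "closed_convex_fun \<psi>"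
  shows "(\<lambda>x. (x, grad \<psi> x)) \<in> measurable (restrict_space \<mu> (dom_grad \<psi>)) borel"
proof (rule borel_measurable_Pair[OF _ grad_measurable_M0[OF \<mu> cc]])
  show "(\<lambda>x. x) \<in> borel_measurable (restrict_space \<mu> (dom_grad \<psi>))"
    by (rule measurable_restrict_space1[OF ident_measurable_M0[OF \<mu>]])
qed

lemma graph_section_sets:
  assumes cc: "closed_convex_fun \<psi>" and E: "E \<in> sets borel"
  shows "{x \<in> dom_grad \<psi> - {0}. (x, grad \<psi> x) \<in> E} \<in> sets \<mu>"
proof -
  have "(\<lambda>x. (x, grad \<psi> x)) -` E \<inter> space (restrict_space \<mu> (dom_grad \<psi>)) \<in> sets (restrict_space \<mu> (dom_grad \<psi>))"
    by (rule measurable_sets[OF id_grad_measurable[OF cc] E])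
  moreover have "dom_grad \<psi> \<inter> space \<mu> \<in> sets \<mu>"
    using dom_grad_borel[OF cc] space_M0[OF \<mu>] by (intro sets_M0[OF \<mu>]) auto
  ultimately have "(\<lambda>x. (x, grad \<psi> x)) -` E \<inter> space (restrict_space \<mu> (dom_grad \<psi>)) \<in> sets \<mu>"
    by (simp add: sets_restrict_space_iff)
  moreover have "(\<lambda>x. (x, grad \<psi> x)) -` E \<inter> space (restrict_space \<mu> (dom_grad \<psi>))
      = {x \<in> dom_grad \<psi> - {0}. (x, grad \<psi> x) \<in> E}"
    using space_M0[OF \<mu>] by (auto simp: space_restrict_space)
  ultimately show ?thesis by simp
qed

text \<open>Away from \<open>x = 0\<close> the coupling sits on the graph of the gradient, so up to
  a null set \<open>E\<close> is a cylinder \<open>D \<times> UNIV\<close>, whose mass is given by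
  the first marginal.\<close>

lemma coupling_graph_part:
  assumes \<gamma>: "zero_coupling \<mu> \<nu> \<gamma>" and cc: "closed_convex_fun \<psi>" and s: "spt \<gamma> \<subseteq> subdiff \<psi>"
    and E: "E \<in> sets borel" "E \<subseteq> (- {0}) \<times> UNIV"
  shows "emeasure \<gamma> E = emeasure \<mu> {x \<in> dom_grad \<psi> - {0}. (x, grad \<psi> x) \<in> E}"
proof -
  define D where "D = {x \<in> dom_grad \<psi> - {0}. (x, grad \<psi> x) \<in> E}"
  have D: "D \<in> sets borel" "0 \<notin> D" using sets_M0_D[OF \<mu> graph_section_sets[OF cc E(1)]] by (auto simp: D_def)
  have N: "- dom_grad \<psi> - {0} \<in> sets borel" "0 \<notin> - dom_grad \<psi> - {0}" using dom_grad_borel[OF cc] by auto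
  have "emeasure \<mu> (- dom_grad \<psi> - {0}) = emeasure \<mu> {}"
    using coupling_AE_grad[OF \<gamma> cc s]
    by (intro emeasure_eq_AE sets_M0[OF \<mu> N]) (auto elim!: eventually_mono)
  then have "(- dom_grad \<psi> - {0}) \<times> UNIV \<in> null_sets \<gamma>"
    using coupling_marginals[OF \<gamma> N] by (intro null_setsI) auto
  then have "AE z in \<gamma>. z \<notin> (- dom_grad \<psi> - {0}) \<times> UNIV" by (rule AE_not_in)
  moreover have "AE z in \<gamma>. z \<in> spt \<gamma>" using \<gamma> by (intro AE_spt) (simp add: zero_coupling_def)
  ultimately have "AE z in \<gamma>. z \<in> E \<longleftrightarrow> z \<in> D \<times> UNIV"
  proof eventually_elim
    case (elim z)
    obtain x y where z: "z = (x, y)" by fastforce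
    show ?case
    proof (cases "x = 0")
      case True then show ?thesis using E(2) z by (auto simp: D_def)
    next
      case False
      then have d: "x \<in> dom_grad \<psi>" using elim(1) z by auto
      have "y = grad \<psi> x" using subdiff_grad[OF cc d] elim(2) s z by blast
      then show ?thesis using z d False by (auto simp: D_def)
    qed
  qed
  moreover have "E \<in> sets \<gamma>" using E by (intro sets_coupling[OF \<gamma>]) (auto simp: zero_prod_def)
  ultimately have "emeasure \<gamma> E = emeasure \<gamma> (D \<times> UNIV)"
    using coupling_marginals(3)[OF \<gamma> D] by (intro emeasure_eq_AE)
  also have "\<dots> = emeasure \<mu> D" by (rule coupling_marginals(1)[OF \<gamma> D])
  finally show ?thesis by (simp add: D_def)
qed

lemma grad_eq_on_excess:
  assumes \<nu>: "\<nu> \<in> M0" and \<gamma>1: "zero_coupling \<mu> \<nu> \<gamma>1" and \<gamma>2: "zero_coupling \<mu> \<nu> \<gamma>2"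
    and cc1: "closed_convex_fun \<psi>1" and cc2: "closed_convex_fun \<psi>2"
    and s1: "spt \<gamma>1 \<subseteq> subdiff \<psi>1" and s2: "spt \<gamma>2 \<subseteq> subdiff \<psi>2"
    and z1: "\<psi>1 0 = 0" and z2: "\<psi>2 0 = 0" "(0, 0) \<in> subdiff \<psi>2"
  shows "AE x in \<mu>. \<psi>2 x < \<psi>1 x \<longrightarrow> grad \<psi>1 x = grad \<psi>2 x"
proof -
  have ae: "AE x in \<mu>. x \<in> excess_set \<psi>1 \<psi>2 q \<longrightarrow> grad \<psi>2 x \<in> excess_image \<psi>1 \<psi>2 q" if q: "0 < q" for q
  proof -
    define E where "E = excess_set \<psi>1 \<psi>2 q \<times> - excess_image \<psi>1 \<psi>2 q"
    have E: "E \<in> sets borel" unfolding E_def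
      using fsigma_in_borel[OF fsigma_excess_set[OF cc1 cc2]] excess_image_borel[OF cc1 cc2]
      by (intro borel_Times) auto
    have E0: "E \<subseteq> (- {0}) \<times> UNIV" using q z1 z2 by (auto simp: E_def excess_set_def zero_ereal_def)
    have "emeasure \<gamma>2 E = 0" unfolding E_def
      by (rule excess_mass_bound[OF \<mu> \<nu> \<gamma>1 \<gamma>2 cc1 cc2 s1 s2 z1 z2 q])
    then have "emeasure \<mu> {x \<in> dom_grad \<psi>2 - {0}. (x, grad \<psi>2 x) \<in> E} = 0"
      using coupling_graph_part[OF \<gamma>2 cc2 s2 E E0] by simp
    then have "{x \<in> dom_grad \<psi>2 - {0}. (x, grad \<psi>2 x) \<in> E} \<in> null_sets \<mu>"
      using graph_section_sets[OF cc2 E] by (intro null_setsI)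
    then have "AE x in \<mu>. x \<notin> {x \<in> dom_grad \<psi>2 - {0}. (x, grad \<psi>2 x) \<in> E}" by (rule AE_not_in)
    with coupling_AE_grad[OF \<gamma>2 cc2 s2] AE_space show ?thesis
      by eventually_elim (use space_M0[OF \<mu>] in \<open>auto simp: E_def\<close>)
  qed
  \<comment> \<open>Restricting to rational levels gives one exceptional null set for all of
    them.\<close>
  have "AE x in \<mu>. \<forall>q\<in>{q\<in>\<rat>. 0 < q}. x \<in> excess_set \<psi>1 \<psi>2 q \<longrightarrow> grad \<psi>2 x \<in> excess_image \<psi>1 \<psi>2 q"
    using ae countable_subset[OF _ countable_rat, of "{q\<in>\<rat>. 0 < q}"] by (subst AE_ball_countable) auto
  with coupling_AE_grad[OF \<gamma>1 cc1 s1] coupling_AE_grad[OF \<gamma>2 cc2 s2] show ?thesis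
  proof eventually_elim
    case (elim x)
    show ?case
    proof
      assume lt: "\<psi>2 x < \<psi>1 x"
      have g1: "(x, grad \<psi>1 x) \<in> subdiff \<psi>1" and g2: "(x, grad \<psi>2 x) \<in> subdiff \<psi>2" using elim s1 s2 by auto
      obtain r1 where r1: "\<psi>1 x = ereal r1" using g1 subdiff_iff[OF cc1] by blast
      obtain r2 where r2: "\<psi>2 x = ereal r2" using g2 subdiff_iff[OF cc2] by blast
      have "(x, grad \<psi>2 x) \<in> subdiff \<psi>1"
      proof (rule subdiff_of_excess_images[OF cc1 cc2 g2 r1 r2])
        show "r2 < r1" using lt r1 r2 by simp
        fix q assume q: "q \<in> \<rat>" "0 < q" "q < r1 - r2"
        then have "x \<in> excess_set \<psi>1 \<psi>2 q" using r1 r2 by (simp add: excess_set_def)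
        then show "grad \<psi>2 x \<in> excess_image \<psi>1 \<psi>2 q" using elim(3) q by blast
      qed
      then show "grad \<psi>1 x = grad \<psi>2 x" using subdiff_grad[OF cc1, of x "grad \<psi>2 x"] elim(1) by simp
    qed
  qed
qed

lemma grad_unique:
  assumes \<nu>: "\<nu> \<in> M0" and \<gamma>1: "zero_coupling \<mu> \<nu> \<gamma>1" and \<gamma>2: "zero_coupling \<mu> \<nu> \<gamma>2"
    and cc1: "closed_convex_fun \<psi>1" and cc2: "closed_convex_fun \<psi>2"
    and s1: "spt \<gamma>1 \<subseteq> subdiff \<psi>1" and s2: "spt \<gamma>2 \<subseteq> subdiff \<psi>2"
    and z1: "\<psi>1 0 = 0" "(0, 0) \<in> subdiff \<psi>1" and z2: "\<psi>2 0 = 0" "(0, 0) \<in> subdiff \<psi>2"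
  shows "AE x in \<mu>. grad \<psi>1 x = grad \<psi>2 x"
proof -
  define \<phi> where "\<phi> x = max (\<psi>1 x) (\<psi>2 x)" for x
  have cc: "closed_convex_fun \<phi>" unfolding \<phi>_def by (rule closed_convex_max[OF cc1 cc2])
  show ?thesis
    using grad_eq_on_excess[OF \<nu> \<gamma>1 \<gamma>2 cc1 cc2 s1 s2 z1(1) z2]
      grad_eq_on_excess[OF \<nu> \<gamma>2 \<gamma>1 cc2 cc1 s2 s1 z2(1) z1] AE_not_multi_subdiff[OF cc]
      coupling_AE_grad[OF \<gamma>1 cc1 s1] coupling_AE_grad[OF \<gamma>2 cc2 s2]
  proof eventually_elim
    case (elim x)
    consider "\<psi>2 x < \<psi>1 x" | "\<psi>1 x < \<psi>2 x" | "\<psi>1 x = \<psi>2 x" by fastforce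
    then show ?case
    proof cases
      case 3
      have "(x, grad \<psi>1 x) \<in> subdiff \<psi>1" "(x, grad \<psi>2 x) \<in> subdiff \<psi>2" using elim s1 s2 by auto
      then have "(x, grad \<psi>1 x) \<in> subdiff \<phi>" "(x, grad \<psi>2 x) \<in> subdiff \<phi>"
        using 3 by (auto simp: subdiff_def \<phi>_def le_max_iff_disj)
      then show ?thesis using elim(3) by (auto simp: multi_subdiff_def)
    qed (use elim in auto)
  qed
qed

text \<open>The support is the link: \<open>(x, grad \<psi>\<^sub>1 x)\<close> lies in it, hence in
  the other subdifferential, where the gradient is the only value.\<close>

lemma grad_determined_by_coupling:
  assumes \<gamma>: "zero_coupling \<mu> \<nu> \<gamma>"
    and cc1: "closed_convex_fun \<psi>1" and cc2: "closed_convex_fun \<psi>2"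
    and s1: "spt \<gamma> \<subseteq> subdiff \<psi>1" and s2: "spt \<gamma> \<subseteq> subdiff \<psi>2"
  shows "AE x in \<mu>. x \<in> dom_grad \<psi>1 \<and> x \<in> dom_grad \<psi>2 \<and> grad \<psi>1 x = grad \<psi>2 x"
  using coupling_AE_grad[OF \<gamma> cc1 s1] coupling_AE_grad[OF \<gamma> cc2 s2]
proof eventually_elim
  case (elim x)
  then have "(x, grad \<psi>1 x) \<in> subdiff \<psi>2" using s2 by blast
  then show ?case using elim subdiff_grad[OF cc2] by blast
qed

text \<open>Stated as a sum because \<nu> may be infinite on \<open>B\<close>; in this form it also
  covers the proper case for sets that accumulate at \<open>0\<close>.\<close>

lemma coupling_off_axis:
  assumes \<gamma>: "zero_coupling \<mu> \<nu> \<gamma>" and cc: "closed_convex_fun \<psi>" and s: "spt \<gamma> \<subseteq> subdiff \<psi>"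
    and B: "B \<in> sets borel" "0 \<notin> B"
  shows "emeasure \<gamma> ({0} \<times> B) + emeasure (grad_push \<psi> \<mu>) B = emeasure \<nu> B"
proof -
  have b: "{0::'a} \<times> B \<in> sets borel" "(- {0::'a}) \<times> B \<in> sets borel" using B by (auto intro!: borel_Times)
  have "emeasure (grad_push \<psi> \<mu>) B = emeasure \<mu> {x \<in> dom_grad \<psi> - {0}. (x, grad \<psi> x) \<in> (- {0}) \<times> B}"
    unfolding emeasure_grad_push[OF \<mu> cc B(1)]
    by (rule arg_cong[where f = "emeasure \<mu>"]) (auto simp: grad_vimage_def)
  also have "\<dots> = emeasure \<gamma> ((- {0}) \<times> B)"
    by (rule coupling_graph_part[OF \<gamma> cc s b(2), symmetric]) auto
  finally have "emeasure \<gamma> ({0} \<times> B) + emeasure (grad_push \<psi> \<mu>) B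
      = emeasure \<gamma> ({0} \<times> B) + emeasure \<gamma> ((- {0}) \<times> B)" by simp
  also have "\<dots> = emeasure \<gamma> ({0} \<times> B \<union> (- {0}) \<times> B)"
    using b B by (intro plus_emeasure sets_coupling[OF \<gamma>]) (auto simp: zero_prod_def)
  also have "{0} \<times> B \<union> (- {0}) \<times> B = UNIV \<times> B" by auto
  finally show ?thesis using coupling_marginals(2)[OF \<gamma> B] by simp
qed

text \<open>Away from \<open>0\<close> the measure \<nu> is finite, which permits solving the sum
  formula for the mass over \<open>x = 0\<close>.\<close>

lemma coupling_axis:
  assumes \<nu>: "\<nu> \<in> M0" and \<gamma>: "zero_coupling \<mu> \<nu> \<gamma>" and cc: "closed_convex_fun \<psi>" and s: "spt \<gamma> \<subseteq> subdiff \<psi>"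
    and B: "B \<in> sets borel" "0 \<notin> closure B"
  shows "emeasure (grad_push \<psi> \<mu>) B \<le> emeasure \<nu> B"
    "emeasure \<gamma> ({0} \<times> B) = emeasure \<nu> B - emeasure (grad_push \<psi> \<mu>) B"
proof -
  have B0: "0 \<notin> B" using B(2) closure_subset by blast
  note sum = coupling_off_axis[OF \<gamma> cc s B(1) B0]
  show le: "emeasure (grad_push \<psi> \<mu>) B \<le> emeasure \<nu> B" using sum by (metis le_add2 le_iff_add add.commute)
  have "emeasure \<nu> B < \<infinity>" using \<nu> B by (auto simp: M0_def)
  then have "emeasure (grad_push \<psi> \<mu>) B \<noteq> \<infinity>" using le_less_trans[OF le] by auto
  then show "emeasure \<gamma> ({0} \<times> B) = emeasure \<nu> B - emeasure (grad_push \<psi> \<mu>) B"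
    using sum ennreal_add_diff_cancel_right by (metis infinity_ennreal_def)
qed

text \<open>Away from \<open>x = 0\<close> a coupling is determined by \<mu> and the gradient, over
  \<open>x = 0\<close> by the defect of \<nu>; both agree for the two couplings.\<close>

lemma coupling_unique:
  assumes \<nu>: "\<nu> \<in> M0" and inf: "emeasure \<mu> (- {0}) = \<infinity> \<or> emeasure \<nu> (- {0}) = \<infinity>"
    and \<gamma>1: "\<gamma>1 \<in> Gamma0cm \<mu> \<nu>" and \<gamma>2: "\<gamma>2 \<in> Gamma0cm \<mu> \<nu>"
  shows "\<gamma>1 = \<gamma>2"
proof -
  have c1: "zero_coupling \<mu> \<nu> \<gamma>1" and c2: "zero_coupling \<mu> \<nu> \<gamma>2"
    using \<gamma>1 \<gamma>2 by (auto simp: Gamma0cm_def)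
  have o1: "(0, 0) \<in> spt \<gamma>1" and o2: "(0, 0) \<in> spt \<gamma>2"
    using zero_in_spt[OF \<mu> \<nu> c1 inf] zero_in_spt[OF \<mu> \<nu> c2 inf] by auto
  obtain \<psi>1 where p1: "closed_convex_fun \<psi>1" "\<psi>1 0 = 0" "spt \<gamma>1 \<subseteq> subdiff \<psi>1"
    using cyclically_monotone_imp_subdiff[OF _ o1] \<gamma>1 by (auto simp: Gamma0cm_def)
  obtain \<psi>2 where p2: "closed_convex_fun \<psi>2" "\<psi>2 0 = 0" "spt \<gamma>2 \<subseteq> subdiff \<psi>2"
    using cyclically_monotone_imp_subdiff[OF _ o2] \<gamma>2 by (auto simp: Gamma0cm_def)
  have ge: "AE x in \<mu>. grad \<psi>1 x = grad \<psi>2 x"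
    using p1 p2 o1 o2 by (intro grad_unique[OF \<nu> c1 c2 p1(1) p2(1) p1(3) p2(3)]) auto
  have graph: "emeasure \<gamma>1 E = emeasure \<gamma>2 E" if E: "E \<in> sets borel" "E \<subseteq> (- {0}) \<times> UNIV" for E
    unfolding coupling_graph_part[OF c1 p1(1,3) E] coupling_graph_part[OF c2 p2(1,3) E]
  proof (rule emeasure_eq_AE)
    show "AE x in \<mu>. x \<in> {x \<in> dom_grad \<psi>1 - {0}. (x, grad \<psi>1 x) \<in> E} \<longleftrightarrow>
        x \<in> {x \<in> dom_grad \<psi>2 - {0}. (x, grad \<psi>2 x) \<in> E}"
      using ge coupling_AE_grad[OF c1 p1(1,3)] coupling_AE_grad[OF c2 p2(1,3)]
      by eventually_elim auto
  qed (intro graph_section_sets p1 p2 E)+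
  have push: "emeasure (grad_push \<psi>1 \<mu>) B = emeasure (grad_push \<psi>2 \<mu>) B" if B: "B \<in> sets borel" for B
  proof -
    have b: "(- {0::'a}) \<times> B \<in> sets borel" using B by (auto intro!: borel_Times)
    have "grad_vimage \<psi> B - {0} = {x \<in> dom_grad \<psi> - {0}. (x, grad \<psi> x) \<in> (- {0}) \<times> B}" for \<psi> :: "'a \<Rightarrow> ereal"
      by (auto simp: grad_vimage_def)
    then show ?thesis
      unfolding emeasure_grad_push[OF \<mu> p1(1) B] emeasure_grad_push[OF \<mu> p2(1) B]
      using graph[OF b] coupling_graph_part[OF c1 p1(1,3) b] coupling_graph_part[OF c2 p2(1,3) b] by auto
  qed
  have axis: "emeasure \<gamma>1 ({0} \<times> B) = emeasure \<gamma>2 ({0} \<times> B)" if B: "B \<in> sets borel" "0 \<notin> B" for B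
  proof -
    \<comment> \<open>The defect is a difference, so it fixes the mass only for sets at positive
      distance from \<open>0\<close>; these exhaust \<open>B\<close>.\<close>
    define C where "C k = B \<inter> away k" for k
    have Cb: "C k \<in> sets borel" for k unfolding C_def using B by (intro sets.Int) simp_all
    have C0: "0 \<notin> closure (C k)" for k
      using closure_minimal[OF _ closed_away, of "C k" k] zero_notin_away unfolding C_def by blast
    have eqk: "emeasure \<gamma>1 ({0} \<times> C k) = emeasure \<gamma>2 ({0} \<times> C k)" for k
      using coupling_axis(2)[OF \<nu> c1 p1(1,3) Cb C0] coupling_axis(2)[OF \<nu> c2 p2(1,3) Cb C0] push[OF Cb] by simp
    have inc: "incseq (\<lambda>k. {0::'a} \<times> C k)"
      using incseq_away[of B] unfolding incseq_def C_def by blast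
    have un: "(\<Union>k. {0::'a} \<times> C k) = {0} \<times> B" using UN_away[OF B(2)] unfolding C_def by blast
    have s: "range (\<lambda>k. {0::'a} \<times> C k) \<subseteq> sets \<gamma>1" "range (\<lambda>k. {0::'a} \<times> C k) \<subseteq> sets \<gamma>2"
      using Cb B by (auto simp: C_def zero_prod_def intro!: sets_coupling[OF c1] sets_coupling[OF c2] borel_Times)
    show ?thesis
      using SUP_emeasure_incseq[OF s(1) inc] SUP_emeasure_incseq[OF s(2) inc] eqk un by simp
  qed
  show ?thesis
  proof (rule measure_eqI)
    show "sets \<gamma>1 = sets \<gamma>2" using c1 c2 by (simp add: zero_coupling_def)
    fix E assume "E \<in> sets \<gamma>1"
    then have E: "E \<in> sets borel" "0 \<notin> E" using c1 by (auto simp: zero_coupling_def sets_restrict_space_iff)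
    define B where "B = {y. (0, y) \<in> E}"
    have "B = (\<lambda>y. (0, y)) -` E \<inter> space borel" by (auto simp: B_def)
    then have B: "B \<in> sets borel"
      using measurable_sets[of "\<lambda>y::'a. (0::'a, y)" borel borel E] E(1) by (auto intro!: borel_measurable_Pair)
    have B0: "0 \<notin> B" using E(2) by (simp add: B_def zero_prod_def)
    define G where "G = E \<inter> (- {0}) \<times> UNIV"
    have Gb: "G \<in> sets borel" unfolding G_def using E(1) by (intro sets.Int borel_Times) auto
    have AB: "{0::'a} \<times> B \<in> sets borel" using B by (intro borel_Times) auto
    have split: "E = {0} \<times> B \<union> G" by (auto simp: B_def G_def)
    have "emeasure \<gamma> E = emeasure \<gamma> ({0} \<times> B) + emeasure \<gamma> G" if "zero_coupling \<mu> \<nu> \<gamma>" for \<gamma>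
      unfolding split using Gb AB E(2) B0
      by (intro plus_emeasure[symmetric] sets_coupling[OF that]) (auto simp: G_def zero_prod_def)
    then show "emeasure \<gamma>1 E = emeasure \<gamma>2 E"
      using c1 c2 axis[OF B B0] graph[OF Gb] by (simp add: G_def)
  qed
qed

end

theorem corollary4p5:
  fixes \<mu> \<nu> :: "'a::euclidean_space measure"
  assumes "\<mu> \<in> M0" and "\<nu> \<in> M0"
    and "emeasure \<mu> (- {0}) = \<infinity> \<or> emeasure \<nu> (- {0}) = \<infinity>"
    and "\<forall>A\<in>sets borel. A \<subseteq> - {0} \<longrightarrow> hausdorff_dim A \<le> ereal (real DIM('a) - 1) \<longrightarrow>
           emeasure \<mu> A = 0"
  shows "\<exists>\<gamma>. Gamma0cm \<mu> \<nu> = {\<gamma>} \<and>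
    (\<exists>\<psi>. closed_convex_fun \<psi> \<and> spt \<gamma> \<subseteq> subdiff \<psi> \<and>
       (\<forall>A\<in>sets borel. \<forall>B\<in>sets borel. A \<subseteq> - {0} \<longrightarrow>
          emeasure \<gamma> (A \<times> B) = emeasure (id_grad_push \<psi> \<mu>) (A \<times> B) \<and>
          emeasure (id_grad_push \<psi> \<mu>) (A \<times> B) = emeasure \<mu> (A \<inter> grad_vimage \<psi> B)) \<and>
       (\<forall>B\<in>sets borel. 0 \<notin> closure B \<longrightarrow>
          emeasure (grad_push \<psi> \<mu>) B \<le> emeasure \<nu> B \<and>
          emeasure \<gamma> ({0} \<times> B) = emeasure \<nu> B - emeasure (grad_push \<psi> \<mu>) B) \<and>
       - {0} - dom_grad \<psi> \<in> sets \<mu> \<and> emeasure \<mu> (- {0} - dom_grad \<psi>) = 0 \<and>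
       (proper_coupling \<gamma> \<longrightarrow>
          (\<forall>B\<in>sets borel. B \<subseteq> - {0} \<longrightarrow>
             emeasure \<nu> B = emeasure (grad_push \<psi> \<mu>) B \<and>
             emeasure (grad_push \<psi> \<mu>) B = emeasure \<mu> (- {0} \<inter> grad_vimage \<psi> B)))) \<and>
    (\<forall>\<psi>\<^sub>1 \<psi>\<^sub>2. closed_convex_fun \<psi>\<^sub>1 \<and> spt \<gamma> \<subseteq> subdiff \<psi>\<^sub>1 \<and>
             closed_convex_fun \<psi>\<^sub>2 \<and> spt \<gamma> \<subseteq> subdiff \<psi>\<^sub>2 \<longrightarrow>
       (AE x in \<mu>. x \<in> dom_grad \<psi>\<^sub>1 \<and> x \<in> dom_grad \<psi>\<^sub>2 \<and> grad \<psi>\<^sub>1 x = grad \<psi>\<^sub>2 x))"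
proof -
  note \<nu> = assms(2)
  interpret small_sets_null \<mu> by unfold_locales (use assms in auto)
  obtain \<gamma> where \<gamma>: "zero_coupling \<mu> \<nu> \<gamma>" "cyclically_monotone (spt \<gamma>)"
    using exists_coupling[OF \<nu>] by blast
  then have in_\<Gamma>: "\<gamma> \<in> Gamma0cm \<mu> \<nu>" by (simp add: Gamma0cm_def)
  then have single: "Gamma0cm \<mu> \<nu> = {\<gamma>}" using coupling_unique[OF \<nu> assms(3)] by blast
  \<comment> \<open>The potential is rebuilt from the support of \<gamma>; infinite mass puts
    \<open>(0, 0)\<close> there, the starting pair of Rockafellar's chains.\<close>
  obtain \<psi> where cc: "closed_convex_fun \<psi>" and s: "spt \<gamma> \<subseteq> subdiff \<psi>"
    using cyclically_monotone_imp_subdiff[OF \<gamma>(2) zero_in_spt[OF \<mu> \<nu> \<gamma>(1) assms(3)]] by blast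
  have part: "emeasure \<gamma> (A \<times> B) = emeasure (id_grad_push \<psi> \<mu>) (A \<times> B) \<and>
      emeasure (id_grad_push \<psi> \<mu>) (A \<times> B) = emeasure \<mu> (A \<inter> grad_vimage \<psi> B)"
    if A: "A \<in> sets borel" "A \<subseteq> - {0}" and B: "B \<in> sets borel" for A B
  proof -
    have b: "A \<times> B \<in> sets borel" using A B by (intro borel_Times)
    have set: "{x \<in> dom_grad \<psi> - {0}. (x, grad \<psi> x) \<in> A \<times> B} = A \<inter> grad_vimage \<psi> B"
      using A(2) by (auto simp: grad_vimage_def)
    have "emeasure (id_grad_push \<psi> \<mu>) (A \<times> B) = emeasure \<mu> (A \<inter> grad_vimage \<psi> B)"
      unfolding id_grad_push_def emeasure_distr_dom_grad[OF \<mu> cc id_grad_measurable[OF cc] b] set ..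
    moreover have "emeasure \<gamma> (A \<times> B) = emeasure \<mu> (A \<inter> grad_vimage \<psi> B)"
      using coupling_graph_part[OF \<gamma>(1) cc s b] A(2) set by auto
    ultimately show ?thesis by simp
  qed
  have dom: "- {0} - dom_grad \<psi> \<in> sets \<mu>"
    using dom_grad_borel[OF cc] by (intro sets_M0[OF \<mu>]) auto
  have "emeasure \<mu> (- {0} - dom_grad \<psi>) = emeasure \<mu> {}"
    using coupling_AE_grad[OF \<gamma>(1) cc s] by (intro emeasure_eq_AE dom) (auto elim!: eventually_mono)
  then have dom0: "emeasure \<mu> (- {0} - dom_grad \<psi>) = 0" by simp
  have proper: "emeasure \<nu> B = emeasure (grad_push \<psi> \<mu>) B \<and>
      emeasure (grad_push \<psi> \<mu>) B = emeasure \<mu> (- {0} \<inter> grad_vimage \<psi> B)"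
    if p: "proper_coupling \<gamma>" and B: "B \<in> sets borel" "B \<subseteq> - {0}" for B
  proof -
    \<comment> \<open>Properness removes the mass over \<open>x = 0\<close>, so the sum formula
      leaves only the push-forward.\<close>
    have "{0} \<times> (- {0}) \<in> sets \<gamma>"
      by (intro sets_coupling[OF \<gamma>(1)] borel_Times) (auto simp: zero_prod_def)
    then have "emeasure \<gamma> ({0} \<times> B) \<le> emeasure \<gamma> ({0} \<times> (- {0}))" using B by (intro emeasure_mono) auto
    then have "emeasure \<gamma> ({0} \<times> B) = 0" using p by (simp add: proper_coupling_def)
    moreover have "grad_vimage \<psi> B - {0} = - {0} \<inter> grad_vimage \<psi> B" by auto
    ultimately show ?thesis
      using coupling_off_axis[OF \<gamma>(1) cc s B(1)] B(2) emeasure_grad_push[OF \<mu> cc B(1)] by auto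
  qed
  show ?thesis
  proof (intro exI[of _ \<gamma>] conjI exI[of _ \<psi>] ballI impI allI single cc s dom dom0)
    fix \<psi>\<^sub>1 \<psi>\<^sub>2
    assume "closed_convex_fun \<psi>\<^sub>1 \<and> spt \<gamma> \<subseteq> subdiff \<psi>\<^sub>1 \<and> closed_convex_fun \<psi>\<^sub>2 \<and> spt \<gamma> \<subseteq> subdiff \<psi>\<^sub>2"
    then show "AE x in \<mu>. x \<in> dom_grad \<psi>\<^sub>1 \<and> x \<in> dom_grad \<psi>\<^sub>2 \<and> grad \<psi>\<^sub>1 x = grad \<psi>\<^sub>2 x"
      using grad_determined_by_coupling[OF \<gamma>(1)] by blast
  qed (use part coupling_axis[OF \<nu> \<gamma>(1) cc s] proper in blast)+
qed

end
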